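(* Let $\Omega$ be a ball or an annulus in $\mathbb{R}^N$, $N\ge2$, centered at the origin, let $a(s)=1+|s|^k$ with $k>1$, let $p>k+1$ and let $\psi:\mathbb{R}\to(0,\infty)$ be continuous. Let $u$ be a (smooth) solution of Morse index one, i.e. $m(u,J)=1$, to the problem $$\begin{cases}-\mathrm{div}(a(u)Du)+\frac{a'(u)}{2}|Du|^2=\psi(|x|)u^p&\text{in }\Omega,\\ u>0&\text{in }\Omega,\\ u=0&\text{on }\partial\Omega.\end{cases}$$ Let $P\in\Omega$ be a maximum point of $u$ and, when $P$ is not the origin, denote by $r_P$ the axis passing through the origin and $P$. Then the following facts hold: (1) $u$ is axially symmetric with respect to $r_P$ (when $P$ is not the origin); (2) if $\Omega$ is a ball and $P$ is the origin, then $u$ is radially symmetric; (3) if $u$ is not radially symmetric, it is never symmetric with respect to any $(N-1)$-dimensional hyperplane passing through the origin and not passing through the axis $r_P$ (i.e. not containing $r_P$); (4) if $u$ is not radially symmetric, all its critical points belong to the symmetry axis $r_P$.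
   Context: A (smooth) solution is a classical solution $u\in C^2(\Omega)\cap C(\overline{\Omega})$; $Du$ is the gradient. A function is axially symmetric with respect to $r_P$ if it is invariant under every orthogonal transformation of $\mathbb{R}^N$ fixing $r_P$ pointwise. Morse index: let $g:\mathbb{R}\to\mathbb{R}$ be the unique (globally defined, strictly increasing) solution of the Cauchy problem $g'=1/\sqrt{a\circ g}$, $g(0)=0$. Put $f(x,s)=\psi(|x|)s^p$ for $s\ge0$, $f(x,s)=0$ for $s<0$, and $h(x,s)=f(x,g(s))\,a(g(s))^{-1/2}$; let $h'=\partial_sh$. Then $u$ is a $C^2$ solution of the quasi-linear problem if and only if $v=g^{-1}(u)$ is a $C^2$ solution of $-\Delta v=h(x,v)$ in $\Omega$, $v=0$ on $\partial\Omega$. The functional formally associated with the quasi-linear problem is $J(u)=\frac12\int_\Omega a(u)|Du|^2-\int_\Omega F(x,u)$, with $F(x,s)=\int_0^sf(x,\tau)\,d\tau$. The Morse index $m(u,J)$ of a smooth solution $u$ is defined as the supremum of the dimensions of the linear subspaces $V\subset H^1_0(\Omega)$ on which the quadratic form $\varphi\mapsto\int_\Omega|D\varphi|^2-\int_\Omega h'(x,v)\varphi^2$, with $v=g^{-1}(u)$, is negative definite. *)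

theory Defs
  imports "HOL-Analysis.Analysis" "HOL-Library.Function_Algebras"
begin

section \<open>Real functions as a real vector space\<close>

instantiation "fun" :: (type, real_vector) real_vector
begin

definition scaleR_fun :: "real \<Rightarrow> ('a \<Rightarrow> 'b) \<Rightarrow> 'a \<Rightarrow> 'b" where
  "scaleR_fun c f = (\<lambda>x. c *\<^sub>R f x)"

instance
  by standard (simp_all add: scaleR_fun_def fun_eq_iff scaleR_add_right scaleR_add_left)

end

(* The library function dim returns 0 on infinite-dimensional subspaces. *)
definition vdim :: "'b::real_vector set \<Rightarrow> enat" where
  "vdim V = (if \<exists>B. finite B \<and> V \<subseteq> span B then enat (dim V) else \<infinity>)"


section \<open>Differential operators and classical regularity\<close>

definition grad :: "('a::euclidean_space \<Rightarrow> real) \<Rightarrow> 'a \<Rightarrow> 'a" where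
  "grad f x = (\<Sum>b\<in>Basis. frechet_derivative f (at x) b *\<^sub>R b)"

definition divergence :: "('a::euclidean_space \<Rightarrow> 'a) \<Rightarrow> 'a \<Rightarrow> real" where
  "divergence F x = (\<Sum>b\<in>Basis. frechet_derivative F (at x) b \<bullet> b)"

(* Functions of class C^n on an open set S. *)
primrec Ck_on :: "nat \<Rightarrow> ('a::euclidean_space \<Rightarrow> real) \<Rightarrow> 'a set \<Rightarrow> bool" where
  "Ck_on 0 f S \<longleftrightarrow> continuous_on S f"
| "Ck_on (Suc n) f S \<longleftrightarrow> (\<forall>x\<in>S. f differentiable (at x)) \<and>
     (\<forall>b\<in>Basis. Ck_on n (\<lambda>x. frechet_derivative f (at x) b) S)"


section \<open>The Sobolev space of functions with zero trace\<close>

definition test_function :: "'a::euclidean_space set \<Rightarrow> ('a \<Rightarrow> real) \<Rightarrow> bool" where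
  "test_function \<Omega> \<eta> \<longleftrightarrow> (\<forall>n. Ck_on n \<eta> UNIV) \<and>
     (\<exists>K. compact K \<and> K \<subseteq> \<Omega> \<and> (\<forall>x. x \<notin> K \<longrightarrow> \<eta> x = 0))"

definition L2_on :: "'a::euclidean_space set \<Rightarrow> ('a \<Rightarrow> 'b::euclidean_space) \<Rightarrow> bool" where
  "L2_on \<Omega> f \<longleftrightarrow> f \<in> borel_measurable (lebesgue_on \<Omega>) \<and>
     integrable (lebesgue_on \<Omega>) (\<lambda>x. (norm (f x))\<^sup>2)"

definition is_weak_grad ::
  "'a::euclidean_space set \<Rightarrow> ('a \<Rightarrow> real) \<Rightarrow> ('a \<Rightarrow> 'a) \<Rightarrow> bool" where
  "is_weak_grad \<Omega> \<phi> G \<longleftrightarrow> (\<forall>\<eta>. test_function \<Omega> \<eta> \<longrightarrow> (\<forall>b\<in>Basis.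
     (\<integral>x. \<phi> x * (grad \<eta> x \<bullet> b) \<partial>lebesgue_on \<Omega>) = - (\<integral>x. (G x \<bullet> b) * \<eta> x \<partial>lebesgue_on \<Omega>)))"

(* Elements of Sobolev spaces are represented by functions on the whole space; only their
   values almost everywhere in Omega matter. *)
definition H1 :: "'a::euclidean_space set \<Rightarrow> ('a \<Rightarrow> real) set" where
  "H1 \<Omega> = {\<phi>. L2_on \<Omega> \<phi> \<and> (\<exists>G. L2_on \<Omega> G \<and> is_weak_grad \<Omega> \<phi> G)}"

(* For members of H1 the choice is unique up to null sets. *)
definition wgrad :: "'a::euclidean_space set \<Rightarrow> ('a \<Rightarrow> real) \<Rightarrow> 'a \<Rightarrow> 'a" where
  "wgrad \<Omega> \<phi> = (SOME G. L2_on \<Omega> G \<and> is_weak_grad \<Omega> \<phi> G)"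

definition H1_norm :: "'a::euclidean_space set \<Rightarrow> ('a \<Rightarrow> real) \<Rightarrow> real" where
  "H1_norm \<Omega> \<phi> = sqrt ((\<integral>x. (\<phi> x)\<^sup>2 \<partial>lebesgue_on \<Omega>) +
     (\<integral>x. (norm (wgrad \<Omega> \<phi> x))\<^sup>2 \<partial>lebesgue_on \<Omega>))"

definition H10 :: "'a::euclidean_space set \<Rightarrow> ('a \<Rightarrow> real) set" where
  "H10 \<Omega> = {\<phi> \<in> H1 \<Omega>. \<forall>\<epsilon>>0. \<exists>\<eta>. test_function \<Omega> \<eta> \<and> H1_norm \<Omega> (\<lambda>x. \<phi> x - \<eta> x) < \<epsilon>}"


section \<open>The quasi-linear problem and its Morse index\<close>

definition classical_solution ::
  "'a::euclidean_space set \<Rightarrow> (real \<Rightarrow> real) \<Rightarrow> (real \<Rightarrow> real) \<Rightarrow> real \<Rightarrow> ('a \<Rightarrow> real) \<Rightarrow> bool" where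
  "classical_solution \<Omega> a \<psi> p u \<longleftrightarrow>
     Ck_on 2 u \<Omega> \<and> continuous_on (closure \<Omega>) u \<and>
     (\<forall>x\<in>\<Omega>. - divergence (\<lambda>y. a (u y) *\<^sub>R grad u y) x + deriv a (u x) / 2 * (norm (grad u x))\<^sup>2
              = \<psi> (norm x) * u x powr p) \<and>
     (\<forall>x\<in>\<Omega>. u x > 0) \<and>
     (\<forall>x\<in>frontier \<Omega>. u x = 0)"

definition change_var :: "(real \<Rightarrow> real) \<Rightarrow> real \<Rightarrow> real" where
  "change_var a = (THE g. (\<forall>s. (g has_real_derivative 1 / sqrt (a (g s))) (at s)) \<and> g 0 = 0)"

definition nonlin :: "(real \<Rightarrow> real) \<Rightarrow> real \<Rightarrow> 'a::euclidean_space \<Rightarrow> real \<Rightarrow> real" where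
  "nonlin \<psi> p x s = (if s \<ge> 0 then \<psi> (norm x) * s powr p else 0)"

definition semilin_nonlin ::
  "(real \<Rightarrow> real) \<Rightarrow> (real \<Rightarrow> real) \<Rightarrow> real \<Rightarrow> 'a::euclidean_space \<Rightarrow> real \<Rightarrow> real" where
  "semilin_nonlin a \<psi> p x s =
     nonlin \<psi> p x (change_var a s) * a (change_var a s) powr (- 1 / 2)"

definition morse_form ::
  "'a::euclidean_space set \<Rightarrow> (real \<Rightarrow> real) \<Rightarrow> (real \<Rightarrow> real) \<Rightarrow> real \<Rightarrow> ('a \<Rightarrow> real)
   \<Rightarrow> ('a \<Rightarrow> real) \<Rightarrow> real" where
  "morse_form \<Omega> a \<psi> p u \<phi> =
     (let v = (\<lambda>x. inv (change_var a) (u x)) in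
       (\<integral>x. (norm (wgrad \<Omega> \<phi> x))\<^sup>2 \<partial>lebesgue_on \<Omega>)
       - (\<integral>x. deriv (semilin_nonlin a \<psi> p x) (v x) * (\<phi> x)\<^sup>2 \<partial>lebesgue_on \<Omega>))"

(* Negative definiteness forces a non-zero element of V not to vanish almost everywhere in Omega,
   so V embeds into the quotient by almost-everywhere equality; conversely every
   finite-dimensional space of classes lifts to a space of representatives.  Hence the supremum
   is the same as for spaces of classes. *)
definition morse_index ::
  "'a::euclidean_space set \<Rightarrow> (real \<Rightarrow> real) \<Rightarrow> (real \<Rightarrow> real) \<Rightarrow> real \<Rightarrow> ('a \<Rightarrow> real) \<Rightarrow> enat" where
  "morse_index \<Omega> a \<psi> p u =
     (SUP V\<in>{V. subspace V \<and> V \<subseteq> H10 \<Omega> \<and> (\<forall>\<phi>\<in>V. \<phi> \<noteq> 0 \<longrightarrow> morse_form \<Omega> a \<psi> p u \<phi> < 0)}. vdim V)"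


section \<open>Domains and symmetry\<close>

definition is_ball :: "'a::euclidean_space set \<Rightarrow> bool" where
  "is_ball \<Omega> \<longleftrightarrow> (\<exists>R>0. \<Omega> = ball 0 R)"

definition is_annulus :: "'a::euclidean_space set \<Rightarrow> bool" where
  "is_annulus \<Omega> \<longleftrightarrow> (\<exists>r R. 0 < r \<and> r < R \<and> \<Omega> = {x. r < norm x \<and> norm x < R})"

definition axis_through :: "'a::euclidean_space \<Rightarrow> 'a set" where
  "axis_through P = span {P}"

definition axially_symmetric :: "'a::euclidean_space set \<Rightarrow> ('a \<Rightarrow> real) \<Rightarrow> 'a set \<Rightarrow> bool" where
  "axially_symmetric \<Omega> u A \<longleftrightarrow>
     (\<forall>T. orthogonal_transformation T \<and> (\<forall>y\<in>A. T y = y) \<longrightarrow> (\<forall>x\<in>\<Omega>. u (T x) = u x))"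

definition radially_symmetric :: "'a::euclidean_space set \<Rightarrow> ('a \<Rightarrow> real) \<Rightarrow> bool" where
  "radially_symmetric \<Omega> u \<longleftrightarrow> (\<forall>x\<in>\<Omega>. \<forall>y\<in>\<Omega>. norm x = norm y \<longrightarrow> u x = u y)"

(* Symmetry with respect to the hyperplane through the origin with normal vector e. *)
definition hyperplane_symmetric :: "'a::euclidean_space set \<Rightarrow> ('a \<Rightarrow> real) \<Rightarrow> 'a \<Rightarrow> bool" where
  "hyperplane_symmetric \<Omega> u e \<longleftrightarrow>
     (\<forall>x\<in>\<Omega>. u (x - (2 * (x \<bullet> e) / (e \<bullet> e)) *\<^sub>R e) = u x)"

end

theory Submission
  imports Defs
begin

text \<open>
  Let \<open>A\<close> be the primitive of \<open>sqrt a\<close> with \<open>A 0 = 0\<close>, the inverse of the change of variable.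
  Then \<open>v = A \<circ> u\<close> is a positive solution of \<open>- \<Delta> v = \<psi>(|x|) F(v)\<close> with zero boundary values,
  where \<open>F (A t) = t powr p / sqrt (a t)\<close>.  The condition \<open>p > k + 1\<close> makes \<open>F\<close> increasing and
  strictly convex on the positive axis (\<open>slope_strict_mono\<close>).  All claims are statements about the
  differences \<open>gap e = v - v \<circ> reflect e\<close> on the half domains \<open>half e = {x \<in> \<Omega>. x \<bullet> e > 0}\<close>.

  The sign of the gap.  Suppose that \<open>gap e\<close> is positive somewhere in \<open>half e\<close>, and test its
  equation with its positive part \<open>\<phi>\<close> on \<open>half e\<close>.  Strict convexity,
  \<open>F(v) - F(v \<circ> reflect e) < F'(v) gap e\<close> where the gap is positive, turns the energy identity into
  \<open>\<integral>|D\<phi>|\<^sup>2 < \<integral> \<psi> F'(v) \<phi>\<^sup>2\<close>: the quadratic form of the Morse index is negative at a function that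
  lives in \<open>half e\<close> (\<open>negative_direction\<close>).  If the gap also took a negative value in \<open>half e\<close>, it
  would take a positive value in the opposite half domain, and a second negative direction with
  disjoint support would raise the Morse index to at least two (\<open>morse_index_ge_2\<close>).  So every gap has
  a constant sign on its half domain (\<open>dominates_cases\<close>).

  Rigidity.  Since \<open>F\<close> is increasing, a nonnegative gap is superharmonic.  By the strong minimum
  principle it vanishes identically as soon as it vanishes at a point of \<open>half e\<close>, and by Hopf's
  boundary point lemma as soon as \<open>v\<close> has a critical point on the mirror \<open>{x \<in> \<Omega>. x \<bullet> e = 0}\<close>
  (\<open>dominates_touching\<close>, \<open>dominates_critical\<close>).

  Symmetry.  The maximum point \<open>P\<close> is critical, hence every mirror through \<open>P\<close> and the origin is a
  mirror symmetry.  Two points of equal norm and equal inner product with \<open>P\<close> are exchanged by such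
  a reflection, which gives axial symmetry, and radial symmetry when \<open>P = 0\<close>.  If \<open>e \<bullet> P > 0\<close>, the gap of
  \<open>e\<close> is nonnegative, because it is nonnegative at \<open>P\<close>.  A mirror symmetry that moves \<open>P\<close> produces
  a second maximum point \<open>P'\<close>; for every \<open>e\<close> in the open cone \<open>e \<bullet> P > 0 > e \<bullet> P'\<close> the gap is both
  nonnegative and nonpositive, and this open cone of mirror symmetries makes \<open>v\<close> locally constant, hence
  constant, on every sphere.  Finally, a critical point off the axis lies on a mirror with
  \<open>e \<bullet> P > 0\<close>, which then is a mirror symmetry that moves \<open>P\<close>, so that the solution is radial.

  Function spaces.  The Morse index refers to \<open>H10\<close> and to weak gradients, which are defined by
  smooth test functions, whereas the truncated gaps are only of class \<open>C1\<close> with compact support.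
  Mollification shows that they belong to \<open>H10\<close> (\<open>C1_compact_H10\<close>), and the fundamental lemma of the
  calculus of variations shows that their weak gradient is the classical one (\<open>weak_grad_unique\<close>,
  \<open>C1_compact_wgrad\<close>).
\<close>

section \<open>Classes of differentiable functions and smooth bumps\<close>

lemma Ck_on_cong:
  assumes "open S" "\<And>x. x \<in> S \<Longrightarrow> f x = g x" "Ck_on n f S"
  shows "Ck_on n g S"
  using assms(2,3)
proof (induction n arbitrary: f g)
  case 0
  then show ?case by (simp cong: continuous_on_cong)
next
  case (Suc n)
  have D: "frechet_derivative g (at x) = frechet_derivative f (at x)" "g differentiable (at x)" if "x \<in> S" for x
  proof -
    have "f differentiable (at x)" using Suc.prems that by simp
    then have "(f has_derivative frechet_derivative f (at x)) (at x)"
      by (simp add: frechet_derivative_works)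
    then have "(g has_derivative frechet_derivative f (at x)) (at x)"
      by (rule has_derivative_transform_within_open) (use that Suc.prems assms(1) in auto)
    then show "frechet_derivative g (at x) = frechet_derivative f (at x)" "g differentiable (at x)"
      by (rule frechet_derivative_at[symmetric], auto simp: differentiable_def)
  qed
  have "Ck_on n (\<lambda>x. frechet_derivative g (at x) b) S" if "b \<in> Basis" for b
    by (rule Suc.IH[of "\<lambda>x. frechet_derivative f (at x) b"]) (use that Suc.prems D in simp_all)
  then show ?case using D(2) by simp
qed

lemma Ck_on_SucI:
  assumes "open S" "\<And>x. x \<in> S \<Longrightarrow> (f has_derivative f' x) (at x)"
    "\<And>b. b \<in> Basis \<Longrightarrow> Ck_on n (\<lambda>x. f' x b) S"
  shows "Ck_on (Suc n) f S"
proof -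
  have "frechet_derivative f (at x) = f' x" if "x \<in> S" for x
    using assms(2)[OF that] frechet_derivative_at by metis
  then have "Ck_on n (\<lambda>x. frechet_derivative f (at x) b) S" if "b \<in> Basis" for b
    by (intro Ck_on_cong[OF assms(1) _ assms(3)[OF that]]) auto
  then show ?thesis using assms(2) by (auto simp: differentiable_def)
qed

lemma Ck_on_SucD:
  assumes "Ck_on (Suc n) f S" "x \<in> S"
  shows "(f has_derivative frechet_derivative f (at x)) (at x)"
  using assms by (simp add: frechet_derivative_works)

lemma Ck_on_Suc_imp: "Ck_on (Suc n) f S \<Longrightarrow> Ck_on n f S"
proof (induction n arbitrary: f)
  case 0
  then show ?case
    by (auto intro!: continuous_at_imp_continuous_on differentiable_imp_continuous_within)
qed auto

lemma Ck_on_const: "Ck_on n (\<lambda>x. c) S"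
  by (induction n arbitrary: c) auto

lemma Ck_on_linear:
  assumes "open S" "bounded_linear f" shows "Ck_on n f S"
proof (cases n)
  case 0
  then show ?thesis using assms by (simp add: linear_continuous_on)
next
  case (Suc m)
  have "Ck_on (Suc m) f S"
    by (rule Ck_on_SucI[where f' = "\<lambda>x. f"]) (use assms in \<open>auto intro: bounded_linear_imp_has_derivative Ck_on_const\<close>)
  then show ?thesis using Suc by simp
qed

lemma Ck_on_add:
  assumes "open S" shows "Ck_on n f S \<Longrightarrow> Ck_on n g S \<Longrightarrow> Ck_on n (\<lambda>x. f x + g x) S"
proof (induction n arbitrary: f g)
  case 0
  then show ?case by (auto intro: continuous_intros)
next
  case (Suc n)
  show ?case
    by (rule Ck_on_SucI[OF assms, where f' = "\<lambda>x h. frechet_derivative f (at x) h + frechet_derivative g (at x) h"])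
      (use Suc in \<open>auto intro!: has_derivative_add simp: frechet_derivative_works[symmetric]\<close>)
qed

lemma Ck_on_mult:
  assumes "open S" shows "Ck_on n f S \<Longrightarrow> Ck_on n g S \<Longrightarrow> Ck_on n (\<lambda>x. f x * g x) S"
proof (induction n arbitrary: f g)
  case 0
  then show ?case by (auto intro: continuous_intros)
next
  case (Suc n)
  show ?case
  proof (rule Ck_on_SucI[OF assms, where f' = "\<lambda>x h. f x * frechet_derivative g (at x) h + frechet_derivative f (at x) h * g x"])
    show "((\<lambda>x. f x * g x) has_derivative (\<lambda>h. f x * frechet_derivative g (at x) h + frechet_derivative f (at x) h * g x)) (at x)"
      if "x \<in> S" for x
      using Ck_on_SucD[OF Suc.prems(1) that] Ck_on_SucD[OF Suc.prems(2) that] by (rule has_derivative_mult)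
    show "Ck_on n (\<lambda>x. f x * frechet_derivative g (at x) b + frechet_derivative f (at x) b * g x) S"
      if "b \<in> Basis" for b
      using Suc.prems Suc.prems[THEN Ck_on_Suc_imp] that by (intro Ck_on_add assms Suc.IH) simp_all
  qed
qed

lemma Ck_on_prod:
  assumes "open S" "finite I" "\<And>i. i \<in> I \<Longrightarrow> Ck_on n (f i) S"
  shows "Ck_on n (\<lambda>x. \<Prod>i\<in>I. f i x) S"
  using assms(2,3) by (induction I rule: finite_induct) (auto intro: Ck_on_const Ck_on_mult assms(1))

text \<open>The functions \<open>exp (- 1 / t) / t ^ k\<close>, extended by zero.  The power is carried along because the
  derivative of a member of this family is a combination of two other members, so smoothness of
  all of them follows by one induction.\<close>

definition flat_exp :: "nat \<Rightarrow> real \<Rightarrow> real" where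
  "flat_exp k t = (if t > 0 then inverse t ^ k * exp (- inverse t) else 0)"

lemma flat_exp_tendsto_0: "(flat_exp k \<longlongrightarrow> 0) (at 0)"
proof -
  have r: "(flat_exp k \<longlongrightarrow> 0) (at_right 0)"
  proof -
    have "((\<lambda>s. s ^ k / exp s) \<longlongrightarrow> (0::real)) at_top" by (rule tendsto_power_div_exp_0)
    then have "((\<lambda>t::real. inverse t ^ k / exp (inverse t)) \<longlongrightarrow> 0) (at_right 0)"
      by (rule filterlim_compose) (rule filterlim_inverse_at_top_right)
    moreover have "\<forall>\<^sub>F t in at_right 0. inverse t ^ k / exp (inverse t) = flat_exp k t"
      by (auto simp: eventually_at_filter flat_exp_def exp_minus divide_inverse)
    ultimately show ?thesis by (rule Lim_transform_eventually)
  qed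
  have "\<forall>\<^sub>F t in at_left 0. 0 = flat_exp k t"
    by (auto simp: eventually_at_filter flat_exp_def)
  then have "(flat_exp k \<longlongrightarrow> 0) (at_left 0)"
    by (rule Lim_transform_eventually[rotated]) simp
  with r show ?thesis by (simp add: filterlim_at_split)
qed

lemma flat_exp_deriv:
  "(flat_exp k has_real_derivative flat_exp (k+2) t - of_nat k * flat_exp (Suc k) t) (at t)"
proof -
  consider "t > 0" | "t < 0" | "t = 0" by linarith
  then show ?thesis
  proof cases
    case 1
    have "((\<lambda>t. inverse t ^ k * exp (- inverse t)) has_real_derivative
        (inverse t ^ k * (exp (- inverse t) * inverse t ^ 2) + of_nat k * inverse t ^ (k - 1) * (- (inverse t ^ 2)) * exp (- inverse t))) (at t)"
      using 1 by (auto intro!: derivative_eq_intros simp: power2_eq_square)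
    moreover have "inverse t ^ k * (exp (- inverse t) * inverse t ^ 2) + of_nat k * inverse t ^ (k - 1) * (- (inverse t ^ 2)) * exp (- inverse t)
       = flat_exp (k+2) t - of_nat k * flat_exp (Suc k) t"
      using 1 by (cases k) (auto simp: flat_exp_def power2_eq_square power_add algebra_simps)
    ultimately have "((\<lambda>t. inverse t ^ k * exp (- inverse t)) has_real_derivative flat_exp (k+2) t - of_nat k * flat_exp (Suc k) t) (at t)"
      by simp
    then show ?thesis
      by (rule has_field_derivative_transform_within_open[where S = "{0<..}"]) (use 1 in \<open>auto simp: flat_exp_def\<close>)
  next
    case 2
    have "((\<lambda>t::real. 0) has_real_derivative 0) (at t)" by simp
    then have "(flat_exp k has_real_derivative 0) (at t)"
      by (rule has_field_derivative_transform_within_open[where S = "{..<0}"]) (use 2 in \<open>auto simp: flat_exp_def\<close>)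
    then show ?thesis using 2 by (simp add: flat_exp_def)
  next
    case 3
    have "(\<lambda>h. (flat_exp k (0 + h) - flat_exp k 0) / h) = flat_exp (Suc k)"
      by (auto simp: flat_exp_def field_simps)
    then have "(flat_exp k has_real_derivative 0) (at 0)"
      unfolding DERIV_def using flat_exp_tendsto_0[of "Suc k"] by simp
    then show ?thesis using 3 by (simp add: flat_exp_def)
  qed
qed

lemma flat_exp_nonneg: "flat_exp k t \<ge> 0"
  by (simp add: flat_exp_def)

text \<open>The induction on \<open>n\<close> treats all exponents \<open>k\<close> at once, because the derivative raises them.\<close>

lemma Ck_on_flat_exp_comp:
  assumes "open S" "\<And>n. Ck_on n q S"
  shows "Ck_on n (\<lambda>x. flat_exp k (q x)) S"
proof (induction n arbitrary: k)
  case 0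
  have "isCont (flat_exp k) t" for t using flat_exp_deriv DERIV_isCont by blast
  then have "continuous_on UNIV (flat_exp k)" by (simp add: continuous_at_imp_continuous_on)
  moreover have "continuous_on S q" using assms(2)[of 0] by simp
  ultimately show ?case by (simp add: continuous_on_compose2)
next
  case (Suc n)
  show ?case
  proof (rule Ck_on_SucI[OF assms(1), where f' = "\<lambda>x h. (flat_exp (k+2) (q x) + (- of_nat k) * flat_exp (Suc k) (q x)) * frechet_derivative q (at x) h"])
    show "((\<lambda>x. flat_exp k (q x)) has_derivative (\<lambda>h. (flat_exp (k+2) (q x) + (- of_nat k) * flat_exp (Suc k) (q x)) * frechet_derivative q (at x) h)) (at x)"
      if "x \<in> S" for x
    proof -
      have "(flat_exp k has_derivative (*) (flat_exp (k+2) (q x) - of_nat k * flat_exp (Suc k) (q x))) (at (q x))"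
        using flat_exp_deriv by (simp add: has_field_derivative_def)
      from has_derivative_compose[OF Ck_on_SucD[OF assms(2) that] this] show ?thesis by simp
    qed
    show "Ck_on n (\<lambda>x. (flat_exp (k+2) (q x) + (- of_nat k) * flat_exp (Suc k) (q x)) * frechet_derivative q (at x) b) S"
      if "b \<in> Basis" for b
      using assms(2)[of "Suc n"] that
      by (intro Ck_on_mult Ck_on_add Ck_on_const assms Suc.IH) auto
  qed
qed

text \<open>Every factor is positive exactly when one coordinate of \<open>x\<close> lies strictly between those of \<open>l\<close> and \<open>h\<close>.
  Since \<open>exp (- 1 / (m c))\<close> tends to 1 for \<open>c > 0\<close>, these bumps converge to the indicator of the box as
  \<open>m\<close> grows.  Boxes are used because they are stable under intersection.\<close>

definition box_bump :: "'a::euclidean_space \<Rightarrow> 'a \<Rightarrow> nat \<Rightarrow> 'a \<Rightarrow> real" where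
  "box_bump l h m x = (\<Prod>b\<in>Basis. flat_exp 0 (real m * ((x \<bullet> b - l \<bullet> b) * (h \<bullet> b - x \<bullet> b))))"

lemma Ck_on_box_bump: "Ck_on n (box_bump l h m) UNIV"
proof -
  have l: "Ck_on n (\<lambda>x. x \<bullet> b + c) UNIV" "Ck_on n (\<lambda>x. c + (-1) * (x \<bullet> b)) UNIV" for n and b :: 'a and c
    by (intro Ck_on_add Ck_on_mult Ck_on_const Ck_on_linear open_UNIV bounded_linear_inner_left)+
  have "Ck_on n (\<lambda>x. real m * ((x \<bullet> b + (- (l \<bullet> b))) * (h \<bullet> b + (-1) * (x \<bullet> b)))) UNIV" for n and b :: 'a
    by (intro Ck_on_mult Ck_on_const l open_UNIV)
  then show ?thesis
    unfolding box_bump_def by (intro Ck_on_prod Ck_on_flat_exp_comp) auto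
qed

lemma box_bump_bounds: "0 \<le> box_bump l h m x" "box_bump l h m x \<le> 1"
proof -
  have "flat_exp 0 t \<le> 1" for t by (simp add: flat_exp_def)
  then show "0 \<le> box_bump l h m x" "box_bump l h m x \<le> 1"
    unfolding box_bump_def by (auto intro!: prod_nonneg prod_le_1 flat_exp_nonneg)
qed

lemma prod_pos_iff_between:
  fixes x l h :: real assumes "l < h"
  shows "(x - l) * (h - x) > 0 \<longleftrightarrow> l < x \<and> x < h"
  using assms by (auto simp: zero_less_mult_iff)

lemma box_bump_pos:
  assumes "x \<in> box l h" "m > 0" shows "box_bump l h m x > 0"
proof -
  have "(x \<bullet> b - l \<bullet> b) * (h \<bullet> b - x \<bullet> b) > 0" if "b \<in> Basis" for b
    using assms(1) that by (auto simp: mem_box)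
  then show ?thesis using assms(2) by (auto simp: box_bump_def flat_exp_def intro!: prod_pos)
qed

lemma box_bump_outside:
  assumes "x \<notin> box l h" "box l h \<noteq> {}" shows "box_bump l h m x = 0"
proof -
  obtain b where b: "b \<in> Basis" "\<not> (l \<bullet> b < x \<bullet> b \<and> x \<bullet> b < h \<bullet> b)" using assms(1) by (auto simp: mem_box)
  have "l \<bullet> b < h \<bullet> b" using assms(2) b(1) by (auto simp: box_ne_empty)
  then have "\<not> (x \<bullet> b - l \<bullet> b) * (h \<bullet> b - x \<bullet> b) > 0" using b(2) prod_pos_iff_between by blast
  then have "\<not> real m * ((x \<bullet> b - l \<bullet> b) * (h \<bullet> b - x \<bullet> b)) > 0" by (auto simp: zero_less_mult_iff)
  then have "flat_exp 0 (real m * ((x \<bullet> b - l \<bullet> b) * (h \<bullet> b - x \<bullet> b))) = 0" by (simp only: flat_exp_def if_False)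
  then show ?thesis unfolding box_bump_def using b(1) by (intro prod_zero) auto
qed

lemma box_bump_tendsto:
  assumes "box l h \<noteq> {}"
  shows "(\<lambda>m. box_bump l h m x) \<longlonglongrightarrow> indicator (box l h) x"
proof (cases "x \<in> box l h")
  case True
  have "(\<lambda>m. flat_exp 0 (real m * c)) \<longlonglongrightarrow> 1" if "c > 0" for c
  proof -
    have "(\<lambda>m. exp (- (inverse (real m) * inverse c))) \<longlonglongrightarrow> exp (- (0 * inverse c))"
      by (intro tendsto_intros lim_inverse_n)
    moreover have "\<forall>\<^sub>F m in sequentially. exp (- (inverse (real m) * inverse c)) = flat_exp 0 (real m * c)"
      using eventually_gt_at_top[of 0] by eventually_elim (use that in \<open>auto simp: flat_exp_def\<close>)
    ultimately show ?thesis by (auto dest: Lim_transform_eventually)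
  qed
  moreover have "(x \<bullet> b - l \<bullet> b) * (h \<bullet> b - x \<bullet> b) > 0" if "b \<in> Basis" for b
    using True that by (auto simp: mem_box)
  ultimately have "(\<lambda>m. box_bump l h m x) \<longlonglongrightarrow> (\<Prod>b\<in>(Basis::'a set). 1)"
    unfolding box_bump_def by (intro tendsto_prod) auto
  then show ?thesis using True by simp
next
  case False
  then show ?thesis using box_bump_outside[OF _ assms] by simp
qed

lemma test_function_box_bump:
  assumes "cbox l h \<subseteq> \<Omega>" "box l h \<noteq> {}"
  shows "test_function \<Omega> (box_bump l h m)"
  unfolding test_function_def
  using assms Ck_on_box_bump box_bump_outside[OF _ assms(2)] box_subset_cbox
  by (metis compact_cbox subsetD)

section \<open>Compactly supported functions of class C1\<close>

lemma has_derivative_grad: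
  assumes "f differentiable (at x)"
  shows "(f has_derivative (\<lambda>h. grad f x \<bullet> h)) (at x)"
proof -
  have d: "(f has_derivative frechet_derivative f (at x)) (at x)"
    using assms by (simp add: frechet_derivative_works)
  then interpret bounded_linear "frechet_derivative f (at x)" by (rule has_derivative_bounded_linear)
  have "frechet_derivative f (at x) h = grad f x \<bullet> h" for h
  proof -
    have "frechet_derivative f (at x) h = frechet_derivative f (at x) (\<Sum>b\<in>Basis. (h \<bullet> b) *\<^sub>R b)"
      by (simp add: euclidean_representation)
    also have "\<dots> = (\<Sum>b\<in>Basis. (h \<bullet> b) * frechet_derivative f (at x) b)"
      by (simp add: sum scale)
    also have "\<dots> = grad f x \<bullet> h"
      by (simp add: grad_def inner_sum_left inner_commute[of h] mult.commute)
    finally show ?thesis .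
  qed
  then have "frechet_derivative f (at x) = (\<lambda>h. grad f x \<bullet> h)" by (rule ext)
  then show ?thesis using d by simp
qed

lemma grad_eqI:
  assumes "(f has_derivative (\<lambda>h. g \<bullet> h)) (at x)" shows "grad f x = g"
proof -
  have "frechet_derivative f (at x) = (\<lambda>h. g \<bullet> h)"
    using assms frechet_derivative_at by metis
  then show ?thesis by (simp add: grad_def euclidean_representation)
qed

lemma Ck_on_grad_inner:
  assumes "Ck_on (Suc n) f S" "open S" shows "Ck_on n (\<lambda>x. grad f x \<bullet> b) S"
proof -
  have "Ck_on n (\<lambda>x. \<Sum>c\<in>B. frechet_derivative f (at x) c * (c \<bullet> b)) S" if "B \<subseteq> Basis" for B
    using finite_subset[OF that finite_Basis] that
    by (induction B rule: finite_induct) (use assms in \<open>auto intro!: Ck_on_const Ck_on_add Ck_on_mult\<close>)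
  then show ?thesis by (simp add: grad_def inner_sum_left)
qed

lemma continuous_on_grad:
  assumes "Ck_on (Suc n) f S" "open S" shows "continuous_on S (grad f)"
proof -
  have "Ck_on (Suc 0) f S" using assms(1)
  proof (induction n)
    case (Suc n)
    show ?case by (rule Suc.IH[OF Ck_on_Suc_imp[OF Suc.prems]])
  qed
  then show ?thesis
    using Ck_on_grad_inner[of 0 f S] assms(2)
    by (subst continuous_on_componentwise) (auto simp del: Ck_on.simps(2))
qed

text \<open>The support \<open>K\<close> and the gradient \<open>G\<close> are explicit, so that the gradient can be handled by its formula
  instead of by \<open>grad f\<close>.\<close>

definition C1_compact :: "'a::euclidean_space set \<Rightarrow> ('a \<Rightarrow> real) \<Rightarrow> ('a \<Rightarrow> 'a) \<Rightarrow> bool" where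
  "C1_compact K f G \<longleftrightarrow> compact K \<and> (\<forall>x. (f has_derivative (\<lambda>h. G x \<bullet> h)) (at x)) \<and>
     continuous_on UNIV G \<and> (\<forall>x. x \<notin> K \<longrightarrow> f x = 0)"

lemma C1_compact_continuous: "C1_compact K f G \<Longrightarrow> continuous_on UNIV f"
  unfolding C1_compact_def
  by (meson continuous_at_imp_continuous_on has_derivative_continuous)

lemma C1_compact_grad: "C1_compact K f G \<Longrightarrow> grad f x = G x"
  unfolding C1_compact_def by (auto intro: grad_eqI)

lemma C1_compact_outside:
  assumes "C1_compact K f G" "x \<notin> K" shows "G x = 0"
proof -
  have "open (- K)" using assms by (auto simp: C1_compact_def compact_imp_closed open_Compl)
  have "(f has_derivative (\<lambda>h. 0 \<bullet> h)) (at x)"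
    by (rule has_derivative_transform_within_open[where f = "\<lambda>_. 0", OF _ \<open>open (- K)\<close>])
      (use assms in \<open>auto simp: C1_compact_def\<close>)
  then show ?thesis using C1_compact_grad[OF assms(1)] grad_eqI by metis
qed

lemma C1_compact_mono: "C1_compact K f G \<Longrightarrow> K \<subseteq> L \<Longrightarrow> compact L \<Longrightarrow> C1_compact L f G"
  unfolding C1_compact_def by auto

lemma C1_compact_lincomb:
  assumes "C1_compact K f G" "C1_compact K f' G'"
  shows "C1_compact K (\<lambda>x. c * f x + d * f' x) (\<lambda>x. c *\<^sub>R G x + d *\<^sub>R G' x)"
proof -
  have "((\<lambda>x. c * f x + d * f' x) has_derivative (\<lambda>h. (c *\<^sub>R G x + d *\<^sub>R G' x) \<bullet> h)) (at x)" for x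
  proof -
    have 1: "(f has_derivative (\<lambda>h. G x \<bullet> h)) (at x)" "(f' has_derivative (\<lambda>h. G' x \<bullet> h)) (at x)"
      using assms by (auto simp: C1_compact_def)
    have "((\<lambda>x. c * f x + d * f' x) has_derivative (\<lambda>h. c * (G x \<bullet> h) + d * (G' x \<bullet> h))) (at x)"
      by (intro has_derivative_add has_derivative_mult_right 1)
    then show ?thesis by (simp add: inner_add_left)
  qed
  then show ?thesis using assms unfolding C1_compact_def by (auto intro!: continuous_intros)
qed

lemma C1_compact_mult:
  assumes "C1_compact K f G" "\<And>x. (g has_derivative (\<lambda>h. H x \<bullet> h)) (at x)" "continuous_on UNIV H"
  shows "C1_compact K (\<lambda>x. f x * g x) (\<lambda>x. f x *\<^sub>R H x + g x *\<^sub>R G x)"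
proof -
  have "((\<lambda>x. f x * g x) has_derivative (\<lambda>h. (f x *\<^sub>R H x + g x *\<^sub>R G x) \<bullet> h)) (at x)" for x
  proof -
    have 1: "(f has_derivative (\<lambda>h. G x \<bullet> h)) (at x)"
      using assms by (auto simp: C1_compact_def)
    from has_derivative_mult[OF 1 assms(2)[of x]]
    show ?thesis by (simp add: inner_add_left mult.commute)
  qed
  moreover have "continuous_on UNIV g"
    using assms(2) by (meson continuous_at_imp_continuous_on has_derivative_continuous)
  ultimately show ?thesis using assms C1_compact_continuous[OF assms(1)] unfolding C1_compact_def
    by (auto intro!: continuous_intros)
qed

lemma C1_compact_test_function:
  assumes "test_function \<Omega> \<eta>"
  obtains K where "K \<subseteq> \<Omega>" "C1_compact K \<eta> (grad \<eta>)"
proof -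
  obtain K where K: "compact K" "K \<subseteq> \<Omega>" "\<And>x. x \<notin> K \<Longrightarrow> \<eta> x = 0"
    and C: "Ck_on (Suc 0) \<eta> UNIV" using assms unfolding test_function_def by blast
  have "C1_compact K \<eta> (grad \<eta>)"
    unfolding C1_compact_def
    using K continuous_on_grad[OF C] C by (auto intro!: has_derivative_grad)
  then show ?thesis using that K by blast
qed

section \<open>Integration by parts\<close>

lemma integrable_compact_support:
  fixes f :: "'a::euclidean_space \<Rightarrow> real"
  assumes "compact K" "continuous_on UNIV f" "\<And>x. x \<notin> K \<Longrightarrow> f x = 0"
  shows "integrable lborel f"
proof -
  have "(\<lambda>x. indicator K x *\<^sub>R f x) = f" using assms(3) by (auto split: split_indicator)
  then show ?thesis
    using borel_integrable_compact[OF assms(1) continuous_on_subset[OF assms(2) subset_UNIV]] by simp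
qed

lemma
  fixes f :: "'a::euclidean_space \<Rightarrow> real"
  assumes "open \<Omega>" "f \<in> borel_measurable borel" "\<And>x. x \<notin> \<Omega> \<Longrightarrow> f x = 0"
  shows lebesgue_on_integral_eq: "integral\<^sup>L (lebesgue_on \<Omega>) f = integral\<^sup>L lborel f"
    and lebesgue_on_integrable_eq: "integrable (lebesgue_on \<Omega>) f = integrable lborel f"
proof -
  have s: "\<Omega> \<inter> space lebesgue \<in> sets lebesgue" using assms(1) by simp
  have i: "(\<lambda>x. indicator \<Omega> x *\<^sub>R f x) = f" using assms(3) by (auto split: split_indicator)
  have m: "f \<in> borel_measurable lborel" using assms(2) by simp
  show "integral\<^sup>L (lebesgue_on \<Omega>) f = integral\<^sup>L lborel f"
    unfolding integral_restrict_space[OF s] i by (rule integral_completion[OF m])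
  show "integrable (lebesgue_on \<Omega>) f = integrable lborel f"
    unfolding integrable_restrict_space[OF s] i by (rule integrable_completion[OF m])
qed

lemma integral_lborel_shift:
  fixes f :: "'a::euclidean_space \<Rightarrow> real"
  assumes [measurable]: "f \<in> borel_measurable borel"
  shows "(\<integral>x. f (x + c) \<partial>lborel) = (\<integral>x. f x \<partial>lborel)"
proof -
  have "(\<integral>x. f x \<partial>lborel) = (\<integral>x. f x \<partial>distr lborel borel ((+) c))"
    by (simp add: lborel_distr_plus)
  also have "\<dots> = (\<integral>x. f (c + x) \<partial>lborel)" by (intro integral_distr) auto
  finally show ?thesis by (simp add: add.commute)
qed

lemma integral_lborel_reflect:
  fixes f :: "'a::euclidean_space \<Rightarrow> real"
  assumes [measurable]: "f \<in> borel_measurable borel"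
  shows "(\<integral>x. f (c - x) \<partial>lborel) = (\<integral>x. f x \<partial>lborel)"
proof -
  have "(lborel :: 'a measure) = distr lborel borel (\<lambda>x. c - x)"
    using lborel_affine[of "-1" c] by (simp add: density_1)
  then have "(\<integral>x. f x \<partial>lborel) = (\<integral>x. f x \<partial>distr lborel borel (\<lambda>x. c - x))" by simp
  also have "\<dots> = (\<integral>x. f (c - x) \<partial>lborel)" by (intro integral_distr) auto
  finally show ?thesis by simp
qed

lemma integral_cbox_eq_lborel:
  fixes f :: "'a::euclidean_space \<Rightarrow> real"
  assumes "continuous_on UNIV f" "\<And>x. x \<notin> cbox l h \<Longrightarrow> f x = 0"
  shows "integral (cbox l h) f = (\<integral>x. f x \<partial>lborel)"
proof -
  have "integral (cbox l h) f = integral UNIV (\<lambda>x. if x \<in> cbox l h then f x else 0)"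
    by (simp add: Henstock_Kurzweil_Integration.integral_restrict_UNIV)
  also have "(\<lambda>x. if x \<in> cbox l h then f x else 0) = f" using assms(2) by auto
  also have "integral UNIV f = (\<integral>x. f x \<partial>lborel)"
    by (intro integral_lborel integrable_compact_support[of "cbox l h"]) (use assms in auto)
  finally show ?thesis .
qed

text \<open>The integral of \<open>f (x + t b)\<close> over the whole space does not depend on \<open>t\<close>; differentiation at
  \<open>t = 0\<close> under the integral sign gives the claim.\<close>

lemma integral_grad_eq_0:
  assumes "C1_compact K f G"
  shows "(\<integral>x. G x \<bullet> b \<partial>lborel) = 0"
proof -
  have K: "compact K" "\<And>x. (f has_derivative (\<lambda>h. G x \<bullet> h)) (at x)" "continuous_on UNIV G"
    "\<And>x. x \<notin> K \<Longrightarrow> f x = 0" using assms by (auto simp: C1_compact_def)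
  have cf: "continuous_on UNIV f" by (rule C1_compact_continuous[OF assms])
  obtain r where r: "\<And>x. x \<in> K \<Longrightarrow> norm x \<le> r"
    using K(1) compact_imp_bounded bounded_iff by metis
  (* The cube contains the supports of all translates by t b with t in [-1, 1]. *)
  obtain c where c: "cball (0::'a) (r + norm b) \<subseteq> cbox (- c) c"
    using bounded_subset_cbox_symmetric[OF bounded_cball] by metis
  have out: "norm x > r + norm b" if "x \<notin> cbox (- c) c" for x
    using c that by (auto simp: subset_eq not_le[symmetric])
  have J: "integral (cbox (- c) c) (\<lambda>x. f (x + t *\<^sub>R b)) = (\<integral>x. f x \<partial>lborel)" if "t \<in> {-1..1}" for t
  proof -
    have "f (x + t *\<^sub>R b) = 0" if "x \<notin> cbox (- c) c" for x
    proof -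
      have "norm (t *\<^sub>R b) \<le> norm b" using \<open>t \<in> _\<close> by (auto intro: mult_left_le_one_le)
      moreover have "norm x \<le> norm (x + t *\<^sub>R b) + norm (t *\<^sub>R b)"
        by (metis add_diff_cancel norm_triangle_ineq4)
      ultimately have "norm (x + t *\<^sub>R b) > r" using out[OF that] by linarith
      then show ?thesis using r K(4) by force
    qed
    then have "integral (cbox (- c) c) (\<lambda>x. f (x + t *\<^sub>R b)) = (\<integral>x. f (x + t *\<^sub>R b) \<partial>lborel)"
      by (intro integral_cbox_eq_lborel continuous_on_compose2[OF cf] continuous_intros) auto
    also have "\<dots> = (\<integral>x. f x \<partial>lborel)"
      by (rule integral_lborel_shift) (simp add: cf borel_measurable_continuous_onI)
    finally show ?thesis .
  qed
  have "((\<lambda>t. integral (cbox (- c) c) (\<lambda>x. f (x + t *\<^sub>R b))) has_field_derivative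
      integral (cbox (- c) c) (\<lambda>x. G (x + 0 *\<^sub>R b) \<bullet> b)) (at 0 within {-1..1})"
  proof (rule leibniz_rule_field_derivative)
    show "((\<lambda>t. f (x + t *\<^sub>R b)) has_field_derivative G (x + t *\<^sub>R b) \<bullet> b) (at t within {-1..1})" for t x
    proof -
      have "((\<lambda>t. x + t *\<^sub>R b) has_derivative (\<lambda>s. s *\<^sub>R b)) (at t within {-1..1})"
        by (auto intro!: derivative_eq_intros)
      from has_derivative_compose[OF this K(2)]
      moreover have "(\<lambda>s. s * c) = (*) c" for c :: real by (auto simp: mult.commute)
      ultimately show ?thesis by (simp add: has_field_derivative_def)
    qed
    show "(\<lambda>x. f (x + t *\<^sub>R b)) integrable_on cbox (- c) c" for t
      by (intro integrable_continuous continuous_on_compose2[OF cf] continuous_intros) auto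
    show "continuous_on ({- 1..1} \<times> cbox (- c) c) (\<lambda>(t, x). G (x + t *\<^sub>R b) \<bullet> b)"
      unfolding split_beta by (intro continuous_intros continuous_on_compose2[OF K(3)]) auto
  qed auto
  then have "((\<lambda>t::real. \<integral>x. f x \<partial>lborel) has_field_derivative
      integral (cbox (- c) c) (\<lambda>x. G (x + 0 *\<^sub>R b) \<bullet> b)) (at 0 within {-1..1})"
    unfolding has_field_derivative_def by (rule has_derivative_transform[rotated 2]) (simp_all add: J)
  then have "((\<lambda>t::real. \<integral>x. f x \<partial>lborel) has_field_derivative integral (cbox (- c) c) (\<lambda>x. G x \<bullet> b)) (at 0)"
    by (simp add: at_within_Icc_at)
  then have "integral (cbox (- c) c) (\<lambda>x. G x \<bullet> b) = 0" by (rule DERIV_unique) simp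
  moreover have "G x \<bullet> b = 0" if "x \<notin> cbox (- c) c" for x
  proof -
    have "x \<notin> K" using out[OF that] r[of x] norm_ge_zero[of b] by linarith
    then show ?thesis using C1_compact_outside[OF assms] by simp
  qed
  ultimately show ?thesis
    by (subst integral_cbox_eq_lborel[symmetric, of _ "- c" c]) (use K(3) in \<open>auto intro!: continuous_intros\<close>)
qed

lemma integration_by_parts:
  assumes "C1_compact K f G" "\<And>x. (g has_derivative (\<lambda>h. H x \<bullet> h)) (at x)" "continuous_on UNIV H"
  shows "(\<integral>x. f x * (H x \<bullet> b) \<partial>lborel) = - (\<integral>x. (G x \<bullet> b) * g x \<partial>lborel)"
proof -
  have K: "compact K" using assms(1) by (simp add: C1_compact_def)
  have cf: "continuous_on UNIV f" by (rule C1_compact_continuous[OF assms(1)])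
  have cg: "continuous_on UNIV g"
    using assms(2) by (meson continuous_at_imp_continuous_on has_derivative_continuous)
  have cG: "continuous_on UNIV G" using assms(1) by (simp add: C1_compact_def)
  have "(\<integral>x. f x * (H x \<bullet> b) + (G x \<bullet> b) * g x \<partial>lborel) = 0"
    using integral_grad_eq_0[OF C1_compact_mult[OF assms], of b]
    by (simp add: inner_add_left mult.commute)
  moreover have "integrable lborel (\<lambda>x. f x * (H x \<bullet> b))" "integrable lborel (\<lambda>x. (G x \<bullet> b) * g x)"
    by (rule integrable_compact_support[OF K];
        use assms(1,3) cf cg cG C1_compact_outside[OF assms(1)] in \<open>auto intro!: continuous_intros simp: C1_compact_def\<close>)+
  ultimately show ?thesis by simp
qed

section \<open>Mollification\<close>

definition conv :: "('a::euclidean_space \<Rightarrow> real) \<Rightarrow> ('a \<Rightarrow> real) \<Rightarrow> 'a \<Rightarrow> real" where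
  "conv f B x = (\<integral>z. f z * B (x - z) \<partial>lborel)"

lemma conv_has_derivative:
  assumes "compact K" "continuous_on UNIV f" "\<And>x. x \<notin> K \<Longrightarrow> f x = 0"
    and B: "\<And>x. (B has_derivative (\<lambda>h. G x \<bullet> h)) (at x)" "continuous_on UNIV G"
  shows "(conv f B has_derivative (\<lambda>h. conv f (\<lambda>y. G y \<bullet> h) x)) (at x)"
proof -
  obtain c where c: "K \<subseteq> cbox (- c) c"
    using bounded_subset_cbox_symmetric[OF compact_imp_bounded[OF assms(1)]] by metis
  have cB: "continuous_on UNIV B"
    using B(1) by (meson continuous_at_imp_continuous_on has_derivative_continuous)
  have e: "conv f C x = integral (cbox (- c) c) (\<lambda>z. f z * C (x - z))" if "continuous_on UNIV C" for C x
    unfolding conv_def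
    by (rule integral_cbox_eq_lborel[symmetric])
      (use c assms in \<open>auto intro!: continuous_intros continuous_on_compose2[OF that]\<close>)
  define D where "D x z = f z *\<^sub>R blinfun_inner_right (G (x - z))" for x z
  have cD: "continuous_on (UNIV \<times> cbox (- c) c) (\<lambda>(x, z). D x z)"
    unfolding D_def split_beta
    by (intro continuous_intros continuous_on_compose2[OF B(2)] continuous_on_compose2[OF assms(2)]
        bounded_linear.continuous_on[OF bounded_linear_blinfun_inner_right]) auto
  have lim: "((\<lambda>x. integral (cbox (- c) c) (\<lambda>z. f z * B (x - z))) has_derivative
      integral (cbox (- c) c) (D x)) (at x within UNIV)"
  proof (rule leibniz_rule[OF _ _ cD])
    show "((\<lambda>x. f z * B (x - z)) has_derivative blinfun_apply (D x z)) (at x within UNIV)" for x z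
    proof -
      have "((\<lambda>x. x - z) has_derivative (\<lambda>h. h)) (at x)" by (auto intro!: derivative_eq_intros)
      from has_derivative_mult_right[OF has_derivative_compose[OF this B(1)], of "f z"]
      show ?thesis by (simp add: D_def scaleR_blinfun.rep_eq)
    qed
    show "(\<lambda>z. f z * B (x - z)) integrable_on cbox (- c) c" for x
      by (intro integrable_continuous continuous_intros continuous_on_compose2[OF cB]
          continuous_on_compose2[OF assms(2)]) auto
  qed auto
  have "blinfun_apply (integral (cbox (- c) c) (D x)) h = conv f (\<lambda>y. G y \<bullet> h) x" for h
  proof -
    have "continuous_on (cbox (- c) c) (D x)"
      unfolding D_def
    by (intro continuous_intros continuous_on_compose2[OF B(2)] continuous_on_compose2[OF assms(2)]
        bounded_linear.continuous_on[OF bounded_linear_blinfun_inner_right]) auto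
    then have "blinfun_apply (integral (cbox (- c) c) (D x)) h = integral (cbox (- c) c) (\<lambda>z. D x z h)"
      by (intro blinfun_apply_integral integrable_continuous)
    also have "\<dots> = conv f (\<lambda>y. G y \<bullet> h) x"
      by (subst e) (use B(2) in \<open>auto intro!: continuous_intros simp: D_def scaleR_blinfun.rep_eq\<close>)
    finally show ?thesis .
  qed
  then have "blinfun_apply (integral (cbox (- c) c) (D x)) = (\<lambda>h. conv f (\<lambda>y. G y \<bullet> h) x)" by (rule ext)
  moreover have "conv f B = (\<lambda>x. integral (cbox (- c) c) (\<lambda>z. f z * B (x - z)))" by (rule ext) (rule e[OF cB])
  ultimately show ?thesis using lim by simp
qed

lemma Ck_on_conv:
  assumes "compact K" "continuous_on UNIV f" "\<And>x. x \<notin> K \<Longrightarrow> f x = 0"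
    and "\<And>n. Ck_on n B UNIV"
  shows "Ck_on n (conv f B) UNIV"
  using assms(4)
proof (induction n arbitrary: B)
  have d: "(conv f B has_derivative (\<lambda>h. conv f (\<lambda>y. grad B y \<bullet> h) x)) (at x)"
    if "\<And>n. Ck_on n B UNIV" for B x
    by (rule conv_has_derivative[OF assms(1,2)])
      (use assms(3) that[of "Suc 0"] continuous_on_grad[OF that[of "Suc 0"]] in \<open>auto intro!: has_derivative_grad\<close>)
  {
    case 0
    show ?case using d[OF 0] by (auto intro!: continuous_at_imp_continuous_on has_derivative_continuous)
  next
    case (Suc n)
    show ?case
      by (rule Ck_on_SucI[OF _ d[OF Suc.prems]])
       (use Suc.prems in \<open>auto intro!: Suc.IH Ck_on_grad_inner\<close>)
  }
qed

text \<open>The mass of the kernel is not normalised; both sides carry it as a factor.\<close>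

lemma conv_approx:
  assumes "compact K" "continuous_on UNIV f" "\<And>x. x \<notin> K \<Longrightarrow> f x = 0"
    and B: "continuous_on UNIV B" "\<And>x. B x \<ge> 0" "compact L" "\<And>x. x \<notin> L \<Longrightarrow> B x = 0"
    and near: "\<And>x z. x - z \<in> L \<Longrightarrow> \<bar>f z - f x\<bar> \<le> \<epsilon>"
  shows "\<bar>conv f B x - f x * (\<integral>y. B y \<partial>lborel)\<bar> \<le> \<epsilon> * (\<integral>y. B y \<partial>lborel)"
proof -
  have mB: "B \<in> borel_measurable borel" by (simp add: B(1) borel_measurable_continuous_onI)
  have iB: "integrable lborel (\<lambda>z. B (x - z))"
  proof (rule integrable_compact_support)
    show "compact ((\<lambda>y. x - y) ` L)" by (intro compact_continuous_image continuous_intros B(3))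
    show "continuous_on UNIV (\<lambda>z. B (x - z))" by (intro continuous_intros continuous_on_compose2[OF B(1)]) auto
    show "B (x - z) = 0" if "z \<notin> (\<lambda>y. x - y) ` L" for z
      using that by (intro B(4)) (auto simp: image_iff)
  qed
  have ifB: "integrable lborel (\<lambda>z. f z * B (x - z))"
    by (rule integrable_compact_support[OF assms(1)])
      (use assms in \<open>auto intro!: continuous_intros continuous_on_compose2[OF B(1)]\<close>)
  have r: "(\<integral>y. B y \<partial>lborel) = (\<integral>z. B (x - z) \<partial>lborel)"
    by (rule integral_lborel_reflect[OF mB, symmetric])
  have "conv f B x - f x * (\<integral>y. B y \<partial>lborel) = (\<integral>z. (f z - f x) * B (x - z) \<partial>lborel)"
    unfolding r conv_def using iB ifB by (simp add: left_diff_distrib)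
  also have "\<bar>\<dots>\<bar> \<le> (\<integral>z. \<epsilon> * B (x - z) \<partial>lborel)"
  proof (rule integral_abs_bound_integral)
    show "integrable lborel (\<lambda>z. (f z - f x) * B (x - z))" using iB ifB by (simp add: left_diff_distrib)
    show "integrable lborel (\<lambda>z. \<epsilon> * B (x - z))" using iB by simp
    show "\<bar>(f z - f x) * B (x - z)\<bar> \<le> \<epsilon> * B (x - z)" for z
    proof (cases "x - z \<in> L")
      case True
      then show ?thesis using near[OF True] B(2)[of "x - z"] by (auto simp: abs_mult intro: mult_right_mono)
    next
      case False
      then show ?thesis using B(4) by simp
    qed
  qed
  also have "\<dots> = \<epsilon> * (\<integral>y. B y \<partial>lborel)" unfolding r by simp
  finally show ?thesis .
qed

lemma uniformly_continuous_compact_support: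
  fixes f :: "'a::euclidean_space \<Rightarrow> real"
  assumes "compact K" "continuous_on UNIV f" "\<And>x. x \<notin> K \<Longrightarrow> f x = 0" "\<epsilon> > 0"
  shows "\<exists>d>0. \<forall>x z. dist x z < d \<longrightarrow> \<bar>f z - f x\<bar> \<le> \<epsilon>"
proof -
  define L where "L = {x + y |x y. x \<in> K \<and> y \<in> cball 0 1}"
  have "compact L" unfolding L_def by (intro compact_sums assms(1) compact_cball)
  then have "uniformly_continuous_on L f"
    by (intro compact_uniformly_continuous continuous_on_subset[OF assms(2)]) auto
  then obtain d where d: "d > 0" "\<And>x z. x \<in> L \<Longrightarrow> z \<in> L \<Longrightarrow> dist z x < d \<Longrightarrow> dist (f z) (f x) < \<epsilon>"
    using assms(4) unfolding uniformly_continuous_on_def by metis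
  have inL: "y \<in> L" if "x \<in> K" "dist x y \<le> 1" for x y
    unfolding L_def using that by (intro CollectI exI[of _ x] exI[of _ "y - x"]) (auto simp: dist_norm norm_minus_commute)
  have "\<bar>f z - f x\<bar> \<le> \<epsilon>" if xz: "dist x z < min d 1" for x z
  proof (cases "x \<in> K \<or> z \<in> K")
    case True
    then have "x \<in> L \<and> z \<in> L" using inL[of x z] inL[of z x] inL[of x x] inL[of z z] xz by (auto simp: dist_commute)
    then show ?thesis using d(2)[of x z] xz by (auto simp: dist_commute dist_real_def)
  next
    case False
    then show ?thesis using assms(3)[of x] assms(3)[of z] assms(4) by simp
  qed
  then show ?thesis using d(1) by (intro exI[of _ "min d 1"]) auto
qed

text \<open>The gradient of \<open>conv f B\<close> falls on the kernel; integration by parts moves it to \<open>f\<close>, and so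
  the same estimate bounds the distance of the functions and of their gradients.  The compact set
  \<open>K'\<close> does not depend on \<open>\<epsilon>\<close>, so uniform closeness yields closeness in the Sobolev norm.\<close>

lemma mollify:
  fixes f :: "'a::euclidean_space \<Rightarrow> real"
  assumes f: "C1_compact K f G" and "K \<subseteq> \<Omega>" "open \<Omega>"
  shows "\<exists>K'. compact K' \<and> K' \<subseteq> \<Omega> \<and> K \<subseteq> K' \<and>
    (\<forall>\<epsilon>>0. \<exists>\<eta>. test_function \<Omega> \<eta> \<and> (\<forall>x. x \<notin> K' \<longrightarrow> \<eta> x = 0) \<and> 
       (\<forall>x. \<bar>f x - \<eta> x\<bar> \<le> \<epsilon>) \<and> (\<forall>x. \<forall>b\<in>Basis. \<bar>G x \<bullet> b - grad \<eta> x \<bullet> b\<bar> \<le> \<epsilon>))"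
proof -
  have K: "compact K" "\<And>x. (f has_derivative (\<lambda>h. G x \<bullet> h)) (at x)" "continuous_on UNIV G"
    "\<And>x. x \<notin> K \<Longrightarrow> f x = 0" using f by (auto simp: C1_compact_def)
  have cf: "continuous_on UNIV f" by (rule C1_compact_continuous[OF f])
  have "\<exists>r>0. {x + y |x y. x \<in> K \<and> y \<in> cball 0 r} \<subseteq> \<Omega>"
  proof (cases "K = {}")
    case True
    then show ?thesis by (auto intro!: exI[of _ 1])
  next
    case False
    from compact_in_open_separated[OF False K(1) assms(3,2)]
    obtain e where e: "e > 0" "{x. infdist x K \<le> e} \<subseteq> \<Omega>" by blast
    have "infdist (x + y) K \<le> e" if "x \<in> K" "norm y \<le> e" for x y
      using infdist_le2[OF that(1), of "x + y" e] that by (simp add: dist_norm)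
    then show ?thesis using e by (intro exI[of _ e]) auto
  qed
  then obtain r where r: "r > 0" "{x + y |x y. x \<in> K \<and> y \<in> cball 0 r} \<subseteq> \<Omega>" by blast
  define K' where "K' = {x + y |x y. x \<in> K \<and> y \<in> cball 0 r}"
  have cK': "compact K'" unfolding K'_def by (intro compact_sums K(1) compact_cball)
  have KK': "K \<subseteq> K'" unfolding K'_def using r(1) by force
  have "\<exists>\<eta>. test_function \<Omega> \<eta> \<and> (\<forall>x. x \<notin> K' \<longrightarrow> \<eta> x = 0) \<and> 
       (\<forall>x. \<bar>f x - \<eta> x\<bar> \<le> \<epsilon>) \<and> (\<forall>x. \<forall>b\<in>Basis. \<bar>G x \<bullet> b - grad \<eta> x \<bullet> b\<bar> \<le> \<epsilon>)" if eps: "\<epsilon> > 0" for \<epsilon>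
  proof -
    obtain d0 where d0: "d0 > 0" "\<And>x z. dist x z < d0 \<Longrightarrow> \<bar>f z - f x\<bar> \<le> \<epsilon>"
      using uniformly_continuous_compact_support[OF K(1) cf _ eps] K(4) by blast
    have "\<exists>d>0. \<forall>x z. dist x z < d \<longrightarrow> \<bar>G z \<bullet> b - G x \<bullet> b\<bar> \<le> \<epsilon>" for b
      by (rule uniformly_continuous_compact_support[OF K(1) _ _ eps])
        (use K(3) C1_compact_outside[OF f] in \<open>auto intro!: continuous_intros\<close>)
    then obtain d where d: "\<And>b. d b > 0" "\<And>b x z. dist x z < d b \<Longrightarrow> \<bar>G z \<bullet> b - G x \<bullet> b\<bar> \<le> \<epsilon>"
      by metis
    (* D is below the margin r of the enlarged support and below all moduli of continuity. *)
    define D where "D = Min (insert r (insert d0 (d ` Basis)))"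
    have D: "D > 0" unfolding D_def using r(1) d0(1) d(1) by auto
    have D: "D > 0" "D \<le> r" "D \<le> d0" "\<And>b. b \<in> Basis \<Longrightarrow> D \<le> d b"
      unfolding D_def using D[unfolded D_def] by - (assumption | rule Min_le; simp)+
    (* A cube of half-width s lies in the ball of radius D. *)
    define s where "s = D / (2 * DIM('a))"
    have s: "s > 0" "s * DIM('a) < D" using D(1) by (auto simp: s_def field_simps)
    define B where "B = box_bump (- (s *\<^sub>R One)) (s *\<^sub>R One :: 'a) 1"
    define L where "L = cbox (- (s *\<^sub>R One)) (s *\<^sub>R One :: 'a)"
    have ne: "box (- (s *\<^sub>R One)) (s *\<^sub>R One :: 'a) \<noteq> {}" using s by (auto simp: box_ne_empty)
    have L: "norm y < D" if "y \<in> L" for y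
    proof -
      have "norm y \<le> (\<Sum>b\<in>Basis. \<bar>y \<bullet> b\<bar>)" by (rule norm_le_l1)
      also have "\<dots> \<le> (\<Sum>b\<in>(Basis::'a set). s)"
        using that by (intro sum_mono) (auto simp: L_def mem_box abs_le_iff minus_le_iff)
      finally show ?thesis using s(2) by (simp add: mult.commute)
    qed
    have CB: "Ck_on n B UNIV" for n unfolding B_def by (rule Ck_on_box_bump)
    have B: "continuous_on UNIV B" "\<And>x. B x \<ge> 0" "compact L" "\<And>x. x \<notin> L \<Longrightarrow> B x = 0"
    proof -
      show "B x = 0" if "x \<notin> L" for x
        unfolding B_def using that box_subset_cbox unfolding L_def by (intro box_bump_outside ne) blast
    qed (use CB[of 0] in \<open>auto simp: B_def L_def box_bump_bounds\<close>)
    define c where "c = (\<integral>y. B y \<partial>lborel)"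
    have iB: "integrable lborel B" by (rule integrable_compact_support[OF B(3,1)]) (rule B(4))
    have "c > 0"
    proof (rule ccontr)
      assume "\<not> c > 0"
      moreover have "c \<ge> 0" unfolding c_def by (intro integral_nonneg_AE) (simp add: B)
      ultimately have "c = 0" by simp
      then have "AE x in lborel. B x = 0"
        unfolding c_def by (subst (asm) integral_nonneg_eq_0_iff_AE[OF iB]) (auto simp: B)
      moreover have "B x \<noteq> 0" if "x \<in> box (- (s *\<^sub>R One)) (s *\<^sub>R One)" for x
        using box_bump_pos[OF that, of 1] by (simp add: B_def)
      ultimately have "AE x in lborel. x \<notin> box (- (s *\<^sub>R One)) (s *\<^sub>R One :: 'a)"
        by (auto elim!: AE_mp)
      then have "emeasure lborel (box (- (s *\<^sub>R One)) (s *\<^sub>R One :: 'a)) = 0"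
        by (subst (asm) AE_iff_measurable[OF _ refl]) auto
      moreover have "emeasure lborel (box (- (s *\<^sub>R One)) (s *\<^sub>R One :: 'a)) > 0"
        using s by (subst emeasure_lborel_box_eq) (auto intro!: prod_pos simp: inner_add_left)
      ultimately show False by simp
    qed
    define \<eta> where "\<eta> x = inverse c * conv f B x" for x
    have C\<eta>: "Ck_on n \<eta> UNIV" for n
      unfolding \<eta>_def by (intro Ck_on_mult Ck_on_const Ck_on_conv[OF K(1) cf] open_UNIV CB K(4))
    have out: "\<eta> x = 0" if "x \<notin> K'" for x
    proof -
      have "f z * B (x - z) = 0" for z
      proof (rule ccontr)
        assume "f z * B (x - z) \<noteq> 0"
        then have "z \<in> K" "x - z \<in> L" using K(4) B(4) by auto
        then have "x \<in> K'" unfolding K'_def using L[of "x - z"] D(2)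
          by (intro CollectI exI[of _ z] exI[of _ "x - z"]) auto
        then show False using that by simp
      qed
      then have "(\<lambda>z. f z * B (x - z)) = (\<lambda>z. 0)" by (rule ext)
      then show ?thesis unfolding \<eta>_def conv_def by simp
    qed
    have bound: "\<bar>F x - inverse c * conv F B x\<bar> \<le> \<epsilon>"
      if F: "continuous_on UNIV F" "\<And>x. x \<notin> K \<Longrightarrow> F x = 0" "\<And>x z. dist x z < D \<Longrightarrow> \<bar>F z - F x\<bar> \<le> \<epsilon>" for F x
    proof -
      have "\<bar>conv F B x - F x * c\<bar> \<le> \<epsilon> * c"
        unfolding c_def by (rule conv_approx[OF K(1) F(1) _ B(1) _ B(3)]) (use L F(2,3) B(2,4) in \<open>auto simp: dist_norm\<close>)
      moreover have "F x - inverse c * conv F B x = - (conv F B x - F x * c) / c"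
        using \<open>c > 0\<close> by (simp add: field_simps)
      ultimately show ?thesis using \<open>c > 0\<close> by (simp add: abs_divide pos_divide_le_eq)
    qed
    have "grad \<eta> x \<bullet> b = inverse c * conv (\<lambda>z. G z \<bullet> b) B x" for x b
    proof -
      have dB: "(B has_derivative (\<lambda>h. grad B x \<bullet> h)) (at x)" for x
        using CB[of "Suc 0"] by (auto intro!: has_derivative_grad)
      have cB: "continuous_on UNIV (grad B)" using continuous_on_grad[OF CB[of "Suc 0"]] by simp
      have "(conv f B has_derivative (\<lambda>h. conv f (\<lambda>y. grad B y \<bullet> h) x)) (at x)"
        by (rule conv_has_derivative[OF K(1) cf _ dB cB]) (rule K(4))
      from has_derivative_mult_right[OF this, of "inverse c"]
      have 1: "(\<eta> has_derivative (\<lambda>h. inverse c * conv f (\<lambda>y. grad B y \<bullet> h) x)) (at x)"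
        by (simp add: \<eta>_def[abs_def])
      have "(\<eta> has_derivative (\<lambda>h. grad \<eta> x \<bullet> h)) (at x)"
        using C\<eta>[of "Suc 0"] by (auto intro!: has_derivative_grad)
      from has_derivative_unique[OF this 1]
      have "grad \<eta> x \<bullet> b = inverse c * conv f (\<lambda>y. grad B y \<bullet> b) x" by metis
      also have "conv f (\<lambda>y. grad B y \<bullet> b) x = - (\<integral>z. f z * (- grad B (x - z) \<bullet> b) \<partial>lborel)"
        by (simp add: conv_def)
      also have "(\<integral>z. f z * (- grad B (x - z) \<bullet> b) \<partial>lborel) = - (\<integral>z. (G z \<bullet> b) * B (x - z) \<partial>lborel)"
      proof (rule integration_by_parts[OF f])
        show "((\<lambda>z. B (x - z)) has_derivative (\<bullet>) (- grad B (x - z))) (at z)" for z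
        proof -
          have "((\<lambda>z. x - z) has_derivative (\<lambda>h. - h)) (at z)" by (auto intro!: derivative_eq_intros)
          from has_derivative_compose[OF this dB]
          have "((\<lambda>z. B (x - z)) has_derivative (\<lambda>h. - grad B (x - z) \<bullet> h)) (at z)" by simp
          then show ?thesis .
        qed
        show "continuous_on UNIV (\<lambda>z. - grad B (x - z))"
          by (intro continuous_intros continuous_on_compose2[OF cB]) auto
      qed
      finally show ?thesis by (simp add: conv_def)
    qed
    moreover have "\<bar>G x \<bullet> b - inverse c * conv (\<lambda>z. G z \<bullet> b) B x\<bar> \<le> \<epsilon>" if "b \<in> Basis" for x b
      by (rule bound) (use K(3) C1_compact_outside[OF f] d(2)[of _ _ b] D(4)[OF that] in \<open>auto intro!: continuous_intros\<close>)
    ultimately have "\<bar>G x \<bullet> b - grad \<eta> x \<bullet> b\<bar> \<le> \<epsilon>" if "b \<in> Basis" for x b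
      using that by simp
    moreover have "\<bar>f x - \<eta> x\<bar> \<le> \<epsilon>" for x
      unfolding \<eta>_def by (rule bound) (use cf K(4) d0(2) D(3) in auto)
    moreover have "test_function \<Omega> \<eta>"
      unfolding test_function_def using C\<eta> cK' out r(2) K'_def by blast
    ultimately show ?thesis using out by blast
  qed
  then show ?thesis using cK' KK' r(2) K'_def by blast
qed

section \<open>The fundamental lemma of the calculus of variations\<close>

text \<open>The positive and the negative part of \<open>W\<close> are densities of two finite measures that agree on all
  boxes, and boxes generate the Borel sets and are stable under intersection.\<close>

lemma AE_eq_0_of_box_integrals:
  fixes W :: "'a::euclidean_space \<Rightarrow> real"
  assumes W: "integrable lborel W"
    and box: "\<And>a b. (\<integral>x. W x * indicator (box a b) x \<partial>lborel) = 0"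
  shows "AE x in lborel. W x = 0"
proof -
  have [measurable]: "W \<in> borel_measurable borel" using W by auto
  define E where "E = range (\<lambda>(a, b). box a b :: 'a set)"
  let ?M = "density lborel (\<lambda>x. ennreal (W x))" and ?N = "density lborel (\<lambda>x. ennreal (- W x))"
  have int: "integrable lborel (\<lambda>x. max 0 (W x * indicator B x))" "integrable lborel (\<lambda>x. max 0 (- W x * indicator B x))"
    if [measurable]: "B \<in> sets borel" for B
    using W that by (auto intro!: integrable_max integrable_real_mult_indicator)
  have em: "emeasure ?M B = ennreal (\<integral>x. max 0 (W x * indicator B x) \<partial>lborel)"
    "emeasure ?N B = ennreal (\<integral>x. max 0 (- W x * indicator B x) \<partial>lborel)"
    if [measurable]: "B \<in> sets borel" for B
  proof -
    have "emeasure ?M B = (\<integral>\<^sup>+x. ennreal (max 0 (W x * indicator B x)) \<partial>lborel)"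
      by (subst emeasure_density) (auto intro!: nn_integral_cong split: split_indicator simp: max_def ennreal_neg)
    then show "emeasure ?M B = ennreal (\<integral>x. max 0 (W x * indicator B x) \<partial>lborel)"
      using int(1)[OF that] by (simp add: nn_integral_eq_integral)
    have "emeasure ?N B = (\<integral>\<^sup>+x. ennreal (max 0 (- W x * indicator B x)) \<partial>lborel)"
      by (subst emeasure_density) (auto intro!: nn_integral_cong split: split_indicator simp: max_def ennreal_neg)
    then show "emeasure ?N B = ennreal (\<integral>x. max 0 (- W x * indicator B x) \<partial>lborel)"
      using int(2)[OF that] by (simp add: nn_integral_eq_integral)
  qed
  have eq: "emeasure ?M X = emeasure ?N X" if "X \<in> E" for X
  proof -
    obtain a b where X: "X = box a b" using \<open>X \<in> E\<close> by (auto simp: E_def)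
    then have [measurable]: "X \<in> sets borel" by simp
    have "(\<integral>x. max 0 (W x * indicator X x) \<partial>lborel) - (\<integral>x. max 0 (- W x * indicator X x) \<partial>lborel)
        = (\<integral>x. max 0 (W x * indicator X x) - max 0 (- W x * indicator X x) \<partial>lborel)"
      using int by simp
    also have "\<dots> = (\<integral>x. W x * indicator X x \<partial>lborel)"
      by (intro Bochner_Integration.integral_cong) (auto simp: max_def)
    also have "\<dots> = 0" using box X by simp
    finally show ?thesis by (simp add: em)
  qed
  have "?M = ?N"
  proof (rule measure_eqI_generator_eq[where E = E and \<Omega> = UNIV])
    show "Int_stable E" by (auto simp: E_def Int_stable_def box_Int_box)
    show "E \<subseteq> Pow UNIV" "sets ?M = sigma_sets UNIV E" "sets ?N = sigma_sets UNIV E"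
      by (simp_all add: E_def borel_eq_box)
    let ?A = "\<lambda>n::nat. box (- (real n *\<^sub>R One)) (real n *\<^sub>R One) :: 'a set"
    show "range ?A \<subseteq> E" "(\<Union>i. ?A i) = UNIV" unfolding UN_box_eq_UNIV E_def by auto
    show "emeasure ?M (?A i) \<noteq> \<infinity>" for i by (subst em) auto
  qed (rule eq)
  moreover have "(\<integral>\<^sup>+x. ennreal (W x) \<partial>lborel) \<noteq> \<infinity>"
    using em(1)[of UNIV] by (simp add: emeasure_density)
  ultimately have "AE x in lborel. ennreal (W x) = ennreal (- W x)"
    by (subst (asm) finite_density_unique) auto
  then show ?thesis
    by eventually_elim (metis ennreal_eq_0_iff ennreal_neg le_cases neg_le_0_iff_le order_antisym)
qed

text \<open>Box bumps are test functions that converge boundedly to indicators of boxes, so the integral of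
  \<open>Z\<close> over every box with closure in \<open>\<Omega>\<close> vanishes.\<close>

lemma fundamental_lemma:
  fixes Z :: "'a::euclidean_space \<Rightarrow> real"
  assumes "open \<Omega>" and Zm: "Z \<in> borel_measurable (lebesgue_on \<Omega>)"
    and Z2: "integrable (lebesgue_on \<Omega>) (\<lambda>x. (Z x)\<^sup>2)"
    and orth: "\<And>\<eta>. test_function \<Omega> \<eta> \<Longrightarrow> (\<integral>x. Z x * \<eta> x \<partial>lebesgue_on \<Omega>) = 0"
  shows "AE x in lebesgue_on \<Omega>. Z x = 0"
proof -
  have s: "\<Omega> \<inter> space lebesgue \<in> sets lebesgue" using assms(1) by simp
  (* Z is Lebesgue measurable only; a Borel version Y' allows the use of lborel. *)
  define Y where "Y x = indicator \<Omega> x * Z x" for x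
  have Ym: "Y \<in> borel_measurable lebesgue"
    using Zm unfolding borel_measurable_restrict_space_iff[OF s] by (simp add: Y_def[abs_def] mult.commute)
  have "(\<lambda>x. indicator \<Omega> x *\<^sub>R (Z x)\<^sup>2) = (\<lambda>x. (Y x)\<^sup>2)"
    by (auto simp: Y_def split: split_indicator)
  then have Y2: "integrable lebesgue (\<lambda>x. (Y x)\<^sup>2)"
    using Z2 unfolding integrable_restrict_space[OF s] by simp
  obtain Y' where Y'm: "Y' \<in> borel_measurable borel" and ae: "AE x in lborel. Y x = Y' x"
    using completion_ex_borel_measurable_real[OF Ym] by auto
  have ae': "AE x in lebesgue. Y x = Y' x" using ae by (rule AE_completion)
  have Y'lm: "Y' \<in> borel_measurable lebesgue" using Y'm by (simp add: measurable_completion)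
  have "integrable lebesgue (\<lambda>x. (Y' x)\<^sup>2)"
    by (rule Bochner_Integration.integrable_cong_AE_imp[OF Y2])
      (use ae' Y'lm in \<open>auto\<close>)
  then have Y'2: "integrable lborel (\<lambda>x. (Y' x)\<^sup>2)"
    using Y'm by (subst (asm) integrable_completion) auto
  have orth': "(\<integral>x. Y' x * \<eta> x \<partial>lborel) = 0" if t: "test_function \<Omega> \<eta>" for \<eta>
  proof -
    have "continuous_on UNIV \<eta>"
      using t C1_compact_continuous by (metis C1_compact_test_function)
    then have m: "\<eta> \<in> borel_measurable borel" by (simp add: borel_measurable_continuous_onI)
    then have ml: "\<eta> \<in> borel_measurable lebesgue" by (simp add: measurable_completion)
    have "(\<integral>x. Y' x * \<eta> x \<partial>lborel) = (\<integral>x. Y' x * \<eta> x \<partial>lebesgue)"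
      using m Y'm by (subst integral_completion) auto
    also have "\<dots> = (\<integral>x. Y x * \<eta> x \<partial>lebesgue)"
      using ae' ml Ym Y'lm by (intro integral_cong_AE) auto
    also have "\<dots> = (\<integral>x. Z x * \<eta> x \<partial>lebesgue_on \<Omega>)"
      unfolding integral_restrict_space[OF s] by (simp add: Y_def mult.assoc)
    finally show ?thesis using orth[OF t] by simp
  qed
  have small: "AE x in lborel. x \<in> box l h \<longrightarrow> Y' x = 0" if sub: "cbox l h \<subseteq> \<Omega>" for l h
  proof -
    define W where "W x = Y' x * indicator (box l h) x" for x
    have Wm: "W \<in> borel_measurable borel" unfolding W_def[abs_def] using Y'm by auto
    have Wi: "integrable lborel W"
    proof (rule Bochner_Integration.integrable_bound)
      show "integrable lborel (\<lambda>x. indicator (box l h) x + (Y' x)\<^sup>2)"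
        using Y'2 emeasure_lborel_box_finite[of l h]
        by (intro Bochner_Integration.integrable_add integrable_real_indicator) auto
      (* Square integrability gives integrability on the bounded box. *)
      have "\<bar>y\<bar> \<le> 1 + y\<^sup>2" for y :: real
        using sum_power2_ge_zero[of "\<bar>y\<bar> - 1/2" 0] by (simp add: power2_eq_square algebra_simps)
      then show "AE x in lborel. norm (W x) \<le> norm (indicator (box l h) x + (Y' x)\<^sup>2)"
        by (auto simp: W_def split: split_indicator)
    qed (use Wm in simp)
    have "(\<integral>x. W x * indicator (box a b) x \<partial>lborel) = 0" for a b
    proof -
      obtain a' b' where B: "box a b \<inter> box l h = box a' b'" unfolding box_Int_box by blast
      have e: "W x * indicator (box a b) x = Y' x * indicator (box a' b') x" for x
        using B by (auto simp: W_def split: split_indicator)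
      show ?thesis
      proof (cases "box a' b' = {}")
        case True
        then show ?thesis by (simp add: e)
      next
        case False
        have "cbox a' b' = closure (box a' b')" using False by simp
        also have "\<dots> \<subseteq> cbox l h"
          using B box_subset_cbox by (intro closure_minimal) auto
        finally have test: "test_function \<Omega> (box_bump a' b' m)" for m
          using test_function_box_bump[OF _ False] sub by blast
        have "(\<lambda>m. \<integral>x. Y' x * box_bump a' b' m x \<partial>lborel) \<longlonglongrightarrow> (\<integral>x. Y' x * indicator (box a' b') x \<partial>lborel)"
        proof (rule integral_dominated_convergence)
          show "integrable lborel (\<lambda>x. \<bar>W x\<bar>)" using Wi by simp
          show "AE x in lborel. (\<lambda>m. Y' x * box_bump a' b' m x) \<longlonglongrightarrow> Y' x * indicator (box a' b') x"
            by (intro AE_I2 tendsto_intros box_bump_tendsto False)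
          have "\<bar>Y' x * box_bump a' b' m x\<bar> \<le> \<bar>W x\<bar>" for m x
          proof (cases "x \<in> box a' b'")
            case True
            then have "x \<in> box l h" using B by blast
            then have "W x = Y' x" by (simp add: W_def)
            then show ?thesis using box_bump_bounds[of a' b' m x] by (simp add: abs_mult mult_left_le)
          next
            case False': False
            show ?thesis using box_bump_outside[OF False' False] by simp
          qed
          then show "AE x in lborel. norm (Y' x * box_bump a' b' m x) \<le> \<bar>W x\<bar>" for m by simp
          show "(\<lambda>x. Y' x * box_bump a' b' m x) \<in> borel_measurable lborel" for m
          proof -
            have "box_bump a' b' m \<in> borel_measurable borel"
              using Ck_on_box_bump[of 0 a' b' m] by (intro borel_measurable_continuous_onI) simp
            then show ?thesis using Y'm by simp
          qed
        qed (use Y'm in auto)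
        moreover have "(\<integral>x. Y' x * box_bump a' b' m x \<partial>lborel) = 0" for m by (rule orth'[OF test])
        ultimately show ?thesis by (simp add: e LIMSEQ_const_iff)
      qed
    qed
    from AE_eq_0_of_box_integrals[OF Wi this] show ?thesis
      by eventually_elim (auto simp: W_def)
  qed
  define F where "F = {box l h | l h. cbox l h \<subseteq> \<Omega>}"
  have op: "S \<in> F \<Longrightarrow> open S" for S by (auto simp: F_def)
  obtain F' where F': "F' \<subseteq> F" "countable F'" "\<Union>F' = \<Union>F" using Lindelof[of F, OF op] by metis
  have "\<Omega> \<subseteq> \<Union>F"
  proof
    fix x assume "x \<in> \<Omega>"
    then obtain l h where "cbox l h \<subseteq> \<Omega>" "x \<in> box l h" using open_contains_cbox[OF assms(1)] by metis
    then show "x \<in> \<Union>F" by (auto simp: F_def)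
  qed
  have "AE x in lborel. \<forall>B\<in>F'. x \<in> B \<longrightarrow> Y' x = 0"
    using small F'(1) by (intro AE_ball_countable' F'(2)) (auto simp: F_def)
  then have "AE x in lborel. x \<in> \<Omega> \<longrightarrow> Z x = 0"
    using ae by eventually_elim (use \<open>\<Omega> \<subseteq> \<Union>F\<close> F'(3) in \<open>auto simp: Y_def subset_eq\<close>)
  then have "AE x in lebesgue. x \<in> \<Omega> \<longrightarrow> Z x = 0" by (rule AE_completion)
  then show ?thesis by (subst AE_restrict_space_iff[OF s])
qed

section \<open>Weak gradients of functions of class C1\<close>

lemma integrable_mult_L2:
  fixes f g :: "'a \<Rightarrow> real"
  assumes [measurable]: "f \<in> borel_measurable M" "g \<in> borel_measurable M"
    and "integrable M (\<lambda>x. (f x)\<^sup>2)" "integrable M (\<lambda>x. (g x)\<^sup>2)"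
  shows "integrable M (\<lambda>x. f x * g x)"
proof (rule Bochner_Integration.integrable_bound)
  show "integrable M (\<lambda>x. (f x)\<^sup>2 + (g x)\<^sup>2)" using assms by simp
  have "\<bar>a * b\<bar> \<le> a\<^sup>2 + b\<^sup>2" for a b :: real
  proof -
    have "2 * (\<bar>a\<bar> * \<bar>b\<bar>) \<le> a\<^sup>2 + b\<^sup>2"
      using sum_squares_ge_zero[of "\<bar>a\<bar> - \<bar>b\<bar>" 0] by (simp add: power2_eq_square algebra_simps)
    moreover have "0 \<le> \<bar>a\<bar> * \<bar>b\<bar>" by simp
    ultimately show ?thesis unfolding abs_mult by linarith
  qed
  then show "AE x in M. norm (f x * g x) \<le> norm ((f x)\<^sup>2 + (g x)\<^sup>2)" by simp
qed simp

lemma L2_on_component: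
  assumes "L2_on \<Omega> G" "b \<in> Basis"
  shows "(\<lambda>x. G x \<bullet> b) \<in> borel_measurable (lebesgue_on \<Omega>)" "integrable (lebesgue_on \<Omega>) (\<lambda>x. (G x \<bullet> b)\<^sup>2)"
proof -
  have G: "G \<in> borel_measurable (lebesgue_on \<Omega>)" "integrable (lebesgue_on \<Omega>) (\<lambda>x. (norm (G x))\<^sup>2)"
    using assms by (auto simp: L2_on_def)
  then show m: "(\<lambda>x. G x \<bullet> b) \<in> borel_measurable (lebesgue_on \<Omega>)" by auto
  show "integrable (lebesgue_on \<Omega>) (\<lambda>x. (G x \<bullet> b)\<^sup>2)"
  proof (rule Bochner_Integration.integrable_bound[OF G(2)])
    have "(y \<bullet> b)\<^sup>2 \<le> (norm y)\<^sup>2" for y :: 'b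
      using Basis_le_norm[OF assms(2), of y] by (metis abs_ge_zero power2_abs power_mono)
    then show "AE x in lebesgue_on \<Omega>. norm ((G x \<bullet> b)\<^sup>2) \<le> norm ((norm (G x))\<^sup>2)" by simp
  qed (use m in auto)
qed

text \<open>Every component of the difference is square integrable and orthogonal to all test functions.\<close>

lemma weak_grad_unique:
  assumes "open \<Omega>" and 1: "L2_on \<Omega> G" "is_weak_grad \<Omega> \<phi> G" and 2: "L2_on \<Omega> H" "is_weak_grad \<Omega> \<phi> H"
  shows "AE x in lebesgue_on \<Omega>. G x = H x"
proof -
  have "AE x in lebesgue_on \<Omega>. G x \<bullet> b - H x \<bullet> b = 0" if b: "b \<in> Basis" for b
  proof (rule fundamental_lemma[OF assms(1)])
    note G = L2_on_component[OF 1(1) b] and H = L2_on_component[OF 2(1) b]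
    show "(\<lambda>x. G x \<bullet> b - H x \<bullet> b) \<in> borel_measurable (lebesgue_on \<Omega>)" using G H by auto
    have "(\<lambda>x. (G x \<bullet> b - H x \<bullet> b)\<^sup>2) = (\<lambda>x. (G x \<bullet> b)\<^sup>2 + (H x \<bullet> b)\<^sup>2 - 2 * ((G x \<bullet> b) * (H x \<bullet> b)))"
      by (auto simp: power2_eq_square algebra_simps)
    then show "integrable (lebesgue_on \<Omega>) (\<lambda>x. (G x \<bullet> b - H x \<bullet> b)\<^sup>2)"
      using integrable_mult_L2[OF G(1) H(1) G(2) H(2)] G H by simp
    fix \<eta> assume t: "test_function \<Omega> \<eta>"
    then obtain K where K: "K \<subseteq> \<Omega>" "C1_compact K \<eta> (grad \<eta>)" by (rule C1_compact_test_function)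
    have c: "continuous_on UNIV \<eta>" by (rule C1_compact_continuous[OF K(2)])
    have m: "\<eta> \<in> borel_measurable (lebesgue_on \<Omega>)"
      using c by (intro measurable_restrict_space1) (simp add: borel_measurable_continuous_onI measurable_completion)
    have "integrable lborel (\<lambda>x. (\<eta> x)\<^sup>2)"
      by (rule integrable_compact_support[of K]) (use K(2) c in \<open>auto simp: C1_compact_def intro!: continuous_intros\<close>)
    then have i: "integrable (lebesgue_on \<Omega>) (\<lambda>x. (\<eta> x)\<^sup>2)"
      by (subst lebesgue_on_integrable_eq[OF assms(1)])
        (use K c in \<open>auto simp: C1_compact_def intro!: borel_measurable_continuous_onI continuous_intros\<close>)
    have "(\<integral>x. (G x \<bullet> b) * \<eta> x \<partial>lebesgue_on \<Omega>) = (\<integral>x. (H x \<bullet> b) * \<eta> x \<partial>lebesgue_on \<Omega>)"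
      using 1(2) 2(2) t b unfolding is_weak_grad_def by (metis minus_equation_iff)
    then show "(\<integral>x. (G x \<bullet> b - H x \<bullet> b) * \<eta> x \<partial>lebesgue_on \<Omega>) = 0"
      using integrable_mult_L2[OF G(1) m G(2) i] integrable_mult_L2[OF H(1) m H(2) i]
      by (simp add: left_diff_distrib)
  qed
  then have "AE x in lebesgue_on \<Omega>. \<forall>b\<in>Basis. G x \<bullet> b - H x \<bullet> b = 0"
    by (intro AE_finite_allI) auto
  then show ?thesis by eventually_elim (auto intro: euclidean_eqI)
qed

context
  fixes \<Omega> K :: "'a::euclidean_space set" and \<phi> G
  assumes open_domain: "open \<Omega>" and supp: "C1_compact K \<phi> G" "K \<subseteq> \<Omega>"
begin

lemma C1_compact_integrals:
  "integral\<^sup>L (lebesgue_on \<Omega>) (\<lambda>x. (\<phi> x)\<^sup>2) = (\<integral>x. (\<phi> x)\<^sup>2 \<partial>lborel)"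
  "integral\<^sup>L (lebesgue_on \<Omega>) (\<lambda>x. (norm (G x))\<^sup>2) = (\<integral>x. (norm (G x))\<^sup>2 \<partial>lborel)"
  "integrable lborel (\<lambda>x. (\<phi> x)\<^sup>2)" "integrable lborel (\<lambda>x. (norm (G x))\<^sup>2)"
  "L2_on \<Omega> \<phi>" "L2_on \<Omega> G"
proof -
  have K: "compact K" "continuous_on UNIV G" "\<And>x. x \<notin> K \<Longrightarrow> \<phi> x = 0" "\<And>x. x \<notin> K \<Longrightarrow> G x = 0" "continuous_on UNIV \<phi>"
    using supp(1) C1_compact_outside[OF supp(1)] C1_compact_continuous[OF supp(1)] by (auto simp: C1_compact_def)
  have c: "continuous_on UNIV (\<lambda>x. (\<phi> x)\<^sup>2)" "continuous_on UNIV (\<lambda>x. (norm (G x))\<^sup>2)"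
    using K by (auto intro!: continuous_intros)
  have o: "(\<phi> x)\<^sup>2 = 0" "(norm (G x))\<^sup>2 = 0" if "x \<notin> K" for x using K that by auto
  show i: "integrable lborel (\<lambda>x. (\<phi> x)\<^sup>2)" "integrable lborel (\<lambda>x. (norm (G x))\<^sup>2)"
    using o by (auto intro!: integrable_compact_support[OF K(1)] c)
  have m: "(\<lambda>x. (\<phi> x)\<^sup>2) \<in> borel_measurable borel" "(\<lambda>x. (norm (G x))\<^sup>2) \<in> borel_measurable borel"
    using c by (auto intro: borel_measurable_continuous_onI)
  have o': "(\<phi> x)\<^sup>2 = 0" "(norm (G x))\<^sup>2 = 0" if "x \<notin> \<Omega>" for x using o that supp(2) by auto
  show "integral\<^sup>L (lebesgue_on \<Omega>) (\<lambda>x. (\<phi> x)\<^sup>2) = (\<integral>x. (\<phi> x)\<^sup>2 \<partial>lborel)"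
    by (rule lebesgue_on_integral_eq[OF open_domain m(1) o'(1)])
  show "integral\<^sup>L (lebesgue_on \<Omega>) (\<lambda>x. (norm (G x))\<^sup>2) = (\<integral>x. (norm (G x))\<^sup>2 \<partial>lborel)"
    by (rule lebesgue_on_integral_eq[OF open_domain m(2) o'(2)])
  have "\<phi> \<in> borel_measurable (lebesgue_on \<Omega>)" "G \<in> borel_measurable (lebesgue_on \<Omega>)"
    using K by (auto intro!: measurable_restrict_space1 measurable_completion borel_measurable_continuous_onI)
  then show "L2_on \<Omega> \<phi>" "L2_on \<Omega> G"
    using i lebesgue_on_integrable_eq[OF open_domain m(1) o'(1)] lebesgue_on_integrable_eq[OF open_domain m(2) o'(2)]
    by (auto simp: L2_on_def)
qed

lemma C1_compact_weak_grad: "is_weak_grad \<Omega> \<phi> G"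
  unfolding is_weak_grad_def
proof (intro allI impI ballI)
  fix \<eta> and b :: 'a assume "test_function \<Omega> \<eta>"
  then obtain L where L: "L \<subseteq> \<Omega>" "C1_compact L \<eta> (grad \<eta>)" by (rule C1_compact_test_function)
  have c: "continuous_on UNIV \<phi>" "continuous_on UNIV \<eta>" "continuous_on UNIV G" "continuous_on UNIV (grad \<eta>)"
    using C1_compact_continuous[OF supp(1)] C1_compact_continuous[OF L(2)] supp(1) L(2) by (auto simp: C1_compact_def)
  have "(\<integral>x. \<phi> x * (grad \<eta> x \<bullet> b) \<partial>lebesgue_on \<Omega>) = (\<integral>x. \<phi> x * (grad \<eta> x \<bullet> b) \<partial>lborel)"
    by (rule lebesgue_on_integral_eq[OF open_domain])
      (use c supp in \<open>auto simp: C1_compact_def intro!: borel_measurable_continuous_onI continuous_intros\<close>)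
  also have "\<dots> = - (\<integral>x. (G x \<bullet> b) * \<eta> x \<partial>lborel)"
    by (rule integration_by_parts[OF supp(1)]) (use L(2) in \<open>auto simp: C1_compact_def\<close>)
  also have "(\<integral>x. (G x \<bullet> b) * \<eta> x \<partial>lborel) = (\<integral>x. (G x \<bullet> b) * \<eta> x \<partial>lebesgue_on \<Omega>)"
    by (rule lebesgue_on_integral_eq[OF open_domain, symmetric])
      (use c L in \<open>auto simp: C1_compact_def intro!: borel_measurable_continuous_onI continuous_intros\<close>)
  finally show "(\<integral>x. \<phi> x * (grad \<eta> x \<bullet> b) \<partial>lebesgue_on \<Omega>) = - (\<integral>x. (G x \<bullet> b) * \<eta> x \<partial>lebesgue_on \<Omega>)" .
qed

lemma C1_compact_H1: "\<phi> \<in> H1 \<Omega>"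
  using C1_compact_weak_grad C1_compact_integrals(5,6) by (auto simp: H1_def)

lemma C1_compact_wgrad:
  "(\<integral>x. (norm (wgrad \<Omega> \<phi> x))\<^sup>2 \<partial>lebesgue_on \<Omega>) = (\<integral>x. (norm (G x))\<^sup>2 \<partial>lborel)"
proof -
  have "L2_on \<Omega> (wgrad \<Omega> \<phi>) \<and> is_weak_grad \<Omega> \<phi> (wgrad \<Omega> \<phi>)"
    unfolding wgrad_def by (rule someI[where x = G]) (use C1_compact_weak_grad C1_compact_integrals(6) in blast)
  then have w: "L2_on \<Omega> (wgrad \<Omega> \<phi>)" "is_weak_grad \<Omega> \<phi> (wgrad \<Omega> \<phi>)" by auto
  have "AE x in lebesgue_on \<Omega>. wgrad \<Omega> \<phi> x = G x"
    by (rule weak_grad_unique[OF open_domain w C1_compact_integrals(6) C1_compact_weak_grad])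
  then have "(\<integral>x. (norm (wgrad \<Omega> \<phi> x))\<^sup>2 \<partial>lebesgue_on \<Omega>) = (\<integral>x. (norm (G x))\<^sup>2 \<partial>lebesgue_on \<Omega>)"
    using w(1) C1_compact_integrals(6) by (intro integral_cong_AE) (auto simp: L2_on_def)
  then show ?thesis using C1_compact_integrals(2) by simp
qed

end

text \<open>The difference to a mollification vanishes outside a fixed compact set, and there it is uniformly
  small together with its gradient.\<close>

lemma C1_compact_H10:
  fixes \<phi> :: "'a::euclidean_space \<Rightarrow> real"
  assumes "open \<Omega>" "C1_compact K \<phi> G" "K \<subseteq> \<Omega>"
  shows "\<phi> \<in> H10 \<Omega>"
proof -
  have "\<exists>\<eta>. test_function \<Omega> \<eta> \<and> H1_norm \<Omega> (\<lambda>x. \<phi> x - \<eta> x) < \<epsilon>" if "\<epsilon> > 0" for \<epsilon>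
  proof -
    obtain K' where K': "compact K'" "K' \<subseteq> \<Omega>" "K \<subseteq> K'"
      and mol: "\<And>\<epsilon>. \<epsilon> > 0 \<Longrightarrow> \<exists>\<eta>. test_function \<Omega> \<eta> \<and> (\<forall>x. x \<notin> K' \<longrightarrow> \<eta> x = 0) \<and> 
       (\<forall>x. \<bar>\<phi> x - \<eta> x\<bar> \<le> \<epsilon>) \<and> (\<forall>x. \<forall>b\<in>Basis. \<bar>G x \<bullet> b - grad \<eta> x \<bullet> b\<bar> \<le> \<epsilon>)"
      using mollify[OF assms(2,3,1)] by metis
    define m where "m = measure lborel K'"
    (* Uniform bounds d for the function and the components of its gradient give the squared norm
       d^2 m + DIM d^2 m. *)
    define d where "d = sqrt (\<epsilon>\<^sup>2 / ((1 + DIM('a)) * (m + 1)))"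
    have m: "m \<ge> 0" by (simp add: m_def)
    have d: "d > 0" unfolding d_def using that m by simp
    have d2: "d\<^sup>2 * ((1 + DIM('a)) * (m + 1)) = \<epsilon>\<^sup>2" unfolding d_def using m by simp
    obtain \<eta> where \<eta>: "test_function \<Omega> \<eta>" "\<And>x. x \<notin> K' \<Longrightarrow> \<eta> x = 0" "\<And>x. \<bar>\<phi> x - \<eta> x\<bar> \<le> d"
      "\<And>x b. b\<in>Basis \<Longrightarrow> \<bar>G x \<bullet> b - grad \<eta> x \<bullet> b\<bar> \<le> d"
      using mol[OF d] by metis
    obtain L where L: "C1_compact L \<eta> (grad \<eta>)" using C1_compact_test_function[OF \<eta>(1)] by metis
    then have "C1_compact K' \<eta> (grad \<eta>)" using \<eta>(2) K'(1) by (auto simp: C1_compact_def)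
    from C1_compact_lincomb[OF C1_compact_mono[OF assms(2) K'(3,1)] this, of 1 "-1"]
    have D: "C1_compact K' (\<lambda>x. \<phi> x - \<eta> x) (\<lambda>x. G x - grad \<eta> x)" by simp
    note I = C1_compact_integrals[OF assms(1) D K'(2)]
    have e: "emeasure lborel K' < \<infinity>" using K'(1) by (rule emeasure_compact_finite)
    have mK: "K' \<in> sets lborel" using K'(1) by (simp add: borel_compact)
    have iK: "integrable lborel (\<lambda>x. c * indicator K' x)" for c :: real using e mK by (intro integrable_mult_right) auto
    have "(\<integral>x. (\<phi> x - \<eta> x)\<^sup>2 \<partial>lborel) \<le> (\<integral>x. d\<^sup>2 * indicator K' x \<partial>lborel)"
    proof (rule integral_mono[OF I(3) iK])
      show "(\<phi> x - \<eta> x)\<^sup>2 \<le> d\<^sup>2 * indicator K' x" for x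
      proof (cases "x \<in> K'")
        case True
        then show ?thesis using power_mono[OF \<eta>(3)[of x], of 2] by simp
      next
        case False
        then have "\<phi> x = 0" "\<eta> x = 0" using \<eta>(2) assms(2) K'(3) by (auto simp: C1_compact_def)
        then show ?thesis by simp
      qed
    qed
    moreover have "(\<integral>x. (norm (G x - grad \<eta> x))\<^sup>2 \<partial>lborel) \<le> (\<integral>x. (DIM('a) * d\<^sup>2) * indicator K' x \<partial>lborel)"
    proof (rule integral_mono[OF I(4) iK])
      show "(norm (G x - grad \<eta> x))\<^sup>2 \<le> (DIM('a) * d\<^sup>2) * indicator K' x" for x
      proof (cases "x \<in> K'")
        case True
        have "(norm (G x - grad \<eta> x))\<^sup>2 = (\<Sum>b\<in>Basis. ((G x - grad \<eta> x) \<bullet> b)\<^sup>2)"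
          unfolding power2_norm_eq_inner by (subst euclidean_inner) (simp only: power2_eq_square)
        also have "\<dots> \<le> (\<Sum>b\<in>(Basis::'a set). d\<^sup>2)"
        proof (rule sum_mono)
          fix b :: 'a assume "b \<in> Basis"
          from power_mono[OF \<eta>(4)[OF this, of x], of 2]
          show "((G x - grad \<eta> x) \<bullet> b)\<^sup>2 \<le> d\<^sup>2" by (simp add: inner_diff_left)
        qed
        finally show ?thesis using True by simp
      next
        case False
        then show ?thesis using C1_compact_outside[OF D] by simp
      qed
    qed
    ultimately have "(\<integral>x. (\<phi> x - \<eta> x)\<^sup>2 \<partial>lborel) + (\<integral>x. (norm (G x - grad \<eta> x))\<^sup>2 \<partial>lborel) \<le> d\<^sup>2 * m + DIM('a) * d\<^sup>2 * m"
      using e mK by (simp add: m_def)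
    also have "\<dots> < \<epsilon>\<^sup>2" unfolding d2[symmetric] using m d by (auto simp: algebra_simps add_strict_increasing)
    finally have "H1_norm \<Omega> (\<lambda>x. \<phi> x - \<eta> x) < sqrt (\<epsilon>\<^sup>2)"
      unfolding H1_norm_def C1_compact_wgrad[OF assms(1) D K'(2)] I(1) by (rule real_sqrt_less_mono)
    then show ?thesis using \<eta>(1) that by auto
  qed
  then show ?thesis using C1_compact_H1[OF assms] by (auto simp: H10_def)
qed

section \<open>Two negative directions with disjoint supports\<close>

text \<open>If \<open>c\<close> is the derivative of the semilinear nonlinearity along the solution and \<open>\<phi>\<close> is of class \<open>C1\<close> with compact
  support in \<open>\<Omega>\<close>, this is the Morse form (\<open>morse_form_C1_compact\<close>).  The gradient is a
  separate argument because it is known by a formula.\<close>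

definition quadratic_form :: "('a::euclidean_space \<Rightarrow> real) \<Rightarrow> ('a \<Rightarrow> real) \<Rightarrow> ('a \<Rightarrow> 'a) \<Rightarrow> real" where
  "quadratic_form c \<phi> G = (\<integral>x. (norm (G x))\<^sup>2 \<partial>lborel) - (\<integral>x. c x * (\<phi> x)\<^sup>2 \<partial>lborel)"

lemma continuous_on_mult_support:
  fixes c f :: "'a::euclidean_space \<Rightarrow> real"
  assumes "open \<Omega>" "compact K" "K \<subseteq> \<Omega>" "continuous_on \<Omega> c" "continuous_on UNIV f" "\<And>x. x \<notin> K \<Longrightarrow> f x = 0"
  shows "continuous_on UNIV (\<lambda>x. c x * f x)"
proof -
  have "open (- K)" using assms(2) by (simp add: compact_imp_closed open_Compl)
  moreover have "continuous_on \<Omega> (\<lambda>x. c x * f x)"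
    by (intro continuous_intros assms(4) continuous_on_subset[OF assms(5)]) auto
  moreover have "continuous_on (- K) (\<lambda>x. c x * f x)"
    by (subst continuous_on_cong[OF refl, where g = "\<lambda>_. 0"]) (auto simp: assms(6))
  ultimately have "continuous_on (\<Omega> \<union> - K) (\<lambda>x. c x * f x)" using assms(1) by (intro continuous_on_open_Un)
  moreover have "\<Omega> \<union> - K = UNIV" using assms(3) by auto
  ultimately show ?thesis by simp
qed

context
  fixes \<Omega> :: "'a::euclidean_space set" and c :: "'a \<Rightarrow> real"
  assumes open_domain: "open \<Omega>" and potential: "continuous_on \<Omega> c"
begin

lemma morse_form_C1_compact:
  assumes "C1_compact K \<phi> G" "K \<subseteq> \<Omega>"
    and c: "\<And>x. x \<in> \<Omega> \<Longrightarrow> c x = deriv (semilin_nonlin a \<psi> p x) (inv (change_var a) (u x))"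
  shows "morse_form \<Omega> a \<psi> p u \<phi> = quadratic_form c \<phi> G"
proof -
  have K: "compact K" "\<And>x. x \<notin> K \<Longrightarrow> \<phi> x = 0" using assms(1) by (auto simp: C1_compact_def)
  have cont: "continuous_on UNIV (\<lambda>x. c x * (\<phi> x)\<^sup>2)"
    by (rule continuous_on_mult_support[OF open_domain K(1) assms(2) potential])
      (use K C1_compact_continuous[OF assms(1)] in \<open>auto intro!: continuous_intros\<close>)
  have "(\<integral>x. deriv (semilin_nonlin a \<psi> p x) (inv (change_var a) (u x)) * (\<phi> x)\<^sup>2 \<partial>lebesgue_on \<Omega>)
      = (\<integral>x. c x * (\<phi> x)\<^sup>2 \<partial>lebesgue_on \<Omega>)"
    using c by (intro Bochner_Integration.integral_cong) auto
  also have "\<dots> = (\<integral>x. c x * (\<phi> x)\<^sup>2 \<partial>lborel)"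
    by (rule lebesgue_on_integral_eq[OF open_domain borel_measurable_continuous_onI[OF cont]])
      (use K(2) assms(2) in auto)
  finally show ?thesis
    unfolding morse_form_def Let_def quadratic_form_def C1_compact_wgrad[OF open_domain assms(1,2)] by simp
qed

text \<open>Disjoint supports make the mixed terms vanish pointwise.\<close>

lemma quadratic_form_disjoint:
  assumes "C1_compact K \<phi> G" "K \<subseteq> \<Omega>" "C1_compact L \<xi> H" "L \<subseteq> \<Omega>" "K \<inter> L = {}"
  shows "quadratic_form c (\<lambda>x. s * \<phi> x + t * \<xi> x) (\<lambda>x. s *\<^sub>R G x + t *\<^sub>R H x) =
    s\<^sup>2 * quadratic_form c \<phi> G + t\<^sup>2 * quadratic_form c \<xi> H"
proof -
  have K: "compact K" "\<And>x. x \<notin> K \<Longrightarrow> \<phi> x = 0" "\<And>x. x \<notin> K \<Longrightarrow> G x = 0"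
    using assms(1) C1_compact_outside by (auto simp: C1_compact_def)
  have L: "compact L" "\<And>x. x \<notin> L \<Longrightarrow> \<xi> x = 0" "\<And>x. x \<notin> L \<Longrightarrow> H x = 0"
    using assms(3) C1_compact_outside by (auto simp: C1_compact_def)
  have "continuous_on UNIV (\<lambda>x. c x * (\<phi> x)\<^sup>2)"
    by (rule continuous_on_mult_support[OF open_domain K(1) assms(2) potential])
      (use K C1_compact_continuous[OF assms(1)] in \<open>auto intro!: continuous_intros\<close>)
  then have i1: "integrable lborel (\<lambda>x. c x * (\<phi> x)\<^sup>2)"
    by (rule integrable_compact_support[OF K(1)]) (simp add: K)
  have "continuous_on UNIV (\<lambda>x. c x * (\<xi> x)\<^sup>2)"
    by (rule continuous_on_mult_support[OF open_domain L(1) assms(4) potential])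
      (use L C1_compact_continuous[OF assms(3)] in \<open>auto intro!: continuous_intros\<close>)
  then have i2: "integrable lborel (\<lambda>x. c x * (\<xi> x)\<^sup>2)"
    by (rule integrable_compact_support[OF L(1)]) (simp add: L)
  note j1 = C1_compact_integrals(4)[OF open_domain assms(1,2)]
  note j2 = C1_compact_integrals(4)[OF open_domain assms(3,4)]
  have dich: "x \<notin> K \<or> x \<notin> L" for x using assms(5) by blast
  have e: "(norm (s *\<^sub>R G x + t *\<^sub>R H x))\<^sup>2 = s\<^sup>2 * (norm (G x))\<^sup>2 + t\<^sup>2 * (norm (H x))\<^sup>2"
    "c x * (s * \<phi> x + t * \<xi> x)\<^sup>2 = s\<^sup>2 * (c x * (\<phi> x)\<^sup>2) + t\<^sup>2 * (c x * (\<xi> x)\<^sup>2)" for x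
    using dich[of x] K(2,3)[of x] L(2,3)[of x] by (auto simp: power_mult_distrib)
  have "(\<integral>x. (norm (s *\<^sub>R G x + t *\<^sub>R H x))\<^sup>2 \<partial>lborel) = s\<^sup>2 * (\<integral>x. (norm (G x))\<^sup>2 \<partial>lborel) + t\<^sup>2 * (\<integral>x. (norm (H x))\<^sup>2 \<partial>lborel)"
    unfolding e(1) using j1 j2 by simp
  moreover have "(\<integral>x. c x * (s * \<phi> x + t * \<xi> x)\<^sup>2 \<partial>lborel) = s\<^sup>2 * (\<integral>x. c x * (\<phi> x)\<^sup>2 \<partial>lborel) + t\<^sup>2 * (\<integral>x. c x * (\<xi> x)\<^sup>2 \<partial>lborel)"
    unfolding e(2) using i1 i2 by simp
  ultimately show ?thesis unfolding quadratic_form_def by (simp only: algebra_simps)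
qed

text \<open>By \<open>quadratic_form_disjoint\<close> the form is negative definite on the plane spanned by the two functions,
  which are independent because neither of them is zero.\<close>

lemma morse_index_ge_2:
  assumes 1: "C1_compact K \<phi> G" "K \<subseteq> \<Omega>" "quadratic_form c \<phi> G < 0"
    and 2: "C1_compact L \<xi> H" "L \<subseteq> \<Omega>" "quadratic_form c \<xi> H < 0" and disj: "K \<inter> L = {}"
    and c: "\<And>x. x \<in> \<Omega> \<Longrightarrow> c x = deriv (semilin_nonlin a \<psi> p x) (inv (change_var a) (u x))"
  shows "morse_index \<Omega> a \<psi> p u \<ge> 2"
proof -
  define V where "V = span {\<phi>, \<xi>}"
  have KL: "compact (K \<union> L)" using 1 2 by (auto simp: C1_compact_def)
  have lin: "\<exists>s t. \<zeta> = (\<lambda>x. s * \<phi> x + t * \<xi> x)" if z: "\<zeta> \<in> V" for \<zeta>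
  proof -
    obtain s where "\<zeta> - s *\<^sub>R \<phi> \<in> span {\<xi>}" using z unfolding V_def span_insert by blast
    then obtain t where "\<zeta> - s *\<^sub>R \<phi> = t *\<^sub>R \<xi>" unfolding span_singleton by blast
    then have "\<zeta> = s *\<^sub>R \<phi> + t *\<^sub>R \<xi>" by (simp add: diff_eq_eq add.commute)
    then have "\<zeta> = (\<lambda>x. s * \<phi> x + t * \<xi> x)" by (simp add: plus_fun_def scaleR_fun_def)
    then show ?thesis by blast
  qed
  have comb: "C1_compact (K \<union> L) (\<lambda>x. s * \<phi> x + t * \<xi> x) (\<lambda>x. s *\<^sub>R G x + t *\<^sub>R H x)" for s t
    using 1(1) 2(1) KL by (intro C1_compact_lincomb) (auto elim: C1_compact_mono)
  have form: "morse_form \<Omega> a \<psi> p u (\<lambda>x. s * \<phi> x + t * \<xi> x) = s\<^sup>2 * quadratic_form c \<phi> G + t\<^sup>2 * quadratic_form c \<xi> H" for s t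
    using morse_form_C1_compact[OF comb _ c] quadratic_form_disjoint[OF 1(1,2) 2(1,2) disj] 1(2) 2(2) by simp
  have "V \<subseteq> H10 \<Omega>"
  proof
    fix \<zeta> assume "\<zeta> \<in> V"
    then obtain s t where "\<zeta> = (\<lambda>x. s * \<phi> x + t * \<xi> x)" using lin by blast
    then show "\<zeta> \<in> H10 \<Omega>" using C1_compact_H10[OF open_domain comb] 1(2) 2(2) by simp
  qed
  moreover have "morse_form \<Omega> a \<psi> p u \<zeta> < 0" if z: "\<zeta> \<in> V" "\<zeta> \<noteq> 0" for \<zeta>
  proof -
    obtain s t where st: "\<zeta> = (\<lambda>x. s * \<phi> x + t * \<xi> x)" using lin z by blast
    have "s \<noteq> 0 \<or> t \<noteq> 0" using z(2) st by (auto simp: zero_fun_def)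
    moreover have "s\<^sup>2 * quadratic_form c \<phi> G \<le> 0" "s \<noteq> 0 \<Longrightarrow> s\<^sup>2 * quadratic_form c \<phi> G < 0" 
      "t\<^sup>2 * quadratic_form c \<xi> H \<le> 0" "t \<noteq> 0 \<Longrightarrow> t\<^sup>2 * quadratic_form c \<xi> H < 0"
      using 1(3) 2(3) by (auto simp: mult_le_0_iff mult_less_0_iff)
    ultimately show ?thesis unfolding st form by linarith
  qed
  moreover have "subspace V" unfolding V_def by simp
  ultimately have "vdim V \<le> morse_index \<Omega> a \<psi> p u"
    unfolding morse_index_def by (intro SUP_upper) auto
  moreover have "vdim V = 2"
  proof -
    have nz: "quadratic_form c (\<lambda>x. 0) (\<lambda>x. 0) = 0" by (simp add: quadratic_form_def)
    have nonzero: "\<zeta> \<noteq> (\<lambda>x. 0)" if "C1_compact M \<zeta> E" "quadratic_form c \<zeta> E < 0" for M \<zeta> E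
    proof
      assume z: "\<zeta> = (\<lambda>x. 0)"
      have "E x = 0" for x
        using C1_compact_grad[OF that(1), of x] grad_eqI[of \<zeta> 0 x] unfolding z by simp
      then have "E = (\<lambda>x. 0)" by auto
      then show False using that(2) nz z by simp
    qed
    have ni: "\<phi> \<noteq> (\<lambda>x. s * \<xi> x)" for s
    proof
      assume e: "\<phi> = (\<lambda>x. s * \<xi> x)"
      have "\<phi> x = 0" for x
      proof (cases "x \<in> K")
        case True
        then have "\<xi> x = 0" using 2(1) disj by (auto simp: C1_compact_def)
        then show ?thesis by (simp add: e)
      qed (use 1(1) in \<open>simp add: C1_compact_def\<close>)
      then show False using nonzero[OF 1(1,3)] by auto
    qed
    have "\<xi> \<noteq> 0" using nonzero[OF 2(1,3)] by (simp add: zero_fun_def)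
    moreover have "\<phi> \<notin> span {\<xi>}"
      using ni unfolding span_singleton by (auto simp: scaleR_fun_def)
    ultimately have "independent {\<phi>, \<xi>}" by (simp add: independent_insert)
    moreover have "\<phi> \<noteq> \<xi>" using ni[of 1] by auto
    ultimately have "dim V = 2" unfolding V_def using dim_span_eq_card_independent[of "{\<phi>, \<xi>}"] by simp
    then have "enat (dim V) = 2" by (simp add: numeral_eq_enat)
    moreover have "\<exists>B. finite B \<and> V \<subseteq> span B" unfolding V_def by (intro exI[of _ "{\<phi>, \<xi>}"]) auto
    ultimately show ?thesis by (simp add: vdim_def)
  qed
  ultimately show ?thesis by simp
qed

end

section \<open>Superharmonic functions\<close>

lemma deriv2_nonneg_at_min:
  fixes f :: "real \<Rightarrow> real"
  assumes d: "e > 0" "\<And>t. \<bar>t\<bar> < e \<Longrightarrow> (f has_real_derivative f' t) (at t)"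
    and d2: "(f' has_real_derivative l) (at 0)"
    and min: "\<And>t. \<bar>t\<bar> < e \<Longrightarrow> f 0 \<le> f t"
  shows "l \<ge> 0"
proof (rule ccontr)
  assume "\<not> l \<ge> 0"
  have "f' 0 = 0"
    by (rule DERIV_local_min[OF d(2) d(1)]) (use d(1) min in auto)
  from DERIV_neg_dec_right[OF d2] \<open>\<not> l \<ge> 0\<close>
  obtain s where s: "s > 0" "\<And>h. h > 0 \<Longrightarrow> h < s \<Longrightarrow> f' (0 + h) < f' 0" by auto
  define h where "h = min s e / 2"
  have h: "0 < h" "h < s" "h < e" using s(1) d(1) by (auto simp: h_def)
  have "f h < f 0"
  proof (rule DERIV_neg_imp_decreasing_open[OF h(1)])
    show "\<exists>y. (f has_real_derivative y) (at x) \<and> y < 0" if "0 < x" "x < h" for x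
      using d(2)[of x] s(2)[of x] that h \<open>f' 0 = 0\<close> by auto
    show "continuous_on {0..h} f"
      using h by (intro continuous_at_imp_continuous_on ballI DERIV_isCont[OF d(2)]) auto
  qed
  then show False using min[of h] h by auto
qed

lemma laplacian_nonneg_at_min:
  fixes f :: "'a::euclidean_space \<Rightarrow> real"
  assumes "open S" "x0 \<in> S"
    and f: "\<And>x. x \<in> S \<Longrightarrow> (f has_derivative (\<lambda>h. G x \<bullet> h)) (at x)"
    and G: "(G has_derivative H) (at x0)"
    and min: "\<And>x. x \<in> S \<Longrightarrow> f x0 \<le> f x"
  shows "(\<Sum>b\<in>Basis. H b \<bullet> b) \<ge> 0"
proof (rule sum_nonneg)
  fix b :: 'a assume b: "b \<in> Basis"
  obtain e where e: "e > 0" "ball x0 e \<subseteq> S" using assms(1,2) open_contains_ball by blast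
  have inS: "x0 + t *\<^sub>R b \<in> S" if "\<bar>t\<bar> < e" for t
    using e(2) that b by (auto simp: subset_eq dist_norm)
  have lin: "((\<lambda>t. x0 + t *\<^sub>R b) has_derivative (\<lambda>s. s *\<^sub>R b)) (at t)" for t
    by (auto intro!: derivative_eq_intros)
  have m: "(\<lambda>s. s * c) = (*) c" for c :: real by (auto simp: mult.commute)
  show "H b \<bullet> b \<ge> 0"
  proof (rule deriv2_nonneg_at_min[OF e(1)])
    show "((\<lambda>t. f (x0 + t *\<^sub>R b)) has_real_derivative G (x0 + t *\<^sub>R b) \<bullet> b) (at t)" if "\<bar>t\<bar> < e" for t
      using has_derivative_compose[OF lin f[OF inS[OF that]]] by (simp add: has_field_derivative_def m)
    interpret bounded_linear H using G by (rule has_derivative_bounded_linear)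
    have "((\<lambda>t. G (x0 + t *\<^sub>R b)) has_derivative (\<lambda>s. s *\<^sub>R H b)) (at 0)"
      using has_derivative_compose[OF lin[of 0], of G H] G by (simp add: scaleR)
    from has_derivative_inner_left[OF this, of b]
    show "((\<lambda>t. G (x0 + t *\<^sub>R b) \<bullet> b) has_real_derivative H b \<bullet> b) (at 0)"
      by (simp add: has_field_derivative_def m)
    show "f (x0 + 0 *\<^sub>R b) \<le> f (x0 + t *\<^sub>R b)" if "\<bar>t\<bar> < e" for t using min[OF inS[OF that]] by simp
  qed
qed

text \<open>Comparison with a barrier: a function that vanishes on the sphere of radius \<open>R\<close>, has positive
  Laplacian in an annulus next to it, and decreases towards it at a positive rate.  With
  \<open>q = R\<^sup>2 - |x - c|\<^sup>2\<close> and \<open>N\<close> the dimension, \<open>z = q + M q\<^sup>2\<close> satisfies \<open>\<Delta>z = 8 M |x - c|\<^sup>2 - 2 N (1 + 2 M q)\<close>,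
  which is positive near the sphere once \<open>M\<close> is large.\<close>

lemma hopf_boundary_point:
  fixes f :: "'a::euclidean_space \<Rightarrow> real"
  assumes C2: "\<And>x. x \<in> S \<Longrightarrow> (f has_derivative (\<lambda>h. G x \<bullet> h)) (at x)"
      "\<And>x. x \<in> ball c R \<Longrightarrow> (G has_derivative H x) (at x)"
      "\<And>x. x \<in> ball c R \<Longrightarrow> (\<Sum>b\<in>Basis. H x b \<bullet> b) \<le> 0"
    and R: "R > 0" "cball c R \<subseteq> S"
    and pos: "\<And>x. x \<in> ball c R \<Longrightarrow> f x > 0" and nonneg: "\<And>x. x \<in> cball c R \<Longrightarrow> f x \<ge> 0"
    and y: "dist c y = R" "f y = 0"
  shows "G y \<bullet> (c - y) > 0"
proof -
  define q where "q x = R\<^sup>2 - (x - c) \<bullet> (x - c)" for x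
  define N where "N = real DIM('a)"
  have N: "N \<ge> 1" unfolding N_def using DIM_positive[where 'a='a] by linarith
  (* With this M, and with r below, M q <= 1 and N <= M |x - c|^2 hold in the annulus r <= |x - c| <= R,
     so the Laplacian of the barrier is at least 8 N - 2 N - 4 N there. *)
  define M where "M = (N + 1) / R\<^sup>2"
  have M: "M > 0" "M * R\<^sup>2 = N + 1" using N R(1) by (auto simp: M_def)
  define z where "z x = q x + M * (q x)\<^sup>2" for x
  define Gz where "Gz x = (-2 * (1 + 2 * M * q x)) *\<^sub>R (x - c)" for x
  define Hz where "Hz x h = (8 * M * ((x - c) \<bullet> h)) *\<^sub>R (x - c) - (2 * (1 + 2 * M * q x)) *\<^sub>R h" for x h
  have dq: "(q has_derivative (\<lambda>h. -2 * ((x - c) \<bullet> h))) (at x)" for x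
    unfolding q_def[abs_def] by (auto intro!: derivative_eq_intros simp: inner_commute)
  have dz: "(z has_derivative (\<lambda>h. Gz x \<bullet> h)) (at x)" for x
    unfolding z_def[abs_def] by (auto intro!: derivative_eq_intros dq simp: Gz_def algebra_simps)
  have dGz: "(Gz has_derivative Hz x) (at x)" for x
    unfolding Gz_def[abs_def] Hz_def[abs_def]
    by (auto intro!: derivative_eq_intros dq simp: algebra_simps)
  have lapz: "(\<Sum>b\<in>Basis. Hz x b \<bullet> b) = 8 * M * ((x - c) \<bullet> (x - c)) - 2 * N * (1 + 2 * M * q x)" for x
  proof -
    have "(\<Sum>b\<in>Basis. Hz x b \<bullet> b) = (\<Sum>b\<in>Basis. 8 * M * (((x - c) \<bullet> b) * ((x - c) \<bullet> b)) - 2 * (1 + 2 * M * q x))"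
      by (intro sum.cong) (auto simp: Hz_def inner_diff_left)
    also have "\<dots> = 8 * M * (\<Sum>b\<in>Basis. ((x - c) \<bullet> b) * ((x - c) \<bullet> b)) - N * (2 * (1 + 2 * M * q x))"
      by (simp add: sum_subtractf sum_distrib_left N_def)
    finally show ?thesis by (simp add: euclidean_inner[of "x - c" "x - c"])
  qed
  define r where "r = sqrt (R\<^sup>2 * N / (N + 1))"
  have r2: "r\<^sup>2 = R\<^sup>2 * N / (N + 1)" unfolding r_def using N by simp
  have r: "0 < r" "r < R"
  proof -
    show "0 < r" unfolding r_def using N R by simp
    have "r\<^sup>2 < R\<^sup>2" unfolding r2 using N R by (simp add: divide_less_eq)
    then show "r < R" using R by (simp add: power_less_imp_less_base)
  qed
  have lap_pos: "(\<Sum>b\<in>Basis. Hz x b \<bullet> b) > 0" if "r \<le> norm (x - c)" "norm (x - c) \<le> R" for x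
  proof -
    have "r\<^sup>2 \<le> (norm (x - c))\<^sup>2" using that r by (intro power_mono) auto
    then have a: "R\<^sup>2 * N / (N + 1) \<le> (x - c) \<bullet> (x - c)" by (simp add: r2 power2_norm_eq_inner)
    then have "q x \<le> R\<^sup>2 - R\<^sup>2 * N / (N + 1)" by (simp add: q_def)
    also have "\<dots> = R\<^sup>2 / (N + 1)" using N by (simp add: field_simps)
    finally have "M * q x \<le> M * (R\<^sup>2 / (N + 1))" by (rule mult_left_mono) (use M(1) in simp)
    also have "\<dots> = 1" using M N by simp
    finally have 1: "M * q x \<le> 1" .
    have "M * (R\<^sup>2 * N / (N + 1)) \<le> M * ((x - c) \<bullet> (x - c))" by (rule mult_left_mono[OF a]) (use M(1) in simp)
    moreover have "M * (R\<^sup>2 * N / (N + 1)) = N" using M(2) N by (simp add: mult.assoc[symmetric])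
    ultimately have 2: "N \<le> M * ((x - c) \<bullet> (x - c))" by simp
    have 3: "N * (M * q x) \<le> N * 1" using 1 N by (intro mult_left_mono) auto
    have "8 * M * A - 2 * N * (1 + 2 * M * q x) = 8 * (M * A) - 2 * N - 4 * (N * (M * q x))" for A
      by (simp add: algebra_simps)
    then show ?thesis unfolding lapz using 2 3 N by (smt (verit))
  qed
  have cS: "continuous_on S f"
    using C2(1) by (meson continuous_at_imp_continuous_on has_derivative_continuous)
  have cz: "continuous_on UNIV z" using dz by (meson continuous_at_imp_continuous_on has_derivative_continuous)
  have "\<exists>m>0. \<forall>x\<in>cball c r. m \<le> f x"
  proof -
    have "continuous_on (cball c r) f" using R(2) r by (intro continuous_on_subset[OF cS]) auto
    from continuous_attains_inf[OF compact_cball _ this] r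
    obtain x0 where "x0 \<in> cball c r" "\<forall>x\<in>cball c r. f x0 \<le> f x" by auto
    then show ?thesis using pos[of x0] r by (intro exI[of _ "f x0"]) auto
  qed
  then obtain m where m: "m > 0" "\<And>x. x \<in> cball c r \<Longrightarrow> m \<le> f x" by blast
  define Z where "Z = R\<^sup>2 + M * (R\<^sup>2)\<^sup>2"
  have Z: "Z > 0" using R M by (auto simp: Z_def intro: add_pos_nonneg)
  have zZ: "z x \<le> Z" if "x \<in> cball c R" for x
  proof -
    have "(norm (x - c))\<^sup>2 \<le> R\<^sup>2" using that by (intro power_mono) (auto simp: dist_norm norm_minus_commute)
    then have "0 \<le> q x" "q x \<le> R\<^sup>2" by (simp_all add: q_def power2_norm_eq_inner)
    then show ?thesis unfolding z_def Z_def using M(1)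
      by (intro add_mono mult_left_mono power_mono) auto
  qed
  (* Small enough for f - eps z to be positive on the inner ball; on the sphere z vanishes. *)
  define \<epsilon> where "\<epsilon> = m / (2 * Z)"
  have \<epsilon>: "\<epsilon> > 0" "\<epsilon> * Z < m" using m Z by (auto simp: \<epsilon>_def)
  define k where "k x = f x - \<epsilon> * z x" for x
  have zbd: "z x = 0" if "dist c x = R" for x
    using that by (simp add: z_def q_def dist_norm norm_minus_commute power2_norm_eq_inner[symmetric])
  have comp: "k x \<ge> 0" if "x \<in> cball c R" for x
  proof -
    have "continuous_on (cball c R) k" unfolding k_def[abs_def]
      by (intro continuous_intros continuous_on_subset[OF cS R(2)] continuous_on_subset[OF cz]) auto
    from continuous_attains_inf[OF compact_cball _ this] R(1)
    obtain x0 where x0: "x0 \<in> cball c R" "\<And>x. x \<in> cball c R \<Longrightarrow> k x0 \<le> k x" by auto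
    (* A negative minimum would lie inside the annulus, where the Laplacian of k is negative. *)
    have "k x0 \<ge> 0"
    proof (rule ccontr)
      assume neg: "\<not> k x0 \<ge> 0"
      have "x0 \<notin> cball c r"
      proof
        assume "x0 \<in> cball c r"
        then have "m \<le> f x0" by (rule m)
        moreover have "\<epsilon> * z x0 \<le> \<epsilon> * Z" using zZ[OF x0(1)] \<epsilon>(1) by simp
        ultimately show False using neg \<epsilon>(2) by (simp add: k_def)
      qed
      moreover have "dist c x0 \<noteq> R"
        using neg nonneg[OF x0(1)] zbd[of x0] by (auto simp: k_def)
      ultimately have in1: "x0 \<in> ball c R" "r \<le> norm (x0 - c)" "norm (x0 - c) \<le> R"
        using x0(1) by (auto simp: dist_norm norm_minus_commute)
      have "(\<Sum>b\<in>Basis. (H x0 b - \<epsilon> *\<^sub>R Hz x0 b) \<bullet> b) \<ge> 0"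
      proof (rule laplacian_nonneg_at_min[OF open_ball in1(1), of k "\<lambda>x. G x - \<epsilon> *\<^sub>R Gz x"])
        show "(k has_derivative (\<bullet>) (G x - \<epsilon> *\<^sub>R Gz x)) (at x)" if "x \<in> ball c R" for x
        proof -
          have "x \<in> S" using that R(2) by auto
          have "(k has_derivative (\<lambda>h. G x \<bullet> h - \<epsilon> * (Gz x \<bullet> h))) (at x)" unfolding k_def[abs_def]
            by (intro has_derivative_diff has_derivative_mult_right dz C2(1) \<open>x \<in> S\<close>)
          moreover have "(\<lambda>h. G x \<bullet> h - \<epsilon> * (Gz x \<bullet> h)) = (\<bullet>) (G x - \<epsilon> *\<^sub>R Gz x)" by (auto simp: inner_diff_left)
          ultimately show ?thesis by simp
        qed
        show "((\<lambda>x. G x - \<epsilon> *\<^sub>R Gz x) has_derivative (\<lambda>b. H x0 b - \<epsilon> *\<^sub>R Hz x0 b)) (at x0)"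
          by (intro has_derivative_diff has_derivative_scaleR_right dGz C2(2) in1)
        show "k x0 \<le> k x" if "x \<in> ball c R" for x using that x0(2) by auto
      qed
      also have "(\<Sum>b\<in>Basis. (H x0 b - \<epsilon> *\<^sub>R Hz x0 b) \<bullet> b) = (\<Sum>b\<in>Basis. H x0 b \<bullet> b) - \<epsilon> * (\<Sum>b\<in>Basis. Hz x0 b \<bullet> b)"
        by (simp add: inner_diff_left sum_subtractf sum_distrib_left)
      finally show False using C2(3)[OF in1(1)] mult_pos_pos[OF \<epsilon>(1) lap_pos[OF in1(2,3)]] by linarith
    qed
    then show ?thesis using x0(2)[OF that] by linarith
  qed
  have yS: "y \<in> S" using R(2) y(1) by auto
  have ky: "k y = 0" using y zbd[of y] by (simp add: k_def)
  have dk: "(k has_derivative (\<lambda>h. G y \<bullet> h - \<epsilon> * (Gz y \<bullet> h))) (at y)" unfolding k_def[abs_def]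
    by (intro has_derivative_diff has_derivative_mult_right dz C2(1) yS)
  (* k is nonnegative in the ball and vanishes at y, so its inward derivative at y is nonnegative. *)
  have "G y \<bullet> (c - y) - \<epsilon> * (Gz y \<bullet> (c - y)) \<ge> 0"
  proof (rule ccontr)
    assume neg: "\<not> ?thesis"
    define j where "j t = k (y + t *\<^sub>R (c - y))" for t
    have lin: "((\<lambda>t. y + t *\<^sub>R (c - y)) has_derivative (\<lambda>s. s *\<^sub>R (c - y))) (at t)" for t
      by (auto intro!: derivative_eq_intros)
    have "(j has_derivative (\<lambda>s. s * (G y \<bullet> (c - y) - \<epsilon> * (Gz y \<bullet> (c - y))))) (at 0)"
      using has_derivative_compose[OF lin[of 0], of k "\<lambda>h. G y \<bullet> h - \<epsilon> * (Gz y \<bullet> h)"] dk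
      by (simp add: j_def[abs_def] algebra_simps)
    then have "(j has_real_derivative (G y \<bullet> (c - y) - \<epsilon> * (Gz y \<bullet> (c - y)))) (at 0)"
      unfolding has_field_derivative_def by (simp add: mult.commute[of _ "G y \<bullet> (c - y) - _"])
    from DERIV_neg_dec_right[OF this] neg
    obtain s where s: "s > 0" "\<And>h. h > 0 \<Longrightarrow> h < s \<Longrightarrow> j (0 + h) < j 0" by auto
    define h where "h = min s 1 / 2"
    have h: "h > 0" "h < s" "h \<le> 1" using s(1) by (auto simp: h_def)
    have "j h < 0" using s(2)[OF h(1,2)] ky by (simp add: j_def)
    moreover have "y + h *\<^sub>R (c - y) \<in> cball c R"
    proof -
      have "c - (y + h *\<^sub>R (c - y)) = (1 - h) *\<^sub>R (c - y)" by (simp add: algebra_simps)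
      then have "dist c (y + h *\<^sub>R (c - y)) = (1 - h) * R" using h y(1) by (simp add: dist_norm)
      also have "\<dots> \<le> 1 * R" using h R(1) by (intro mult_right_mono) auto
      finally show ?thesis by simp
    qed
    ultimately show False using comp[of "y + h *\<^sub>R (c - y)"] by (simp add: j_def)
  qed
  moreover have "q y = 0" using y(1) by (simp add: q_def dist_norm norm_minus_commute power2_norm_eq_inner[symmetric])
  then have "Gz y = 2 *\<^sub>R (c - y)" by (simp add: Gz_def algebra_simps)
  then have "Gz y \<bullet> (c - y) = 2 * R\<^sup>2"
    using y(1) by (simp add: dist_norm power2_norm_eq_inner[symmetric])
  ultimately show ?thesis using \<epsilon>(1) R(1) by (smt (verit) mult_pos_pos zero_less_power)
qed

text \<open>The zero set is closed.  If a zero had points with \<open>f > 0\<close> nearby, a ball around such a point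
  could be enlarged until it touches the zero set; at the point of contact Hopf's lemma gives
  a nonzero gradient, which is impossible at an interior minimum.\<close>

lemma strong_minimum_principle:
  fixes f :: "'a::euclidean_space \<Rightarrow> real"
  assumes D: "open D" "connected D"
    and C2: "\<And>x. x \<in> D \<Longrightarrow> (f has_derivative (\<lambda>h. G x \<bullet> h)) (at x)"
      "\<And>x. x \<in> D \<Longrightarrow> (G has_derivative H x) (at x)"
      "\<And>x. x \<in> D \<Longrightarrow> (\<Sum>b\<in>Basis. H x b \<bullet> b) \<le> 0"
    and nonneg: "\<And>x. x \<in> D \<Longrightarrow> f x \<ge> 0"
    and x0: "x0 \<in> D" "f x0 = 0" and x: "x \<in> D"
  shows "f x = 0"
proof -
  define Z where "Z = {x \<in> D. f x = 0}"
  have cf: "continuous_on D f"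
    using C2(1) by (meson continuous_at_imp_continuous_on has_derivative_continuous)
  have cl: "closedin (top_of_set D) Z"
    using continuous_closedin_preimage_constant[OF cf, of 0] by (simp add: Z_def)
  have "\<exists>e>0. ball y0 e \<subseteq> Z" if "y0 \<in> Z" for y0
  proof -
    have y0: "y0 \<in> D" "f y0 = 0" using that by (auto simp: Z_def)
    then obtain e where e: "e > 0" "cball y0 e \<subseteq> D" using D(1) open_contains_cball by blast
    have "f x1 = 0" if x1: "x1 \<in> ball y0 (e / 2)" for x1
    proof (rule ccontr)
      assume ne: "f x1 \<noteq> 0"
      define C where "C = {x \<in> cball y0 e. f x = 0}"
      have "closed C" unfolding C_def
        by (intro continuous_closed_preimage_constant continuous_on_subset[OF cf] e closed_cball)
      moreover have "y0 \<in> C" using y0 e by (simp add: C_def)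
      then have "C \<noteq> {}" by blast
      ultimately obtain y where y: "y \<in> C" "\<And>z. z \<in> C \<Longrightarrow> dist x1 y \<le> dist x1 z"
        using distance_attains_inf by metis
      define R where "R = dist x1 y"
      have "R \<le> dist x1 y0" unfolding R_def using y(2)[of y0] y0 e by (auto simp: C_def)
      then have Rs: "R < e / 2" using x1 by (simp add: dist_commute)
      have R: "R > 0" unfolding R_def using ne y(1) by (auto simp: C_def)
      have sub: "cball x1 R \<subseteq> ball y0 e"
      proof
        fix z assume "z \<in> cball x1 R"
        then show "z \<in> ball y0 e" using dist_triangle[of y0 z x1] Rs x1 by auto
      qed
      have subD: "cball x1 R \<subseteq> D" using sub e(2) ball_subset_cball by blast
      have yD: "y \<in> D" using y(1) e(2) by (auto simp: C_def)
      have "G y \<bullet> (x1 - y) > 0"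
      proof (rule hopf_boundary_point[OF C2(1) _ _ R subD])
        show "f z > 0" if "z \<in> ball x1 R" for z
        proof -
          have "z \<in> ball y0 e" using that subsetD[OF sub, of z] by simp
          then have "f z \<noteq> 0" using y(2)[of z] that by (auto simp: C_def R_def)
          moreover have "f z \<ge> 0" using that subsetD[OF subD, of z] nonneg[of z] by simp
          ultimately show ?thesis by simp
        qed
      next
        have "ball x1 R \<subseteq> D" using subD ball_subset_cball by blast
        then show "(G has_derivative H z) (at z)" "(\<Sum>b\<in>Basis. H z b \<bullet> b) \<le> 0" if "z \<in> ball x1 R" for z
          using that C2(2,3) by blast+
      qed (use subD nonneg y(1) in \<open>auto simp: R_def C_def\<close>)
      moreover have "(\<lambda>h. G y \<bullet> h) = (\<lambda>h. 0)"
        by (rule differential_zero_maxmin[OF yD D(1) C2(1)[OF yD]]) (use nonneg y(1) in \<open>auto simp: C_def\<close>)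
      then have "G y \<bullet> (x1 - y) = 0" by metis
      ultimately show False by simp
    qed
    moreover have "ball y0 (e / 2) \<subseteq> D" using e by (auto simp: subset_eq)
    ultimately show ?thesis using e(1) by (intro exI[of _ "e / 2"]) (auto simp: Z_def)
  qed
  then have "open Z" unfolding open_contains_ball by blast
  then have "openin (top_of_set D) Z" using D(1) by (simp add: openin_open_eq Z_def)
  then have "Z = D" using D(2) cl x0 unfolding connected_clopen by (auto simp: Z_def)
  then show ?thesis using x by (auto simp: Z_def)
qed

section \<open>The change of variable and the semilinear reaction term\<close>

text \<open>A solution \<open>g\<close> of the Cauchy problem satisfies \<open>(A \<circ> g)' = 1\<close> for the primitive \<open>A\<close> of \<open>sqrt a\<close>, hence
  \<open>g\<close> is the inverse of \<open>A\<close>.  This settles existence and uniqueness at once.\<close>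

lemma change_var_inverse:
  fixes a :: "real \<Rightarrow> real"
  assumes ca: "continuous_on UNIV a" and a1: "\<And>s. a s \<ge> 1"
  obtains A where "\<And>t. (A has_real_derivative sqrt (a t)) (at t)" "A 0 = 0" "strict_mono A"
    "\<And>s. A (change_var a s) = s" "\<And>t. change_var a (A t) = t" "inv (change_var a) = A"
    "\<And>s. (change_var a has_real_derivative 1 / sqrt (a (change_var a s))) (at s)"
proof -
  have "\<exists>F. \<forall>x. -\<infinity> < ereal x \<longrightarrow> ereal x < \<infinity> \<longrightarrow> (F has_vector_derivative sqrt (a x)) (at x)"
    by (rule einterval_antiderivative)
      (use ca in \<open>auto simp: continuous_on_eq_continuous_at intro!: continuous_intros\<close>)
  then obtain F where F: "\<And>x. (F has_real_derivative sqrt (a x)) (at x)"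
    by (auto simp: has_real_derivative_iff_has_vector_derivative)
  define A where "A t = F t - F 0" for t
  have A: "(A has_real_derivative sqrt (a t)) (at t)" "A 0 = 0" for t
    unfolding A_def[abs_def] using DERIV_diff[OF F[of t] DERIV_const[of "F 0"]] by auto
  have s1: "sqrt (a t) \<ge> 1" for t using a1[of t] by simp
  have growth: "A t - A s \<ge> t - s" if "s \<le> t" for s t
  proof -
    have d: "((\<lambda>x. A x - x) has_real_derivative sqrt (a x) - 1) (at x)" for x
      by (intro derivative_intros A)
    have "A s - s \<le> A t - t"
      by (rule DERIV_nonneg_imp_nondecreasing[OF that]) (metis d s1 diff_ge_0_iff_ge)
    then show ?thesis by simp
  qed
  have sm: "strict_mono A"
    using growth by (intro strict_monoI) (smt (verit))
  have cA: "isCont A t" for t using A(1) by (rule DERIV_isCont)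
  have surj: "\<exists>t. A t = s" for s
  proof (cases "s \<ge> 0")
    case True
    have "\<exists>x\<ge>0. x \<le> s \<and> A x = s"
      using growth[of 0 s] A(2) True cA by (intro IVT) auto
    then show ?thesis by blast
  next
    case False
    have "\<exists>x\<ge>s. x \<le> 0 \<and> A x = s"
      using growth[of s 0] A(2) False cA by (intro IVT) auto
    then show ?thesis by blast
  qed
  define g where "g = inv A"
  have bA: "bij A" using sm surj by (auto simp: bij_def strict_mono_imp_inj_on surj_def) metis
  have Ag: "A (g s) = s" and gA: "g (A t) = t" for s t
    unfolding g_def using bA by (simp_all add: bij_is_inj bij_is_surj surj_f_inv_f)
  have cg: "isCont g s" for s
    using isCont_inverse_function[where d = 1 and g = g and f = A and x = "g s"] cA gA Ag by auto
  have dg: "(g has_real_derivative 1 / sqrt (a (g s))) (at s)" for s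
  proof -
    have "(g has_real_derivative inverse (sqrt (a (g s)))) (at s)"
      by (rule DERIV_inverse_function[where f = A and a = "s - 1" and b = "s + 1"])
        (use A Ag cg s1[of "g s"] in auto)
    then show ?thesis by (simp add: divide_inverse)
  qed
  have g0: "g 0 = 0" using gA[of 0] A(2) by simp
  have cv: "change_var a = g"
    unfolding change_var_def
  proof (rule the_equality)
    show "(\<forall>s. (g has_real_derivative 1 / sqrt (a (g s))) (at s)) \<and> g 0 = 0" using dg g0 by simp
    fix h assume h: "(\<forall>s. (h has_real_derivative 1 / sqrt (a (h s))) (at s)) \<and> h 0 = 0"
    have "((\<lambda>s. A (h s) - s) has_real_derivative 0) (at s)" for s
    proof -
      have "((\<lambda>s. A (h s) - s) has_real_derivative sqrt (a (h s)) * (1 / sqrt (a (h s))) - 1) (at s)"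
        using h by (intro derivative_intros DERIV_chain2[OF A(1)]) auto
      then show ?thesis using s1[of "h s"] by simp
    qed
    then have "A (h s) - s = A (h 0) - 0" for s by (rule DERIV_isconst_all[rule_format]) 
    then have "A (h s) = s" for s using h A(2) by simp
    then show "h = g" using gA by (metis ext)
  qed
  have "inv (change_var a) = A"
    unfolding cv g_def using bA by (simp add: inv_inv_eq)
  then show ?thesis using that[of A] A sm Ag gA dg unfolding cv by blast
qed

lemma powr_neg_half: "x > 0 \<Longrightarrow> x powr (- 1 / 2) = 1 / sqrt x"
  using powr_minus[of x "1 / 2"] powr_half_sqrt[of x] by (simp add: inverse_eq_divide)

text \<open>The quotient of the derivative of \<open>t powr p / sqrt (a t)\<close> by \<open>sqrt (a t)\<close>, for \<open>a t = 1 + t powr k\<close>.  In the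
  new variable this is the derivative of the reaction term.  It is written as a product of two
  increasing factors.\<close>

definition slope :: "real \<Rightarrow> real \<Rightarrow> real \<Rightarrow> real" where
  "slope k p t = t powr (p - 1 - k) * (t powr k * (p + (p - k / 2) * t powr k) / (1 + t powr k)\<^sup>2)"

text \<open>The first factor increases because \<open>p > k + 1\<close>.  For the second one put \<open>\<tau> = t powr k\<close> and
  \<open>q = p - k / 2\<close>: the numerator of the difference of \<open>\<tau> (p + q \<tau>) / (1 + \<tau>)\<^sup>2\<close> at \<open>\<tau>\<close> and \<open>\<sigma>\<close> factors
  as \<open>\<tau> - \<sigma>\<close> times a positive factor, because \<open>2 q - p = p - k\<close> is positive.\<close>

lemma slope_strict_mono:
  assumes k: "k > 1" "p > k + 1" and st: "0 < s" "s < t"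
  shows "slope k p s < slope k p t"
proof -
  define q where "q = p - k / 2"
  define \<sigma> \<tau> where "\<sigma> = s powr k" and "\<tau> = t powr k"
  have q: "q > 0" using k by (simp add: q_def)
  have pos: "0 < \<sigma>" "\<sigma> < \<tau>" using st k by (auto simp: \<sigma>_def \<tau>_def intro: powr_less_mono2)
  have "\<tau> * (p + q * \<tau>) * (1 + \<sigma>)\<^sup>2 - \<sigma> * (p + q * \<sigma>) * (1 + \<tau>)\<^sup>2 =
     (\<tau> - \<sigma>) * (p + (2 * q - p) * (\<sigma> * \<tau>) + q * (\<sigma> + \<tau>))"
    by (simp add: power2_eq_square algebra_simps)
  also have "\<dots> > 0"
  proof (rule mult_pos_pos)
    have "2 * q - p > 0" using k by (simp add: q_def)
    then show "0 < p + (2 * q - p) * (\<sigma> * \<tau>) + q * (\<sigma> + \<tau>)"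
      using pos q k by (intro add_pos_pos mult_pos_pos) auto
  qed (use pos in simp)
  finally have lt: "\<sigma> * (p + q * \<sigma>) / (1 + \<sigma>)\<^sup>2 < \<tau> * (p + q * \<tau>) / (1 + \<tau>)\<^sup>2"
    using pos by (simp add: frac_less_eq divide_less_eq less_divide_eq field_simps)
  have "s powr (p - 1 - k) < t powr (p - 1 - k)" using st k by (intro powr_less_mono2) auto
  moreover have "0 < \<sigma> * (p + q * \<sigma>) / (1 + \<sigma>)\<^sup>2"
    using pos q k by (intro divide_pos_pos mult_pos_pos add_pos_pos) auto
  ultimately show ?thesis
    using lt unfolding slope_def q_def[symmetric] \<sigma>_def[symmetric] \<tau>_def[symmetric]
    by (intro mult_strict_mono') auto
qed

lemma slope_pos: "k > 1 \<Longrightarrow> p > k + 1 \<Longrightarrow> t > 0 \<Longrightarrow> slope k p t > 0"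
  unfolding slope_def using add_pos_nonneg[of 1 "t powr k"]
  by (intro divide_pos_pos mult_pos_pos add_pos_pos) auto

lemma slope_continuous:
  assumes "k > 1" "p > k + 1" shows "continuous_on {0<..} (slope k p)"
proof -
  have "(1 + t powr k)\<^sup>2 \<noteq> 0" for t :: real
    by (metis add_pos_nonneg less_irrefl powr_ge_zero zero_eq_power2 zero_less_one)
  then show ?thesis unfolding slope_def[abs_def] by (intro continuous_intros) auto
qed

lemma one_plus_powr_has_deriv:
  assumes "t > 0" shows "((\<lambda>s. 1 + \<bar>s\<bar> powr k) has_real_derivative k * t powr (k - 1)) (at t)"
proof -
  have "((\<lambda>s. 1 + s powr k) has_real_derivative k * t powr (k - 1)) (at t)"
    using assms by (auto intro!: derivative_eq_intros)
  then show ?thesis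
    by (rule has_field_derivative_transform_within_open[where S = "{0<..}"]) (use assms in auto)
qed

definition reaction :: "(real \<Rightarrow> real) \<Rightarrow> real \<Rightarrow> real \<Rightarrow> real" where
  "reaction a p s = change_var a s powr p * a (change_var a s) powr (- 1 / 2)"

definition reaction_deriv :: "(real \<Rightarrow> real) \<Rightarrow> real \<Rightarrow> real \<Rightarrow> real \<Rightarrow> real" where
  "reaction_deriv a k p s = slope k p (change_var a s)"

lemma
  fixes k p :: real and a :: "real \<Rightarrow> real" and \<psi> and x :: "'a::euclidean_space"
  assumes k: "k > 1" "p > k + 1" and a: "a = (\<lambda>s. 1 + \<bar>s\<bar> powr k)"
  shows inverse_change_var_deriv: "(inv (change_var a) has_real_derivative sqrt (a t)) (at t)"
    and inverse_change_var_0: "inv (change_var a) 0 = 0"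
    and inverse_change_var_strict_mono: "strict_mono (inv (change_var a))"
    and reaction_inverse_change_var: "t > 0 \<Longrightarrow> reaction a p (inv (change_var a) t) = t powr p / sqrt (a t)"
    and reaction_has_deriv: "s > 0 \<Longrightarrow> (reaction a p has_real_derivative reaction_deriv a k p s) (at s)"
    and reaction_deriv_strict_mono: "0 < s \<Longrightarrow> s < t \<Longrightarrow> reaction_deriv a k p s < reaction_deriv a k p t"
    and reaction_deriv_pos: "0 < s \<Longrightarrow> 0 < reaction_deriv a k p s"
    and reaction_pos: "0 < s \<Longrightarrow> 0 < reaction a p s"
    and reaction_deriv_continuous: "continuous_on {0<..} (reaction_deriv a k p)"
    and deriv_semilin_nonlin: "s > 0 \<Longrightarrow> deriv (semilin_nonlin a \<psi> p x) s = \<psi> (norm x) * reaction_deriv a k p s"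
proof -
  have ca: "continuous_on UNIV a"
    unfolding a using k by (intro continuous_intros continuous_on_powr') auto
  have a1: "a s \<ge> 1" for s unfolding a by simp
  obtain A where A: "\<And>t. (A has_real_derivative sqrt (a t)) (at t)" "A 0 = 0" "strict_mono A"
    "\<And>s. A (change_var a s) = s" "\<And>t. change_var a (A t) = t" "inv (change_var a) = A"
    and dg: "\<And>s. (change_var a has_real_derivative 1 / sqrt (a (change_var a s))) (at s)"
    using change_var_inverse[OF ca a1] by metis
  define g where "g = change_var a"
  define F where "F = reaction a p"
  define F' where "F' = reaction_deriv a k p"
  note F_eq = F_def and F'_eq = F'_def
  have F_def: "F s = g s powr p * a (g s) powr (- 1 / 2)" for s
    by (simp add: F_def g_def reaction_def)
  have F'_def: "F' s = slope k p (g s)" for s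
    by (simp add: F'_def g_def reaction_deriv_def)
  have g_mono: "g s < g t" if "s < t" for s t
    using that A(3,4) unfolding g_def by (metis strict_mono_less)
  have g0: "g 0 = 0" using A(2,5) unfolding g_def by metis
  have gpos: "g s > 0" if "s > 0" for s using g_mono[OF that] g0 by simp
  have apos: "a (g s) > 0" for s using a1[of "g s"] by linarith
  have dF: "(F has_real_derivative F' s) (at s)" if "s > 0" for s
  proof -
    define t where "t = g s"
    have t: "t > 0" using gpos[OF that] by (simp add: t_def)
    have da: "(a has_real_derivative k * t powr (k - 1)) (at t)"
      unfolding a by (rule one_plus_powr_has_deriv[OF t])
    have at: "a t = 1 + t powr k" "a t > 0" using t by (auto simp: a add_pos_nonneg)
    have "((\<lambda>t. t powr p * a t powr (- 1 / 2)) has_real_derivative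
       t powr p * ((- 1 / 2) * a t powr (- 1 / 2 - 1) * (k * t powr (k - 1))) + p * t powr (p - 1) * a t powr (- 1 / 2)) (at t)"
      using t at by (auto intro!: derivative_eq_intros da)
    moreover have "(g has_real_derivative 1 / sqrt (a t)) (at s)" using dg by (simp add: g_def t_def)
    ultimately have "(F has_real_derivative
       (t powr p * ((- 1 / 2) * a t powr (- 1 / 2 - 1) * (k * t powr (k - 1))) + p * t powr (p - 1) * a t powr (- 1 / 2)) * (1 / sqrt (a t))) (at s)"
      unfolding F_def[abs_def] t_def by (rule DERIV_chain2)
    moreover have "(t powr p * ((- 1 / 2) * a t powr (- 1 / 2 - 1) * (k * t powr (k - 1))) + p * t powr (p - 1) * a t powr (- 1 / 2)) * (1 / sqrt (a t))
       = F' s"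
    proof -
      define \<tau> where "\<tau> = t powr k"
      have tau: "\<tau> > 0" "a t = 1 + \<tau>" using t at by (auto simp: \<tau>_def)
      have e1: "t powr p = t powr (p - 1 - k) * \<tau> * t" "t powr (p - 1) = t powr (p - 1 - k) * \<tau>"
        "t powr (k - 1) * t = \<tau>"
        unfolding \<tau>_def
        using powr_add[of t "p - 1" 1] powr_add[of t "p - 1 - k" k] powr_add[of t "k - 1" 1] t by simp_all
      have h: "a t powr (- 1 / 2) = 1 / sqrt (a t)" 
        using at(2) by (rule powr_neg_half)
      have "a t powr (- 1 / 2 - 1) = a t powr (- 1 / 2) / a t"
        using at(2) by (subst powr_diff) simp
      then have h2: "a t powr (- 1 / 2 - 1) = 1 / (sqrt (a t) * a t)" using h by simp
      have sq: "sqrt (a t) * sqrt (a t) = a t" "sqrt (a t) > 0" using at(2) by auto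
      have "(t powr p * ((- 1 / 2) * a t powr (- 1 / 2 - 1) * (k * t powr (k - 1))) + p * t powr (p - 1) * a t powr (- 1 / 2)) * (1 / sqrt (a t))
        = t powr (p - 1 - k) * \<tau> * (- (k / 2) * (t powr (k - 1) * t) / (a t) + p) / (sqrt (a t) * sqrt (a t))"
        unfolding h h2 e1(1,2) using sq(2) at(2) by (simp add: field_simps)
      also have "\<dots> = t powr (p - 1 - k) * \<tau> * (- (k / 2) * \<tau> / (1 + \<tau>) + p) / (1 + \<tau>)"
        using sq(1) e1(3) tau(2) by simp
      also have "\<dots> = t powr (p - 1 - k) * (\<tau> * (p + (p - k / 2) * \<tau>) / (1 + \<tau>)\<^sup>2)"
        using tau(1) by (simp add: field_simps power2_eq_square)
      finally show ?thesis unfolding F'_def slope_def t_def[symmetric] \<tau>_def[symmetric] .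
    qed
    ultimately show ?thesis by simp
  qed
  have FA: "F (A t) = t powr p / sqrt (a t)" if "t > 0" for t
  proof -
    have "a t powr (- 1 / 2) = 1 / sqrt (a t)"
      using a1[of t] by (intro powr_neg_half) linarith
    then show ?thesis unfolding F_def g_def A(5) by simp
  qed
  have mono: "F' s < F' t" if "0 < s" "s < t" for s t
    unfolding F'_def using that g_mono gpos by (intro slope_strict_mono k) auto
  have pos: "0 < F' s" if "0 < s" for s
    unfolding F'_def using gpos[OF that] slope_pos k by simp
  have Fpos: "0 < F s" if "0 < s" for s unfolding F_def using gpos[OF that] apos[of s] by simp
  have cont: "continuous_on {0<..} F'"
    unfolding F'_def[abs_def]
  proof (rule continuous_on_compose2[OF slope_continuous[OF k]])
    show "continuous_on {0<..} g"
      using dg unfolding g_def by (intro continuous_at_imp_continuous_on ballI DERIV_isCont) blast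
  qed (use gpos in auto)
  have der: "deriv (semilin_nonlin a \<psi> p x) s = \<psi> (norm x) * F' s" if "s > 0" for s
  proof -
    have "((\<lambda>s. \<psi> (norm x) * F s) has_real_derivative \<psi> (norm x) * F' s) (at s)"
      using dF[OF that] by (rule DERIV_cmult)
    then have "(semilin_nonlin a \<psi> p x has_real_derivative \<psi> (norm x) * F' s) (at s)"
      by (rule has_field_derivative_transform_within_open[where S = "{0<..}"])
        (use that gpos in \<open>auto simp: semilin_nonlin_def nonlin_def F_def g_def less_imp_le\<close>)
    then show ?thesis by (rule DERIV_imp_deriv)
  qed
  show "(inv (change_var a) has_real_derivative sqrt (a t)) (at t)" "inv (change_var a) 0 = 0" "strict_mono (inv (change_var a))"
    unfolding A(6) by (rule A)+
  show "t > 0 \<Longrightarrow> reaction a p (inv (change_var a) t) = t powr p / sqrt (a t)"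
    using FA unfolding A(6) F_eq .
  show "s > 0 \<Longrightarrow> (reaction a p has_real_derivative reaction_deriv a k p s) (at s)"
    "0 < s \<Longrightarrow> s < t \<Longrightarrow> reaction_deriv a k p s < reaction_deriv a k p t"
    "0 < s \<Longrightarrow> 0 < reaction_deriv a k p s" "0 < s \<Longrightarrow> 0 < reaction a p s"
    "continuous_on {0<..} (reaction_deriv a k p)"
    "s > 0 \<Longrightarrow> deriv (semilin_nonlin a \<psi> p x) s = \<psi> (norm x) * reaction_deriv a k p s"
    using dF mono pos Fpos cont der unfolding F_eq F'_eq by blast+
qed

section \<open>Truncations\<close>

text \<open>At \<open>t = \<epsilon>\<close> the difference quotients from the left vanish and those from the right tend to \<open>g' \<epsilon> = 0\<close>.\<close>

lemma has_real_derivative_glue: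
  fixes g :: "real \<Rightarrow> real"
  assumes g: "g \<epsilon> = 0" "g' \<epsilon> = 0" "\<And>t. t \<ge> \<epsilon> \<Longrightarrow> (g has_real_derivative g' t) (at t)"
  shows "((\<lambda>t. if t \<le> \<epsilon> then 0 else g t) has_real_derivative (if t \<le> \<epsilon> then 0 else g' t)) (at t)"
proof -
  let ?f = "\<lambda>t. if t \<le> \<epsilon> then 0 else g t"
  consider "t < \<epsilon>" | "t > \<epsilon>" | "t = \<epsilon>" by linarith
  then show ?thesis
  proof cases
    case 1
    have "((\<lambda>t::real. 0::real) has_real_derivative 0) (at t)" by simp
    then have "(?f has_real_derivative 0) (at t)"
      by (rule has_field_derivative_transform_within_open[where S = "{..<\<epsilon>}"]) (use 1 in auto)
    then show ?thesis using 1 by simp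
  next
    case 2
    have "(?f has_real_derivative g' t) (at t)"
      using g(3)[OF less_imp_le[OF 2]]
      by (rule has_field_derivative_transform_within_open[where S = "{\<epsilon><..}"]) (use 2 in auto)
    then show ?thesis using 2 by simp
  next
    case 3
    have "((\<lambda>y. (g y - g \<epsilon>) / (y - \<epsilon>)) \<longlongrightarrow> 0) (at \<epsilon>)"
      using g(3)[of \<epsilon>] g(2) by (simp add: has_field_derivative_iff)
    then have "((\<lambda>y. (g y - g \<epsilon>) / (y - \<epsilon>)) \<longlongrightarrow> 0) (at_right \<epsilon>)"
      by (rule filterlim_mono) (auto simp: at_le)
    moreover have "\<forall>\<^sub>F y in at_right \<epsilon>. (g y - g \<epsilon>) / (y - \<epsilon>) = (?f y - ?f \<epsilon>) / (y - \<epsilon>)"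
      using g(1) by (auto simp: eventually_at_filter)
    ultimately have r: "((\<lambda>y. (?f y - ?f \<epsilon>) / (y - \<epsilon>)) \<longlongrightarrow> 0) (at_right \<epsilon>)"
      by (rule Lim_transform_eventually)
    have "\<forall>\<^sub>F y in at_left \<epsilon>. 0 = (?f y - ?f \<epsilon>) / (y - \<epsilon>)"
      by (auto simp: eventually_at_filter)
    then have "((\<lambda>y. (?f y - ?f \<epsilon>) / (y - \<epsilon>)) \<longlongrightarrow> 0) (at_left \<epsilon>)"
      by (rule Lim_transform_eventually[rotated]) simp
    from filterlim_split_at[OF this r] show ?thesis using 3 by (simp add: has_field_derivative_iff)
  qed
qed

text \<open>The family \<open>trunc\<close>, of class \<open>C1\<close> and vanishing below \<open>\<epsilon>\<close>, replaces the positive part.  The derivative of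
  \<open>trunc_energy\<close> is the square of \<open>trunc_deriv\<close>, hence
  \<open>|D (trunc \<epsilon> \<circ> w)|\<^sup>2 = Dw \<bullet> D (trunc_energy \<epsilon> \<circ> w)\<close>, and the equation of \<open>w\<close> evaluates the energy of
  the truncation after one integration by parts.  As \<open>\<epsilon>\<close> tends to 0 both functions tend to the
  positive part.\<close>

definition trunc :: "real \<Rightarrow> real \<Rightarrow> real" where
  "trunc \<epsilon> t = (if t \<le> \<epsilon> then 0 else (t - \<epsilon>)\<^sup>2 / t)"

definition trunc_deriv :: "real \<Rightarrow> real \<Rightarrow> real" where
  "trunc_deriv \<epsilon> t = (if t \<le> \<epsilon> then 0 else 1 - \<epsilon>\<^sup>2 / t\<^sup>2)"

definition trunc_energy :: "real \<Rightarrow> real \<Rightarrow> real" where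
  "trunc_energy \<epsilon> t = (if t \<le> \<epsilon> then 0 else t - 8 / 3 * \<epsilon> + 2 * \<epsilon>\<^sup>2 / t - \<epsilon> ^ 4 / (3 * t ^ 3))"

lemma trunc_has_deriv:
  assumes "\<epsilon> > 0" shows "(trunc \<epsilon> has_real_derivative trunc_deriv \<epsilon> t) (at t)"
  unfolding trunc_def[abs_def] trunc_deriv_def
proof (rule has_real_derivative_glue)
  show "((\<lambda>t. (t - \<epsilon>)\<^sup>2 / t) has_real_derivative 1 - \<epsilon>\<^sup>2 / t\<^sup>2) (at t)" if "t \<ge> \<epsilon>" for t
    using that assms by (auto intro!: derivative_eq_intros simp: field_simps power2_eq_square)
qed (use assms in auto)

lemma trunc_energy_has_deriv:
  assumes "\<epsilon> > 0" shows "(trunc_energy \<epsilon> has_real_derivative (trunc_deriv \<epsilon> t)\<^sup>2) (at t)"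
proof -
  have "(trunc_energy \<epsilon> has_real_derivative (if t \<le> \<epsilon> then 0 else (1 - \<epsilon>\<^sup>2 / t\<^sup>2)\<^sup>2)) (at t)"
    unfolding trunc_energy_def[abs_def]
  proof (rule has_real_derivative_glue)
    show "((\<lambda>t. t - 8 / 3 * \<epsilon> + 2 * \<epsilon>\<^sup>2 / t - \<epsilon> ^ 4 / (3 * t ^ 3)) has_real_derivative (1 - \<epsilon>\<^sup>2 / t\<^sup>2)\<^sup>2) (at t)"
      if "t \<ge> \<epsilon>" for t
      using that assms by (auto intro!: derivative_eq_intros simp: field_simps power2_eq_square power3_eq_cube power4_eq_xxxx)
    show "\<epsilon> - 8 / 3 * \<epsilon> + 2 * \<epsilon>\<^sup>2 / \<epsilon> - \<epsilon> ^ 4 / (3 * \<epsilon> ^ 3) = 0"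
      using assms by (simp add: field_simps power2_eq_square power3_eq_cube power4_eq_xxxx)
  qed (use assms in auto)
  then show ?thesis by (auto simp: trunc_deriv_def)
qed

lemma trunc_deriv_continuous:
  assumes "\<epsilon> > 0" shows "continuous_on UNIV (trunc_deriv \<epsilon>)"
proof -
  have "trunc_deriv \<epsilon> = (\<lambda>t. 1 - \<epsilon>\<^sup>2 / (max t \<epsilon>)\<^sup>2)"
    using assms by (auto simp: trunc_deriv_def max_def)
  moreover have "continuous_on UNIV (\<lambda>t. 1 - \<epsilon>\<^sup>2 / (max t \<epsilon>)\<^sup>2)"
    using assms by (intro continuous_intros) (auto simp: max_def)
  ultimately show ?thesis by simp
qed

lemma trunc_bounds:
  assumes "0 < \<epsilon>" "\<epsilon> \<le> 1" "t \<le> m" "0 \<le> m"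
  shows "(trunc \<epsilon> t)\<^sup>2 \<le> m\<^sup>2" "\<bar>trunc_energy \<epsilon> t\<bar> \<le> m + 6"
proof -
  have "0 \<le> trunc \<epsilon> t \<and> trunc \<epsilon> t \<le> m"
  proof (cases "t \<le> \<epsilon>")
    case False
    then have "(t - \<epsilon>)\<^sup>2 \<le> t\<^sup>2" using assms by (intro power_mono) auto
    then have "(t - \<epsilon>)\<^sup>2 / t \<le> t" using False assms by (simp add: divide_le_eq power2_eq_square)
    then show ?thesis using False assms by (simp add: trunc_def)
  qed (use assms in \<open>simp add: trunc_def\<close>)
  then show "(trunc \<epsilon> t)\<^sup>2 \<le> m\<^sup>2" by (intro power_mono) auto
  show "\<bar>trunc_energy \<epsilon> t\<bar> \<le> m + 6"
  proof (cases "t \<le> \<epsilon>")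
    case False
    then have t: "t > 0" "\<epsilon> \<le> t" using assms by auto
    have "\<epsilon>\<^sup>2 \<le> \<epsilon> * t" using t assms by (simp add: power2_eq_square)
    then have 1: "2 * \<epsilon>\<^sup>2 / t \<le> 2 * \<epsilon>" using t by (simp add: divide_le_eq)
    have "\<epsilon> ^ 3 \<le> t ^ 3" using t assms by (intro power_mono) auto
    then have "\<epsilon> * \<epsilon> ^ 3 \<le> \<epsilon> * t ^ 3" using assms by (intro mult_left_mono) auto
    then have 2: "\<epsilon> ^ 4 / (3 * t ^ 3) \<le> \<epsilon> / 3" using t by (simp add: divide_le_eq power4_eq_xxxx power3_eq_cube)
    define X Y where "X = 2 * \<epsilon>\<^sup>2 / t" and "Y = \<epsilon> ^ 4 / (3 * t ^ 3)"
    have XY: "0 \<le> X" "X \<le> 2 * \<epsilon>" "0 \<le> Y" "Y \<le> \<epsilon> / 3"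
      unfolding X_def Y_def using 1 2 t assms by auto
    have "trunc_energy \<epsilon> t = t - 8 / 3 * \<epsilon> + X - Y"
      using False by (simp add: trunc_energy_def X_def Y_def)
    then show ?thesis using XY t assms unfolding abs_le_iff by linarith
  qed (use assms in \<open>simp add: trunc_energy_def\<close>)
qed

lemma trunc_tendsto:
  "(\<lambda>n. trunc (inverse (real (Suc n))) t) \<longlonglongrightarrow> max 0 t"
  "(\<lambda>n. trunc_energy (inverse (real (Suc n))) t) \<longlonglongrightarrow> max 0 t"
proof -
  let ?e = "\<lambda>n. inverse (real (Suc n))"
  have e: "?e \<longlonglongrightarrow> 0" by (rule LIMSEQ_inverse_real_of_nat)
  have "(\<lambda>n. trunc (?e n) t) \<longlonglongrightarrow> max 0 t \<and> (\<lambda>n. trunc_energy (?e n) t) \<longlonglongrightarrow> max 0 t"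
  proof (cases "t \<le> 0")
    case True
    then have "t \<le> ?e n" for n by (meson inverse_nonnegative_iff_nonnegative of_nat_0_le_iff order_trans)
    then show ?thesis using True by (simp add: trunc_def trunc_energy_def)
  next
    case False
    have ev: "\<forall>\<^sub>F n in sequentially. ?e n < t" using e False by (intro order_tendstoD(2)) auto
    have "(\<lambda>n. (t - ?e n)\<^sup>2 / t) \<longlonglongrightarrow> (t - 0)\<^sup>2 / t" using False by (intro tendsto_intros e) auto
    moreover have "\<forall>\<^sub>F n in sequentially. (t - ?e n)\<^sup>2 / t = trunc (?e n) t"
      using ev by eventually_elim (simp add: trunc_def)
    ultimately have 1: "(\<lambda>n. trunc (?e n) t) \<longlonglongrightarrow> (t - 0)\<^sup>2 / t" by (rule Lim_transform_eventually)
    have "(\<lambda>n. t - 8 / 3 * ?e n + 2 * (?e n)\<^sup>2 / t - (?e n) ^ 4 / (3 * t ^ 3)) \<longlonglongrightarrow> t - 8 / 3 * 0 + 2 * 0\<^sup>2 / t - 0 ^ 4 / (3 * t ^ 3)"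
      using False by (intro tendsto_intros e) auto
    moreover have "\<forall>\<^sub>F n in sequentially. t - 8 / 3 * ?e n + 2 * (?e n)\<^sup>2 / t - (?e n) ^ 4 / (3 * t ^ 3) = trunc_energy (?e n) t"
      using ev by eventually_elim (simp add: trunc_energy_def)
    ultimately have 2: "(\<lambda>n. trunc_energy (?e n) t) \<longlonglongrightarrow> t - 8 / 3 * 0 + 2 * 0\<^sup>2 / t - 0 ^ 4 / (3 * t ^ 3)"
      by (rule Lim_transform_eventually)
    show ?thesis using 1 2 False by (simp add: power2_eq_square max_def)
  qed
  then show "(\<lambda>n. trunc (?e n) t) \<longlonglongrightarrow> max 0 t" "(\<lambda>n. trunc_energy (?e n) t) \<longlonglongrightarrow> max 0 t" by auto
qed

text \<open>The open sets \<open>D\<close> and \<open>- K\<close> cover the space, and on \<open>- K\<close> the extension vanishes together with its gradient.\<close>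

lemma C1_compact_extend:
  assumes "open D" "compact K" "K \<subseteq> D"
    and f: "\<And>x. x \<in> D \<Longrightarrow> (f has_derivative (\<lambda>h. g x \<bullet> h)) (at x)" and g: "continuous_on D g"
    and zero: "\<And>x. x \<in> D \<Longrightarrow> x \<notin> K \<Longrightarrow> f x = 0"
  shows "C1_compact K (\<lambda>x. if x \<in> D then f x else 0) (\<lambda>x. if x \<in> D then g x else 0)"
proof -
  let ?f = "\<lambda>x. if x \<in> D then f x else 0" and ?g = "\<lambda>x. if x \<in> D then g x else 0"
  have oK: "open (- K)" using assms(2) by (simp add: compact_imp_closed open_Compl)
  have inD: "(?f has_derivative (\<lambda>h. g x \<bullet> h)) (at x)" if "x \<in> D" for x
    by (rule has_derivative_transform_within_open[OF f[OF that] assms(1) that]) simp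
  have outK: "(?f has_derivative (\<lambda>h. 0 \<bullet> h)) (at x)" if "x \<notin> K" for x
    by (rule has_derivative_transform_within_open[where f = "\<lambda>_. 0", OF _ oK]) (use that zero in auto)
  have g0: "?g x = 0" if "x \<notin> K" for x
    using inD[of x] outK[OF that] grad_eqI[of ?f] by (cases "x \<in> D") (metis, simp)
  have "(?f has_derivative (\<lambda>h. ?g x \<bullet> h)) (at x)" for x
    using inD[of x] outK[of x] assms(3) by (cases "x \<in> D") auto
  moreover have "continuous_on (D \<union> - K) ?g"
  proof (rule continuous_on_open_Un[OF assms(1) oK])
    show "continuous_on D ?g" by (subst continuous_on_cong[OF refl, of _ _ g]) (auto simp: g)
    show "continuous_on (- K) ?g" by (subst continuous_on_cong[OF refl, where g = "\<lambda>_. 0"]) (use g0 in auto)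
  qed
  moreover have "D \<union> - K = UNIV" using assms(3) by auto
  ultimately show ?thesis unfolding C1_compact_def using assms(2) zero by auto
qed

section \<open>Reflections\<close>

definition reflect :: "'a::euclidean_space \<Rightarrow> 'a \<Rightarrow> 'a" where
  "reflect e x = x - (2 * (x \<bullet> e) / (e \<bullet> e)) *\<^sub>R e"

lemma bounded_linear_reflect: "bounded_linear (reflect e)"
proof -
  have "linear (reflect e)"
    by (rule linearI) (simp_all add: reflect_def inner_add_left add_divide_distrib ring_distribs scaleR_add_left scaleR_diff_right)
  then show ?thesis by (simp add: linear_conv_bounded_linear)
qed

lemma reflect_inner_self: "e \<noteq> 0 \<Longrightarrow> reflect e x \<bullet> e = - (x \<bullet> e)"
  by (simp add: reflect_def inner_diff_left)

lemma reflect_reflect [simp]: "reflect e (reflect e x) = x"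
proof (cases "e = 0")
  case False
  then show ?thesis using reflect_inner_self[OF False, of x] by (simp add: reflect_def[of e "reflect e x"]) (simp add: reflect_def)
qed (simp add: reflect_def)

lemma reflect_inner_commute: "reflect e x \<bullet> y = x \<bullet> reflect e y"
  by (simp add: reflect_def inner_diff_left inner_diff_right inner_commute)

lemma reflect_inner_reflect: "reflect e x \<bullet> reflect e y = x \<bullet> y"
  by (simp add: reflect_inner_commute)

lemma norm_reflect [simp]: "norm (reflect e x) = norm x"
  by (simp add: norm_eq_sqrt_inner reflect_inner_reflect)

lemma reflect_fixed: "x \<bullet> e = 0 \<Longrightarrow> reflect e x = x"
  by (simp add: reflect_def)

lemma reflect_minus: "reflect (- e) = reflect e"
  by (rule ext) (simp add: reflect_def)

lemma reflect_scaleR: "c \<noteq> 0 \<Longrightarrow> reflect (c *\<^sub>R e) = reflect e"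
  by (rule ext) (simp add: reflect_def)

lemma reflect_diff: "norm x = norm y \<Longrightarrow> reflect (x - y) x = y"
proof (cases "x = y")
  case False
  assume n: "norm x = norm y"
  then have "x \<bullet> x = y \<bullet> y" by (simp add: norm_eq_sqrt_inner)
  then have "2 * (x \<bullet> (x - y)) = (x - y) \<bullet> (x - y)"
    by (simp add: inner_diff_left inner_diff_right inner_commute)
  then show ?thesis using False by (simp add: reflect_def)
qed (simp add: reflect_def)

text \<open>A reflection is a self-adjoint isometry, so conjugation by it preserves the trace.\<close>

lemma trace_reflect:
  fixes L :: "'a::euclidean_space \<Rightarrow> 'a"
  assumes "bounded_linear L"
  shows "(\<Sum>b\<in>Basis. reflect e (L (reflect e b)) \<bullet> b) = (\<Sum>b\<in>Basis. L b \<bullet> b)"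
proof -
  interpret L: bounded_linear L by fact
  interpret R: bounded_linear "reflect e" by (rule bounded_linear_reflect)
  have "(\<Sum>b\<in>Basis. reflect e (L (reflect e b)) \<bullet> b) = (\<Sum>b\<in>Basis. L (reflect e b) \<bullet> reflect e b)"
    by (simp add: reflect_inner_commute)
  also have "\<dots> = (\<Sum>b\<in>Basis. \<Sum>c\<in>Basis. (reflect e b \<bullet> c) * (L c \<bullet> reflect e b))"
  proof (rule sum.cong[OF refl])
    fix b :: 'a
    have "L (reflect e b) = L (\<Sum>c\<in>Basis. (reflect e b \<bullet> c) *\<^sub>R c)" by (simp add: euclidean_representation)
    also have "\<dots> = (\<Sum>c\<in>Basis. (reflect e b \<bullet> c) *\<^sub>R L c)" by (simp add: L.sum L.scaleR)
    finally show "L (reflect e b) \<bullet> reflect e b = (\<Sum>c\<in>Basis. (reflect e b \<bullet> c) * (L c \<bullet> reflect e b))"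
      by (simp add: inner_sum_left)
  qed
  also have "\<dots> = (\<Sum>c\<in>Basis. \<Sum>b\<in>Basis. (b \<bullet> reflect e c) * (reflect e (L c) \<bullet> b))"
    by (subst sum.swap) (simp add: reflect_inner_commute)
  also have "\<dots> = (\<Sum>c\<in>Basis. reflect e (L c) \<bullet> reflect e c)"
    by (subst (2) euclidean_inner) (simp add: inner_commute mult.commute)
  finally show ?thesis by (simp add: reflect_inner_reflect)
qed

section \<open>Balls and annuli\<close>

text \<open>In polar coordinates the set is the image of a product of two convex sets.  The value \<open>r = 0\<close>
  covers the half ball, which does not contain the origin.\<close>

lemma connected_half_annulus:
  fixes e :: "'a::euclidean_space"
  assumes "r \<ge> 0"
  shows "connected {x. r < norm x \<and> norm x < R \<and> x \<bullet> e > 0}"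
proof -
  let ?S = "{r<..<R} \<times> {y. e \<bullet> y > 0}"
  let ?f = "\<lambda>(\<rho>, y). (\<rho> / norm y) *\<^sub>R y"
  have ne: "norm y \<noteq> 0" if "e \<bullet> y > 0" for y using that by auto
  have "connected ?S"
    by (intro connected_Times convex_connected convex_real_interval convex_halfspace_gt)
  moreover have "continuous_on ?S ?f"
    unfolding split_beta using ne by (intro continuous_intros) auto
  ultimately have "connected (?f ` ?S)" by (rule connected_continuous_image[rotated])
  moreover have "?f ` ?S = {x. r < norm x \<and> norm x < R \<and> x \<bullet> e > 0}"
  proof (intro equalityI subsetI)
    fix x assume "x \<in> ?f ` ?S"
    then obtain \<rho> y where y: "r < \<rho>" "\<rho> < R" "e \<bullet> y > 0" "x = (\<rho> / norm y) *\<^sub>R y" by auto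
    then have "norm x = \<rho>" "x \<bullet> e > 0" using ne[OF y(3)] assms by (auto simp: inner_commute)
    then show "x \<in> {x. r < norm x \<and> norm x < R \<and> x \<bullet> e > 0}" using y by simp
  next
    fix x assume x: "x \<in> {x. r < norm x \<and> norm x < R \<and> x \<bullet> e > 0}"
    then have "x \<noteq> 0" by auto
    then have "x = ?f (norm x, x)" by simp
    moreover have "(norm x, x) \<in> ?S" using x by (auto simp: inner_commute)
    ultimately show "x \<in> ?f ` ?S" by (rule image_eqI)
  qed
  ultimately show ?thesis by simp
qed

lemma ball_or_annulus_properties:
  fixes \<Omega> :: "'a::euclidean_space set"
  assumes "is_ball \<Omega> \<or> is_annulus \<Omega>"
  shows "open \<Omega>" "bounded \<Omega>" "x \<in> \<Omega> \<Longrightarrow> norm y = norm x \<Longrightarrow> y \<in> \<Omega>" "connected {x \<in> \<Omega>. x \<bullet> e > 0}"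
proof -
  have "open \<Omega> \<and> bounded \<Omega> \<and> (\<forall>x y. x \<in> \<Omega> \<longrightarrow> norm y = norm x \<longrightarrow> y \<in> \<Omega>) \<and> connected {x \<in> \<Omega>. x \<bullet> e > 0}"
    using assms
  proof
    assume "is_ball \<Omega>"
    then obtain R where R: "\<Omega> = ball 0 R" by (auto simp: is_ball_def)
    have "{x \<in> \<Omega>. x \<bullet> e > 0} = {x. 0 < norm x \<and> norm x < R \<and> x \<bullet> e > 0}" using R by auto
    then show ?thesis using connected_half_annulus[of 0 R e] R by simp
  next
    assume "is_annulus \<Omega>"
    then obtain r R where R: "0 < r" "\<Omega> = {x. r < norm x \<and> norm x < R}" by (auto simp: is_annulus_def)
    have "open \<Omega>" unfolding R(2) by (intro open_Collect_conj open_Collect_less continuous_intros)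
    moreover have "bounded \<Omega>" by (rule bounded_subset[OF bounded_ball[of 0 R]]) (use R in auto)
    moreover have "{x \<in> \<Omega>. x \<bullet> e > 0} = {x. r < norm x \<and> norm x < R \<and> x \<bullet> e > 0}" using R by auto
    ultimately show ?thesis using connected_half_annulus[of r R e] R by simp
  qed
  then show "open \<Omega>" "bounded \<Omega>" "x \<in> \<Omega> \<Longrightarrow> norm y = norm x \<Longrightarrow> y \<in> \<Omega>" "connected {x \<in> \<Omega>. x \<bullet> e > 0}"
    by blast+
qed

section \<open>The semilinear problem\<close>

text \<open>The problem \<open>- \<Delta> v = \<psi>(|x|) F(v)\<close> that the transformed solution solves; \<open>G\<close> is the gradient of \<open>v\<close> and
  \<open>H x\<close> the derivative of \<open>G\<close> at \<open>x\<close>.  Invariance under the isometries that fix the origin makes all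
  reflections act on \<open>\<Omega>\<close>, and connectedness of the half domains is what the strong minimum principle needs.\<close>

locale semilinear_problem =
  fixes \<Omega> :: "'a::euclidean_space set" and \<psi> F F' :: "real \<Rightarrow> real"
    and v :: "'a \<Rightarrow> real" and G :: "'a \<Rightarrow> 'a" and H :: "'a \<Rightarrow> 'a \<Rightarrow> 'a"
  assumes open_domain: "open \<Omega>" and bounded_domain: "bounded \<Omega>"
    and rotation_invariant: "\<And>x y. x \<in> \<Omega> \<Longrightarrow> norm y = norm x \<Longrightarrow> y \<in> \<Omega>"
    and half_connected: "\<And>e. connected {x \<in> \<Omega>. x \<bullet> e > 0}"
    and weight: "continuous_on UNIV \<psi>" "\<And>t. \<psi> t > 0"
    and reaction: "\<And>s. s > 0 \<Longrightarrow> (F has_real_derivative F' s) (at s)"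
      "\<And>s t. 0 < s \<Longrightarrow> s < t \<Longrightarrow> F' s < F' t" "\<And>s. s > 0 \<Longrightarrow> F' s > 0" "\<And>s. s > 0 \<Longrightarrow> F s > 0"
      "continuous_on {0<..} F'"
    and gradient: "\<And>x. x \<in> \<Omega> \<Longrightarrow> (v has_derivative (\<lambda>h. G x \<bullet> h)) (at x)"
    and hessian: "\<And>x. x \<in> \<Omega> \<Longrightarrow> (G has_derivative H x) (at x)"
      "\<And>h. continuous_on \<Omega> (\<lambda>x. H x h)"
    and continuous_closure: "continuous_on (closure \<Omega>) v"
    and positive: "\<And>x. x \<in> \<Omega> \<Longrightarrow> v x > 0" and boundary: "\<And>x. x \<in> frontier \<Omega> \<Longrightarrow> v x = 0"
    and equation: "\<And>x. x \<in> \<Omega> \<Longrightarrow> - (\<Sum>b\<in>Basis. H x b \<bullet> b) = \<psi> (norm x) * F (v x)"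
begin

definition potential :: "'a \<Rightarrow> real" where
  "potential x = \<psi> (norm x) * F' (v x)"

definition half :: "'a \<Rightarrow> 'a set" where
  "half e = {x \<in> \<Omega>. x \<bullet> e > 0}"

definition gap :: "'a \<Rightarrow> 'a \<Rightarrow> real" where
  "gap e x = v x - v (reflect e x)"

definition gap_grad :: "'a \<Rightarrow> 'a \<Rightarrow> 'a" where
  "gap_grad e x = G x - reflect e (G (reflect e x))"

definition gap_hess :: "'a \<Rightarrow> 'a \<Rightarrow> 'a \<Rightarrow> 'a" where
  "gap_hess e x h = H x h - reflect e (H (reflect e x) (reflect e h))"

lemma reflect_domain [simp]: "reflect e x \<in> \<Omega> \<longleftrightarrow> x \<in> \<Omega>"
  using rotation_invariant[of x "reflect e x"] rotation_invariant[of "reflect e x" x] by auto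

lemma reflect_closure: "x \<in> closure \<Omega> \<Longrightarrow> reflect e x \<in> closure \<Omega>"
proof -
  assume x: "x \<in> closure \<Omega>"
  have "reflect e ` closure \<Omega> \<subseteq> closure (reflect e ` \<Omega>)"
    by (intro image_closure_subset linear_continuous_on bounded_linear_reflect closed_closure closure_subset)
  moreover have "reflect e ` \<Omega> \<subseteq> \<Omega>" by auto
  ultimately show ?thesis using x closure_mono by blast
qed

lemma reflect_frontier: "x \<in> frontier \<Omega> \<Longrightarrow> reflect e x \<in> frontier \<Omega>"
  using reflect_closure[of x e] open_domain by (auto simp: frontier_def interior_open)

lemma frontierI: "x \<in> closure \<Omega> \<Longrightarrow> x \<notin> \<Omega> \<Longrightarrow> x \<in> frontier \<Omega>"
  using open_domain by (auto simp: frontier_def interior_open)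

lemma open_half: "open (half e)"
proof -
  have "half e = \<Omega> \<inter> {x. e \<bullet> x > 0}" by (auto simp: half_def inner_commute)
  then show ?thesis using open_domain open_halfspace_gt[of 0 e] by (simp add: open_Int)
qed

lemma half_subset: "half e \<subseteq> \<Omega>" by (auto simp: half_def)

lemma reflect_half: "e \<noteq> 0 \<Longrightarrow> x \<in> half e \<Longrightarrow> reflect e x \<in> half (- e)"
  by (simp add: half_def reflect_inner_self)

lemma half_disjoint: "half e \<inter> half (- e) = {}" by (auto simp: half_def)

lemma gap_reflect: "gap e (reflect e x) = - gap e x" by (simp add: gap_def)

lemma gap_minus: "gap (- e) x = gap e x" by (simp add: gap_def reflect_minus)

lemma hessian_linear: "x \<in> \<Omega> \<Longrightarrow> bounded_linear (H x)"
  using hessian(1) has_derivative_bounded_linear by blast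

lemma continuous_v: "continuous_on \<Omega> v"
  using gradient by (meson continuous_at_imp_continuous_on has_derivative_continuous)

lemma continuous_reflect: "continuous_on S (reflect e)"
  by (intro linear_continuous_on bounded_linear_reflect)

lemma gap_gradient:
  assumes "x \<in> \<Omega>" shows "(gap e has_derivative (\<lambda>h. gap_grad e x \<bullet> h)) (at x)"
proof -
  have "((\<lambda>x. v (reflect e x)) has_derivative (\<lambda>h. G (reflect e x) \<bullet> reflect e h)) (at x)"
    by (rule has_derivative_compose[OF bounded_linear_imp_has_derivative[OF bounded_linear_reflect] gradient])
      (use assms in simp)
  from has_derivative_diff[OF gradient[OF assms] this]
  show ?thesis by (simp add: gap_def[abs_def] gap_grad_def inner_diff_left reflect_inner_commute)
qed

lemma gap_hessian:
  assumes "x \<in> \<Omega>" shows "(gap_grad e has_derivative gap_hess e x) (at x)"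
proof -
  have "((\<lambda>x. G (reflect e x)) has_derivative (\<lambda>h. H (reflect e x) (reflect e h))) (at x)"
    by (rule has_derivative_compose[OF bounded_linear_imp_has_derivative[OF bounded_linear_reflect] hessian(1)])
      (use assms in simp)
  from has_derivative_diff[OF hessian(1)[OF assms] bounded_linear.has_derivative[OF bounded_linear_reflect this]]
  show ?thesis by (simp add: gap_grad_def[abs_def] gap_hess_def[abs_def])
qed

text \<open>By \<open>trace_reflect\<close> the Laplacian commutes with the reflection, which also preserves \<open>norm x\<close>.\<close>

lemma gap_laplacian:
  assumes "x \<in> \<Omega>"
  shows "(\<Sum>b\<in>Basis. gap_hess e x b \<bullet> b) = - \<psi> (norm x) * (F (v x) - F (v (reflect e x)))"
proof -
  have "(\<Sum>b\<in>Basis. gap_hess e x b \<bullet> b) = (\<Sum>b\<in>Basis. H x b \<bullet> b) - (\<Sum>b\<in>Basis. H (reflect e x) b \<bullet> b)"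
    using trace_reflect[OF hessian_linear[of "reflect e x"], of e] assms
    by (simp add: gap_hess_def inner_diff_left sum_subtractf)
  then show ?thesis using equation[OF assms] equation[of "reflect e x"] assms
    by (simp add: algebra_simps)
qed

lemma continuous_gap_grad: "continuous_on \<Omega> (gap_grad e)"
  using gap_hessian by (meson continuous_at_imp_continuous_on has_derivative_continuous)

lemma continuous_gap_hess: "continuous_on \<Omega> (\<lambda>x. gap_hess e x h)"
  unfolding gap_hess_def
  by (intro continuous_intros hessian(2) continuous_on_compose2[OF continuous_reflect[of UNIV]]
      continuous_on_compose2[OF hessian(2) continuous_reflect]) auto

lemma F_mono: "0 < s \<Longrightarrow> s \<le> t \<Longrightarrow> F s \<le> F t"
  by (rule DERIV_nonneg_imp_nondecreasing) (meson reaction(1,3) less_le_trans less_imp_le)+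

lemma F_convex:
  assumes "0 < s" "s < t" shows "F t - F s < F' t * (t - s)"
proof -
  have "F s - F' t * s > F t - F' t * t"
  proof (rule DERIV_neg_imp_decreasing_open[OF assms(2)])
    show "\<exists>y. ((\<lambda>x. F x - F' t * x) has_real_derivative y) (at x) \<and> y < 0" if "s < x" "x < t" for x
      using that assms reaction(2)[of x t] by (intro exI[of _ "F' x - F' t"]) (auto intro!: derivative_eq_intros reaction(1))
    show "continuous_on {s..t} (\<lambda>x. F x - F' t * x)"
      using assms by (intro continuous_intros continuous_at_imp_continuous_on ballI DERIV_isCont[OF reaction(1)]) auto
  qed
  then show ?thesis by (simp add: algebra_simps)
qed

lemma v_bounded: obtains M where "M > 0" "\<And>x. x \<in> \<Omega> \<Longrightarrow> v x \<le> M"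
proof -
  have "compact (closure \<Omega>)" using bounded_domain by simp
  then have "bounded (v ` closure \<Omega>)"
    using continuous_closure compact_continuous_image compact_imp_bounded by blast
  then obtain B where "\<And>x. x \<in> closure \<Omega> \<Longrightarrow> norm (v x) \<le> B" unfolding bounded_iff by blast
  then have "v x \<le> max B 1" if "x \<in> \<Omega>" for x using that closure_subset by fastforce
  then show ?thesis using that[of "max B 1"] by auto
qed

lemma weight_bounded: obtains C where "C > 0" "\<And>x. x \<in> \<Omega> \<Longrightarrow> \<psi> (norm x) \<le> C"
proof -
  have "compact (closure \<Omega>)" using bounded_domain by simp
  moreover have "continuous_on (closure \<Omega>) (\<lambda>x. \<psi> (norm x))"
    by (intro continuous_on_compose2[OF weight(1)] continuous_intros) auto
  ultimately have "bounded ((\<lambda>x. \<psi> (norm x)) ` closure \<Omega>)"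
    using compact_continuous_image compact_imp_bounded by blast
  then obtain B where "\<And>x. x \<in> closure \<Omega> \<Longrightarrow> norm (\<psi> (norm x)) \<le> B" unfolding bounded_iff by blast
  then have "\<psi> (norm x) \<le> max B 1" if "x \<in> \<Omega>" for x using that closure_subset by fastforce
  then show ?thesis using that[of "max B 1"] by auto
qed

lemma continuous_potential: "continuous_on \<Omega> potential"
  unfolding potential_def
  by (intro continuous_intros continuous_on_compose2[OF weight(1)]
      continuous_on_compose2[OF reaction(5) continuous_v]) (use positive in auto)

text \<open>The gap is continuous on the closed domain and vanishes on the mirror and on \<open>frontier \<Omega>\<close>, because
  the reflection maps the frontier to itself.\<close>

lemma superlevel_compact:
  assumes "e \<noteq> 0" "\<epsilon> > 0"
  shows "compact {x \<in> half e. gap e x \<ge> \<epsilon>}"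
proof -
  define K where "K = {x \<in> closure \<Omega>. 0 \<le> x \<bullet> e \<and> \<epsilon> \<le> gap e x}"
  have "continuous_on (closure \<Omega>) (gap e)" unfolding gap_def
    by (intro continuous_intros continuous_closure continuous_on_compose2[OF continuous_closure continuous_reflect])
      (auto simp: reflect_closure)
  then have "closed (closure \<Omega> \<inter> gap e -` {\<epsilon>..})" by (intro continuous_closed_preimage) auto
  moreover have "closed {x. e \<bullet> x \<ge> 0}" by (rule closed_halfspace_ge)
  moreover have "K = (closure \<Omega> \<inter> gap e -` {\<epsilon>..}) \<inter> {x. e \<bullet> x \<ge> 0}"
    by (auto simp: K_def inner_commute)
  ultimately have "closed K" by auto
  moreover have "bounded K" using bounded_domain by (rule bounded_subset[OF bounded_closure]) (auto simp: K_def)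
  ultimately have "compact K" by (simp add: compact_eq_bounded_closed)
  moreover have "K = {x \<in> half e. gap e x \<ge> \<epsilon>}"
  proof -
    have "x \<in> half e" if "x \<in> K" for x
    proof -
      have x: "x \<in> closure \<Omega>" "0 \<le> x \<bullet> e" "\<epsilon> \<le> gap e x" using that by (auto simp: K_def)
      have "x \<in> \<Omega>"
      proof (rule ccontr)
        assume "x \<notin> \<Omega>"
        then have "x \<in> frontier \<Omega>" using x(1) frontierI by blast
        then have "gap e x = 0" using boundary reflect_frontier by (simp add: gap_def)
        then show False using x(3) assms(2) by simp
      qed
      moreover have "x \<bullet> e \<noteq> 0"
      proof
        assume "x \<bullet> e = 0"
        then have "gap e x = 0" by (simp add: gap_def reflect_fixed)
        then show False using x(3) assms(2) by simp
      qed
      ultimately show ?thesis using x(2) by (auto simp: half_def)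
    qed
    then show ?thesis using half_subset closure_subset by (fastforce simp: K_def half_def)
  qed
  ultimately show ?thesis by simp
qed

text \<open>The field \<open>trunc_energy \<epsilon> (gap e x) *\<^sub>R gap_grad e x\<close> on the half domain has compact support, so the
  integral of its divergence vanishes.  The divergence is \<open>|E|\<^sup>2\<close> plus \<open>trunc_energy\<close> times the
  Laplacian of the gap, which the equation expresses by \<open>F\<close>.\<close>

lemma truncation_energy:
  assumes "e \<noteq> 0" "\<epsilon> > 0"
  defines "\<phi> \<equiv> \<lambda>x. if x \<in> half e then trunc \<epsilon> (gap e x) else 0"
    and "E \<equiv> \<lambda>x. if x \<in> half e then trunc_deriv \<epsilon> (gap e x) *\<^sub>R gap_grad e x else 0"
    and "K \<equiv> {x \<in> half e. gap e x \<ge> \<epsilon>}"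
    and "q \<equiv> \<lambda>x. if x \<in> half e then \<psi> (norm x) * ((F (v x) - F (v (reflect e x))) * trunc_energy \<epsilon> (gap e x)
         - F' (v x) * (trunc \<epsilon> (gap e x))\<^sup>2) else 0"
  shows "C1_compact K \<phi> E" "integrable lborel q" "quadratic_form potential \<phi> E = (\<integral>x. q x \<partial>lborel)"
proof -
  have K: "compact K" "K \<subseteq> half e" using superlevel_compact[OF assms(1,2)] by (auto simp: K_def)
  have sub: "x \<in> \<Omega>" if "x \<in> half e" for x using that half_subset by blast
  have cw: "continuous_on \<Omega> (gap e)"
    using gap_gradient by (meson continuous_at_imp_continuous_on has_derivative_continuous)
  have chain: "((\<lambda>x. f (gap e x)) has_derivative (\<lambda>h. (f' *\<^sub>R gap_grad e x) \<bullet> h)) (at x)"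
    if "x \<in> half e" "(f has_real_derivative f') (at (gap e x))" for f f' x
    using has_derivative_compose[OF gap_gradient[OF sub[OF that(1)]], of f "\<lambda>h. f' * h"] that(2)
    by (simp add: has_field_derivative_def)
  have ctr: "continuous_on UNIV (trunc \<epsilon>)" "continuous_on UNIV (trunc_energy \<epsilon>)" "continuous_on UNIV (trunc_deriv \<epsilon>)"
    using trunc_has_deriv[OF assms(2)] trunc_energy_has_deriv[OF assms(2)] trunc_deriv_continuous[OF assms(2)]
    by (auto intro!: continuous_at_imp_continuous_on DERIV_isCont)
  have cwh: "continuous_on (half e) (\<lambda>x. f (gap e x))" if "continuous_on UNIV f" for f :: "real \<Rightarrow> real"
    by (intro continuous_on_compose2[OF that] continuous_on_subset[OF cw half_subset]) auto
  have cGh: "continuous_on (half e) (gap_grad e)" by (rule continuous_on_subset[OF continuous_gap_grad half_subset])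
  have cHh: "continuous_on (half e) (\<lambda>x. gap_hess e x h)" for h by (rule continuous_on_subset[OF continuous_gap_hess half_subset])
  show C: "C1_compact K \<phi> E" unfolding \<phi>_def E_def
  proof (rule C1_compact_extend[OF open_half K])
    show "((\<lambda>x. trunc \<epsilon> (gap e x)) has_derivative (\<bullet>) (trunc_deriv \<epsilon> (gap e x) *\<^sub>R gap_grad e x)) (at x)"
      if "x \<in> half e" for x by (rule chain[OF that trunc_has_deriv[OF assms(2)]])
    show "continuous_on (half e) (\<lambda>x. trunc_deriv \<epsilon> (gap e x) *\<^sub>R gap_grad e x)"
      by (intro continuous_intros cwh ctr cGh)
  qed (auto simp: K_def trunc_def)
  (* The gradient of the component trunc_energy eps (gap e x) * (gap_grad e x \<bullet> b) of the field. *)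
  define B where "B b x = (trunc_deriv \<epsilon> (gap e x))\<^sup>2 *\<^sub>R ((gap_grad e x \<bullet> b) *\<^sub>R gap_grad e x)
     + trunc_energy \<epsilon> (gap e x) *\<^sub>R (\<Sum>c\<in>Basis. (gap_hess e x c \<bullet> b) *\<^sub>R c)" for b x
  have adj: "(\<Sum>c\<in>Basis. (gap_hess e x c \<bullet> b) *\<^sub>R c) \<bullet> h = gap_hess e x h \<bullet> b" if "x \<in> \<Omega>" for x b h
  proof -
    interpret bounded_linear "gap_hess e x" using gap_hessian[OF that] by (rule has_derivative_bounded_linear)
    have "gap_hess e x h = gap_hess e x (\<Sum>c\<in>Basis. (h \<bullet> c) *\<^sub>R c)" by (simp add: euclidean_representation)
    also have "\<dots> = (\<Sum>c\<in>Basis. (h \<bullet> c) *\<^sub>R gap_hess e x c)" by (simp add: sum scaleR)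
    finally show ?thesis by (simp add: inner_sum_left inner_commute[of h] mult.commute)
  qed
  have CB: "C1_compact K (\<lambda>x. if x \<in> half e then trunc_energy \<epsilon> (gap e x) * (gap_grad e x \<bullet> b) else 0)
    (\<lambda>x. if x \<in> half e then B b x else 0)" for b
  proof (rule C1_compact_extend[OF open_half K])
    show "((\<lambda>x. trunc_energy \<epsilon> (gap e x) * (gap_grad e x \<bullet> b)) has_derivative (\<bullet>) (B b x)) (at x)" if x: "x \<in> half e" for x
    proof -
      from has_derivative_mult[OF chain[OF x trunc_energy_has_deriv[OF assms(2)]] has_derivative_inner_left[OF gap_hessian[OF sub[OF x], of e], of b]]
      have "((\<lambda>x. trunc_energy \<epsilon> (gap e x) * (gap_grad e x \<bullet> b)) has_derivative
         (\<lambda>h. trunc_energy \<epsilon> (gap e x) * (gap_hess e x h \<bullet> b) + ((trunc_deriv \<epsilon> (gap e x))\<^sup>2 *\<^sub>R gap_grad e x) \<bullet> h * (gap_grad e x \<bullet> b))) (at x)" .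
      moreover have "(\<lambda>h. trunc_energy \<epsilon> (gap e x) * (gap_hess e x h \<bullet> b) + ((trunc_deriv \<epsilon> (gap e x))\<^sup>2 *\<^sub>R gap_grad e x) \<bullet> h * (gap_grad e x \<bullet> b)) = (\<bullet>) (B b x)"
        by (rule ext) (simp add: B_def inner_add_left adj[OF sub[OF x]])
      ultimately show ?thesis by simp
    qed
    show "continuous_on (half e) (B b)" unfolding B_def
      by (intro continuous_intros cwh ctr cGh cHh)
  qed (auto simp: K_def trunc_energy_def)
  define S where "S x = (if x \<in> half e then trunc_energy \<epsilon> (gap e x) * (\<Sum>b\<in>Basis. gap_hess e x b \<bullet> b) else 0)" for x
  have Kd: "compact K" "\<And>x. x \<notin> K \<Longrightarrow> E x = 0" "continuous_on UNIV E" "continuous_on UNIV \<phi>" "\<And>x. x \<notin> K \<Longrightarrow> \<phi> x = 0"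
    using C C1_compact_outside[OF C] C1_compact_continuous[OF C] by (auto simp: C1_compact_def)
  have KO: "K \<subseteq> \<Omega>" using K(2) half_subset by blast
  have iE: "integrable lborel (\<lambda>x. (norm (E x))\<^sup>2)"
    by (rule C1_compact_integrals(4)[OF open_domain C KO])
  have iB: "integrable lborel (\<lambda>x. (if x \<in> half e then B b x else 0) \<bullet> b)" for b
    by (rule integrable_compact_support[OF K(1)])
      (use CB[of b] C1_compact_outside[OF CB[of b]] in \<open>auto simp: C1_compact_def intro!: continuous_intros\<close>)
  have sumB: "(\<Sum>b\<in>Basis. (if x \<in> half e then B b x else 0) \<bullet> b) = (norm (E x))\<^sup>2 + S x" for x
  proof (cases "x \<in> half e")
    case True
    have "(\<Sum>b\<in>Basis. B b x \<bullet> b) = (\<Sum>b\<in>Basis. (trunc_deriv \<epsilon> (gap e x))\<^sup>2 * ((gap_grad e x \<bullet> b) * (gap_grad e x \<bullet> b)) + trunc_energy \<epsilon> (gap e x) * (gap_hess e x b \<bullet> b))"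
      by (intro sum.cong refl) (simp add: B_def inner_add_left adj[OF sub[OF True]])
    also have "\<dots> = (trunc_deriv \<epsilon> (gap e x))\<^sup>2 * (\<Sum>b\<in>Basis. (gap_grad e x \<bullet> b) * (gap_grad e x \<bullet> b)) + trunc_energy \<epsilon> (gap e x) * (\<Sum>b\<in>Basis. gap_hess e x b \<bullet> b)"
      by (simp add: sum.distrib sum_distrib_left)
    also have "(\<Sum>b\<in>Basis. (gap_grad e x \<bullet> b) * (gap_grad e x \<bullet> b)) = (norm (gap_grad e x))\<^sup>2"
      unfolding power2_norm_eq_inner by (rule euclidean_inner[symmetric])
    finally show ?thesis using True by (simp add: E_def S_def power_mult_distrib)
  qed (simp add: E_def S_def)
  have iSum: "integrable lborel (\<lambda>x. (norm (E x))\<^sup>2 + S x)"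
    unfolding sumB[symmetric] using iB by (intro Bochner_Integration.integrable_sum)
  have iS: "integrable lborel S"
    using Bochner_Integration.integrable_diff[OF iSum iE] by simp
  have "(\<integral>x. (norm (E x))\<^sup>2 + S x \<partial>lborel) = (\<Sum>b\<in>Basis. \<integral>x. (if x \<in> half e then B b x else 0) \<bullet> b \<partial>lborel)"
    unfolding sumB[symmetric] using iB by (intro Bochner_Integration.integral_sum)
  also have "\<dots> = 0" using integral_grad_eq_0[OF CB] by (intro sum.neutral) blast
  finally have energy: "(\<integral>x. (norm (E x))\<^sup>2 \<partial>lborel) = (\<integral>x. - S x \<partial>lborel)"
    using iE iS by simp
  have "continuous_on UNIV (\<lambda>x. potential x * (\<phi> x)\<^sup>2)"
    by (rule continuous_on_mult_support[OF open_domain K(1) KO continuous_potential])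
      (use Kd in \<open>auto intro!: continuous_intros\<close>)
  then have iP: "integrable lborel (\<lambda>x. potential x * (\<phi> x)\<^sup>2)"
    by (rule integrable_compact_support[OF K(1)]) (simp add: Kd)
  have q: "q x = - S x - potential x * (\<phi> x)\<^sup>2" for x
  proof (cases "x \<in> half e")
    case True
    show ?thesis unfolding q_def S_def \<phi>_def potential_def gap_laplacian[OF sub[OF True]]
      using True by (simp add: algebra_simps)
  qed (simp add: q_def S_def \<phi>_def)
  show "integrable lborel q" unfolding q[abs_def] using iS iP by simp
  show "quadratic_form potential \<phi> E = (\<integral>x. q x \<partial>lborel)"
    unfolding quadratic_form_def energy q[abs_def] using iS iP by simp
qed

text \<open>In the limit \<open>\<epsilon> \<rightarrow> 0\<close> the integrand \<open>q\<close> of \<open>truncation_energy\<close> tends boundedly to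
  \<open>\<psi> gap (F(v) - F(v \<circ> reflect e) - F'(v) gap)\<close> on the set where the gap is positive and to 0 elsewhere.  By strict
  convexity the limit is negative on that nonempty open set.\<close>

lemma negative_direction:
  assumes e: "e \<noteq> 0" and x0: "x0 \<in> half e" "gap e x0 > 0"
  shows "\<exists>K \<phi> E. C1_compact K \<phi> E \<and> K \<subseteq> half e \<and> quadratic_form potential \<phi> E < 0"
proof -
  let ?\<epsilon> = "\<lambda>n. inverse (real (Suc n))"
  define q where "q n x = (if x \<in> half e then \<psi> (norm x) * ((F (v x) - F (v (reflect e x))) * trunc_energy (?\<epsilon> n) (gap e x)
         - F' (v x) * (trunc (?\<epsilon> n) (gap e x))\<^sup>2) else 0)" for n x
  define Q where "Q x = (if x \<in> half e then \<psi> (norm x) * ((F (v x) - F (v (reflect e x))) * max 0 (gap e x)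
         - F' (v x) * (max 0 (gap e x))\<^sup>2) else 0)" for x
  note T = truncation_energy[OF e, of "?\<epsilon> n" for n, folded q_def]
  have eps: "?\<epsilon> n > 0" "?\<epsilon> n \<le> 1" for n by (auto simp: inverse_le_1_iff)
  have iq: "integrable lborel (q n)" for n using T(2)[OF eps(1)] by (simp add: q_def[abs_def])
  obtain M where M: "M > 0" "\<And>x. x \<in> \<Omega> \<Longrightarrow> v x \<le> M" using v_bounded by blast
  obtain C where C: "C > 0" "\<And>x. x \<in> \<Omega> \<Longrightarrow> \<psi> (norm x) \<le> C" using weight_bounded by blast
  (* Monotonicity of F and F' bounds them by their values at the upper bound M of v. *)
  define D where "D = C * (F M * (M + 6) + F' M * M\<^sup>2)"
  have lim: "(\<lambda>n. q n x) \<longlonglongrightarrow> Q x" for x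
  proof (cases "x \<in> half e")
    case True
    show ?thesis unfolding q_def Q_def if_P[OF True] by (intro tendsto_intros trunc_tendsto)
  qed (simp add: q_def Q_def)
  have bound: "norm (q n x) \<le> indicator \<Omega> x * D" for n x
  proof (cases "x \<in> half e")
    case True
    then have x: "x \<in> \<Omega>" using half_subset by blast
    have vx: "0 < v x" "v x \<le> M" "0 < v (reflect e x)" "v (reflect e x) \<le> M" using x positive M by auto
    have F: "0 < F (v x)" "F (v x) \<le> F M" "0 < F (v (reflect e x))" "F (v (reflect e x)) \<le> F M"
      using vx by (auto intro: F_mono reaction(4))
    have F': "0 < F' (v x)" "F' (v x) \<le> F' M"
      using vx reaction(2)[of "v x" M] reaction(3)[of "v x"] by (auto simp: le_less)
    have wM: "gap e x \<le> M" using vx by (simp add: gap_def)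
    note tb = trunc_bounds[OF eps(1)[of n] eps(2)[of n] wM less_imp_le[OF M(1)]]
    have a: "\<bar>(F (v x) - F (v (reflect e x))) * trunc_energy (?\<epsilon> n) (gap e x)\<bar> \<le> F M * (M + 6)"
      unfolding abs_mult using F tb(2) by (intro mult_mono) auto
    have b: "\<bar>F' (v x) * (trunc (?\<epsilon> n) (gap e x))\<^sup>2\<bar> \<le> F' M * M\<^sup>2"
      unfolding abs_mult using F' tb(1) by (intro mult_mono) auto
    have "\<bar>(F (v x) - F (v (reflect e x))) * trunc_energy (?\<epsilon> n) (gap e x) - F' (v x) * (trunc (?\<epsilon> n) (gap e x))\<^sup>2\<bar> \<le> F M * (M + 6) + F' M * M\<^sup>2"
      using a b by linarith
    then have "\<psi> (norm x) * \<bar>(F (v x) - F (v (reflect e x))) * trunc_energy (?\<epsilon> n) (gap e x) - F' (v x) * (trunc (?\<epsilon> n) (gap e x))\<^sup>2\<bar> \<le> D"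
      unfolding D_def using C(2)[OF x] C(1) weight(2)[of "norm x"] by (intro mult_mono) auto
    then show ?thesis using True x weight(2)[of "norm x"] by (simp add: q_def abs_mult del: of_nat_Suc)
  next
    case False
    have "0 \<le> D" unfolding D_def using C M reaction(3,4)[OF M(1)] by auto
    then show ?thesis using False by (simp add: q_def)
  qed
  have iD: "integrable lborel (\<lambda>x. indicator \<Omega> x * D)"
    using emeasure_bounded_finite[OF bounded_domain] open_domain by (intro integrable_mult_left integrable_real_indicator) auto
  have mq: "q n \<in> borel_measurable lborel" for n using iq by auto
  have mQ: "Q \<in> borel_measurable lborel" by (rule borel_measurable_LIMSEQ_real[OF lim mq])
  have conv: "(\<lambda>n. \<integral>x. q n x \<partial>lborel) \<longlonglongrightarrow> (\<integral>x. Q x \<partial>lborel)"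
    by (rule integral_dominated_convergence[OF mQ mq iD]) (use lim bound in auto)
  have iQ: "integrable lborel Q"
    by (rule integrable_dominated_convergence[where s = q, OF mQ mq iD]) (use lim bound in auto)
  have Qneg: "Q x < 0" if x: "x \<in> half e" "gap e x > 0" for x
  proof -
    have "x \<in> \<Omega>" using x half_subset by blast
    then have "F (v x) - F (v (reflect e x)) < F' (v x) * gap e x"
      unfolding gap_def using x(2) positive by (intro F_convex) (auto simp: gap_def)
    then have "(F (v x) - F (v (reflect e x))) * gap e x < F' (v x) * gap e x * gap e x" using x(2) by simp
    then have "\<psi> (norm x) * ((F (v x) - F (v (reflect e x))) * gap e x - F' (v x) * (gap e x)\<^sup>2) < 0"
      using weight(2)[of "norm x"] by (intro mult_pos_neg) (auto simp: power2_eq_square)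
    then show ?thesis using x by (simp add: Q_def max_def)
  qed
  have Qle: "Q x \<le> 0" for x
    using Qneg[of x] by (cases "x \<in> half e \<and> gap e x > 0") (auto simp: Q_def max_def)
  have "(\<integral>x. Q x \<partial>lborel) < 0"
  proof (rule ccontr)
    assume "\<not> ?thesis"
    moreover have "(\<integral>x. - Q x \<partial>lborel) \<ge> 0" using Qle by (intro integral_nonneg_AE) simp
    ultimately have "(\<integral>x. - Q x \<partial>lborel) = 0" using iQ by simp
    then have ae: "AE x in lborel. - Q x = 0"
      using iQ Qle by (subst (asm) integral_nonneg_eq_0_iff_AE) auto
    define U where "U = {x \<in> half e. gap e x > 0}"
    have "continuous_on (half e) (gap e)"
      using gap_gradient half_subset by (meson continuous_at_imp_continuous_on has_derivative_continuous subsetD)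
    then have "open (half e \<inter> gap e -` {0<..})" by (intro continuous_open_preimage open_half) auto
    moreover have "U = half e \<inter> gap e -` {0<..}" by (auto simp: U_def)
    ultimately have oU: "open U" by simp
    have "AE x in lborel. x \<notin> U" using ae by eventually_elim (use Qneg in \<open>force simp: U_def\<close>)
    then have "emeasure lborel U = 0" using oU by (subst (asm) AE_iff_measurable[OF _ refl]) auto
    moreover obtain l h where lh: "x0 \<in> box l h" "box l h \<subseteq> U"
    proof -
      have "x0 \<in> U" using x0 by (simp add: U_def)
      then show ?thesis using open_contains_cbox[OF oU] box_subset_cbox that by (metis subset_trans)
    qed
    ultimately have "emeasure lborel (box l h) = 0" using oU emeasure_mono[OF lh(2), of lborel] by simp
    moreover have "emeasure lborel (box l h) > 0"
      using lh(1) by (subst emeasure_lborel_box_eq) (force simp: mem_box inner_diff_left intro!: prod_pos)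
    ultimately show False by simp
  qed
  then have "\<forall>\<^sub>F n in sequentially. (\<integral>x. q n x \<partial>lborel) < 0" by (rule order_tendstoD(2)[OF conv])
  then obtain n where n: "(\<integral>x. q n x \<partial>lborel) < 0" by (auto dest: eventually_happens)
  then show ?thesis using T(1,3)[OF eps(1), of n] unfolding q_def[abs_def]
    by (intro exI conjI) (assumption, auto)
qed

end

section \<open>Symmetry at Morse index one\<close>

locale morse_index_one_problem = semilinear_problem +
  assumes no_two_negative_directions:
    "\<And>K \<phi> E L \<xi> E'. C1_compact K \<phi> E \<Longrightarrow> K \<subseteq> \<Omega> \<Longrightarrow> quadratic_form potential \<phi> E < 0 \<Longrightarrow>
      C1_compact L \<xi> E' \<Longrightarrow> L \<subseteq> \<Omega> \<Longrightarrow> quadratic_form potential \<xi> E' < 0 \<Longrightarrow> K \<inter> L \<noteq> {}"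
begin

definition mirror_symmetric :: "'a \<Rightarrow> bool" where
  "mirror_symmetric e \<longleftrightarrow> (\<forall>x\<in>\<Omega>. v (reflect e x) = v x)"

definition dominates :: "'a \<Rightarrow> bool" where
  "dominates e \<longleftrightarrow> (\<forall>x\<in>half e. gap e x \<ge> 0)"

lemma mirror_symmetric_if_half:
  assumes "e \<noteq> 0" "\<And>x. x \<in> half e \<Longrightarrow> gap e x = 0"
  shows "mirror_symmetric e"
  unfolding mirror_symmetric_def
proof
  fix x assume x: "x \<in> \<Omega>"
  consider "x \<bullet> e > 0" | "x \<bullet> e = 0" | "x \<bullet> e < 0" by linarith
  then show "v (reflect e x) = v x"
  proof cases
    case 1
    then show ?thesis using assms(2)[of x] x by (simp add: half_def gap_def)
  next
    case 2
    then show ?thesis by (simp add: reflect_fixed)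
  next
    case 3
    then have "reflect e x \<in> half e" using x assms(1) by (simp add: half_def reflect_inner_self)
    then show ?thesis using assms(2)[of "reflect e x"] by (simp add: gap_def)
  qed
qed

lemma mirror_symmetric_minus: "mirror_symmetric (- e) = mirror_symmetric e"
  by (simp add: mirror_symmetric_def reflect_minus)

lemma mirror_symmetric_scaleR: "c \<noteq> 0 \<Longrightarrow> mirror_symmetric (c *\<^sub>R e) = mirror_symmetric e"
  by (simp add: mirror_symmetric_def reflect_scaleR)

text \<open>Otherwise the gap has both signs in \<open>half e\<close>.  Since the gap is odd under the reflection, it is then positive
  somewhere in \<open>half e\<close> and somewhere in \<open>half (- e)\<close>, and both half domains carry a negative direction.\<close>

lemma dominates_cases:
  assumes "e \<noteq> 0" shows "dominates e \<or> dominates (- e)"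
proof (rule ccontr)
  assume "\<not> ?thesis"
  then obtain x y where x: "x \<in> half e" "gap e x < 0" and y: "y \<in> half (- e)" "gap (- e) y < 0"
    unfolding dominates_def by fastforce
  have me: "- e \<noteq> 0" using assms by simp
  have "reflect (- e) y \<in> half e" using reflect_half[OF me y(1)] by simp
  moreover have "gap e (reflect (- e) y) > 0"
    using y(2) gap_reflect[of e y] gap_minus[of e y] by (simp add: reflect_minus)
  ultimately obtain K \<phi> E where K: "C1_compact K \<phi> E" "K \<subseteq> half e" "quadratic_form potential \<phi> E < 0"
    using negative_direction[OF assms] by blast
  have "reflect e x \<in> half (- e)" by (rule reflect_half[OF assms x(1)])
  moreover have "gap (- e) (reflect e x) > 0"
    using x(2) gap_reflect[of e x] gap_minus[of e "reflect e x"] by simp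
  ultimately obtain L \<xi> E' where L: "C1_compact L \<xi> E'" "L \<subseteq> half (- e)" "quadratic_form potential \<xi> E' < 0"
    using negative_direction[OF me] by blast
  have "K \<inter> L = {}" using K(2) L(2) half_disjoint by blast
  then show False
    using no_two_negative_directions[OF K(1) _ K(3) L(1) _ L(3)] K(2) L(2) half_subset by blast
qed

text \<open>The reaction term is increasing.\<close>

lemma dominates_superharmonic:
  assumes "dominates e" "x \<in> half e"
  shows "(\<Sum>b\<in>Basis. gap_hess e x b \<bullet> b) \<le> 0"
proof -
  have x: "x \<in> \<Omega>" using assms(2) half_subset by blast
  have "v (reflect e x) \<le> v x" using assms by (auto simp: dominates_def gap_def)
  then have "F (v (reflect e x)) \<le> F (v x)" using positive x by (intro F_mono) auto
  then show ?thesis unfolding gap_laplacian[OF x] using weight(2)[of "norm x"] by (simp add: mult_left_mono)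
qed

lemma dominates_touching:
  assumes "e \<noteq> 0" "dominates e" "x0 \<in> half e" "gap e x0 = 0"
  shows "mirror_symmetric e"
proof (rule mirror_symmetric_if_half[OF assms(1)])
  fix x assume x: "x \<in> half e"
  show "gap e x = 0"
  proof (rule strong_minimum_principle[OF open_half])
    show "connected (half e)" using half_connected by (simp add: half_def)
    show "(gap e has_derivative (\<bullet>) (gap_grad e x)) (at x)" if "x \<in> half e" for x
      by (rule gap_gradient) (use that half_subset in blast)
    show "(gap_grad e has_derivative gap_hess e x) (at x)" if "x \<in> half e" for x
      by (rule gap_hessian) (use that half_subset in blast)
    show "(\<Sum>b\<in>Basis. gap_hess e x b \<bullet> b) \<le> 0" if "x \<in> half e" for x
      by (rule dominates_superharmonic[OF assms(2) that])
  qed (use assms x in \<open>auto simp: dominates_def\<close>)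
qed

text \<open>If the gap did not vanish identically it would be positive in \<open>half e\<close>, and Hopf's lemma in a ball of
  \<open>half e\<close> that touches the mirror at \<open>x\<close> would give a nonzero gradient of the gap at \<open>x\<close>.  But this gradient is
  \<open>G x - reflect e (G x) = 0\<close>.\<close>

lemma dominates_critical:
  assumes e: "e \<noteq> 0" and dom: "dominates e" and x: "x \<in> \<Omega>" "x \<bullet> e = 0" "G x = 0"
  shows "mirror_symmetric e"
proof (rule ccontr)
  assume "\<not> mirror_symmetric e"
  then have pos: "gap e y > 0" if "y \<in> half e" for y
    using dominates_touching[OF e dom that] dom that by (force simp: dominates_def)
  obtain r where r: "r > 0" "cball x r \<subseteq> \<Omega>" using open_domain x(1) open_contains_cball by blast
  define \<delta> where "\<delta> = r / (2 * norm e)"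
  define c where "c = x + \<delta> *\<^sub>R e"
  define R where "R = \<delta> * norm e"
  have R: "R > 0" "2 * R = r" "\<delta> > 0" using r e by (auto simp: R_def \<delta>_def)
  have "dist x c = R" using R(3) by (simp add: c_def R_def dist_norm)
  have sub: "cball c R \<subseteq> \<Omega>"
  proof
    fix y assume "y \<in> cball c R"
    then have "dist x y \<le> r" using \<open>dist x c = R\<close> R(2) dist_triangle[of x y c] by simp
    then show "y \<in> \<Omega>" using r(2) by auto
  qed
  have inner: "y \<bullet> e \<ge> (R - dist c y) * norm e" for y
  proof -
    have "(c - y) \<bullet> e \<le> norm (c - y) * norm e" by (rule norm_cauchy_schwarz)
    moreover have "c \<bullet> e = R * norm e" using x(2) by (simp add: c_def R_def inner_add_left power2_norm_eq_inner[symmetric] power2_eq_square)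
    ultimately show ?thesis by (simp add: inner_diff_left dist_norm algebra_simps)
  qed
  have ballh: "y \<in> half e" if "y \<in> ball c R" for y
  proof -
    have "(R - dist c y) * norm e > 0" using that e by (intro mult_pos_pos) auto
    moreover have "y \<in> \<Omega>" using that sub by auto
    ultimately show ?thesis using inner[of y] by (auto simp: half_def)
  qed
  have "gap_grad e x \<bullet> (c - x) > 0"
  proof (rule hopf_boundary_point[OF gap_gradient _ _ R(1) sub])
    show "(gap_grad e has_derivative gap_hess e y) (at y)" if "y \<in> ball c R" for y
      by (rule gap_hessian) (use ballh[OF that] half_subset in blast)
    show "(\<Sum>b\<in>Basis. gap_hess e y b \<bullet> b) \<le> 0" if "y \<in> ball c R" for y
      by (rule dominates_superharmonic[OF dom ballh[OF that]])
    show "gap e y > 0" if "y \<in> ball c R" for y by (rule pos[OF ballh[OF that]])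
    show "gap e y \<ge> 0" if "y \<in> cball c R" for y
    proof (cases "y \<bullet> e > 0")
      case True
      then show ?thesis using pos[of y] that sub by (auto simp: half_def)
    next
      case False
      have "(R - dist c y) * norm e \<ge> 0" using that by simp
      then have "y \<bullet> e = 0" using False inner[of y] by linarith
      then show ?thesis by (simp add: gap_def reflect_fixed)
    qed
    show "dist c x = R" using \<open>dist x c = R\<close> by (simp add: dist_commute)
    show "gap e x = 0" using x(2) by (simp add: gap_def reflect_fixed)
  qed
  moreover have "gap_grad e x = 0"
    using x by (simp add: gap_grad_def reflect_fixed)
  ultimately show False by simp
qed

text \<open>The gap is nonnegative at \<open>P\<close>.  If its sign on \<open>half e\<close> were nonpositive it would vanish at \<open>P\<close>, and hence
  identically.\<close>

lemma dominates_towards_max_at: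
  assumes P: "P \<in> \<Omega>" "\<And>x. x \<in> \<Omega> \<Longrightarrow> v x \<le> v P" and Pe: "P \<bullet> e > 0"
  shows "dominates e"
proof -
  have e: "e \<noteq> 0" using Pe by auto
  have Ph: "P \<in> half e" using Pe P(1) by (simp add: half_def)
  have wP: "gap e P \<ge> 0" using P by (simp add: gap_def)
  show ?thesis
  proof (cases "dominates e")
    case False
    then have dm: "dominates (- e)" using dominates_cases[OF e] by blast
    have rP: "reflect e P \<in> half (- e)" by (rule reflect_half[OF e Ph])
    have "gap (- e) (reflect e P) = - gap e P" by (simp add: gap_minus gap_reflect)
    moreover have "gap (- e) (reflect e P) \<ge> 0" using dm rP by (auto simp: dominates_def)
    ultimately have "gap (- e) (reflect e P) = 0" using wP by simp
    then have "mirror_symmetric (- e)" using dominates_touching[OF _ dm rP] e by simp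
    then have "mirror_symmetric e" by (simp add: mirror_symmetric_minus)
    then show ?thesis by (auto simp: mirror_symmetric_def dominates_def gap_def half_def)
  qed
qed

context
  fixes P
  assumes P: "P \<in> \<Omega>" "\<And>x. x \<in> \<Omega> \<Longrightarrow> v x \<le> v P"
begin

lemma gradient_max: "G P = 0"
proof -
  have "(\<lambda>h. G P \<bullet> h) = (\<lambda>h. 0)"
    by (rule differential_zero_maxmin[OF P(1) open_domain gradient[OF P(1)]]) (use P in auto)
  then have "G P \<bullet> G P = 0" by metis
  then show ?thesis by simp
qed

lemma dominates_towards_max: "P \<bullet> e > 0 \<Longrightarrow> dominates e"
  by (rule dominates_towards_max_at) (use P in auto)

lemma mirror_symmetric_orthogonal_max:
  assumes "e \<noteq> 0" "P \<bullet> e = 0" shows "mirror_symmetric e"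
proof (cases "dominates e")
  case True
  then show ?thesis by (rule dominates_critical[OF assms(1) _ P(1) assms(2) gradient_max])
next
  case False
  then have "dominates (- e)" using dominates_cases[OF assms(1)] by blast
  then have "mirror_symmetric (- e)" using assms by (intro dominates_critical[OF _ _ P(1) _ gradient_max]) auto
  then show ?thesis by (simp add: mirror_symmetric_minus)
qed

text \<open>The reflection that exchanges \<open>x\<close> and \<open>y\<close> has normal vector \<open>x - y\<close>, which is orthogonal to \<open>P\<close>.\<close>

lemma invariant_about_max:
  assumes x: "x \<in> \<Omega>" "norm y = norm x" "x \<bullet> P = y \<bullet> P"
  shows "v y = v x"
proof (cases "x = y")
  case False
  have "mirror_symmetric (x - y)" using False x(3) by (intro mirror_symmetric_orthogonal_max) (auto simp: inner_diff_right inner_commute)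
  then have "v (reflect (x - y) x) = v x" using x(1) by (simp add: mirror_symmetric_def)
  then show ?thesis using reflect_diff[of x y] x(2) by simp
qed simp

text \<open>The reflected point \<open>P'\<close> is a second maximum point.  For \<open>e\<close> in the open cone \<open>U\<close> of directions that
  separate \<open>P\<close> from \<open>P'\<close>, domination towards both points forces the gap to vanish.  Fix \<open>x\<close>, choose
  \<open>e \<in> U\<close> not orthogonal to \<open>x\<close> and put \<open>z = reflect e x\<close>.  For \<open>x'\<close> near \<open>x\<close> on the same sphere the
  direction \<open>x' - z\<close> is still a multiple of an element of \<open>U\<close>, and its reflection maps \<open>x'\<close> to \<open>z\<close>; so \<open>v\<close>
  is constant on the sphere near \<open>x\<close>.\<close>

lemma radial_if_tilted_symmetry:
  assumes dim: "DIM('a) \<ge> 2" and e0: "mirror_symmetric e0" "P \<bullet> e0 \<noteq> 0"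
    and xy: "x \<in> \<Omega>" "norm y = norm x"
  shows "v y = v x"
proof -
  define P' where "P' = reflect e0 P"
  have e0n: "e0 \<noteq> 0" using e0(2) by auto
  have P': "P' \<in> \<Omega>" "v P' = v P" using e0(1) P(1) by (auto simp: P'_def mirror_symmetric_def)
  have ne: "P' \<noteq> P" using reflect_inner_self[OF e0n, of P] e0(2) by (auto simp: P'_def)
  have nP: "norm P' = norm P" by (simp add: P'_def)
  define U where "U = {e. e \<bullet> P > 0 \<and> e \<bullet> P' < 0}"
  have symU: "mirror_symmetric e" if "e \<in> U" for e
  proof -
    have e: "e \<noteq> 0" using that by (auto simp: U_def)
    have d1: "dominates e" using that by (intro dominates_towards_max) (simp add: U_def inner_commute)
    have d2: "dominates (- e)"
      by (rule dominates_towards_max_at[of P']) (use that P P' in \<open>auto simp: U_def inner_commute\<close>)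
    show ?thesis
    proof (rule mirror_symmetric_if_half[OF e])
      fix x assume x: "x \<in> half e"
      have "gap e x \<ge> 0" using d1 x by (auto simp: dominates_def)
      moreover have "gap (- e) (reflect e x) \<ge> 0" using d2 reflect_half[OF e x] by (auto simp: dominates_def)
      ultimately show "gap e x = 0" by (simp add: gap_minus gap_reflect)
    qed
  qed
  have openU: "open U"
  proof -
    have "U = {e. P \<bullet> e > 0} \<inter> {e. P' \<bullet> e < 0}" by (auto simp: U_def inner_commute)
    then show ?thesis by (simp add: open_Int open_halfspace_gt open_halfspace_lt)
  qed
  have e1: "P - P' \<in> U"
  proof -
    have "P \<bullet> P = P' \<bullet> P'" using nP by (simp add: norm_eq_sqrt_inner)
    moreover have "(P - P') \<bullet> (P - P') > 0" using ne by simp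
    ultimately have "P \<bullet> P - P \<bullet> P' > 0" by (simp add: inner_diff_left inner_diff_right inner_commute)
    then show ?thesis using \<open>P \<bullet> P = _\<close> by (simp add: U_def inner_diff_left inner_commute[of P' P])
  qed
  have locally_constant: "\<exists>d>0. \<forall>x'. norm x' = norm x \<longrightarrow> dist x x' < d \<longrightarrow> v x' = v x" if x: "x \<in> \<Omega>" for x
  proof (cases "x = 0")
    case True
    then show ?thesis by (auto intro!: exI[of _ 1])
  next
    case False
    (* If P - P' itself is orthogonal to x, a small multiple of x is added. *)
    have "\<exists>e\<in>U. x \<bullet> e \<noteq> 0"
    proof (cases "x \<bullet> (P - P') = 0")
      case True
      obtain t where t: "t > 0" "ball (P - P') t \<subseteq> U" using openU e1 open_contains_ball by blast
      define s where "s = t / (2 * norm x)"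
      have "P - P' + s *\<^sub>R x \<in> ball (P - P') t" using t(1) False by (simp add: s_def dist_norm)
      moreover have "x \<bullet> (P - P' + s *\<^sub>R x) \<noteq> 0" using True False t(1) by (simp add: inner_add_right s_def)
      ultimately show ?thesis using t(2) by blast
    qed (use e1 in blast)
    then obtain e where e: "e \<in> U" "x \<bullet> e \<noteq> 0" by blast
    have en: "e \<noteq> 0" using e(2) by auto
    define z where "z = reflect e x"
    define s where "s = 2 * (x \<bullet> e) / (e \<bullet> e)"
    have s: "s \<noteq> 0" using e(2) en by (simp add: s_def)
    have xz: "x - z = s *\<^sub>R e" by (simp add: z_def s_def reflect_def)
    have vz: "v z = v x" using symU[OF e(1)] x by (simp add: mirror_symmetric_def z_def)
    obtain t where t: "t > 0" "ball e t \<subseteq> U" using openU e(1) open_contains_ball by blast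
    have "v x' = v x" if x': "norm x' = norm x" "dist x x' < t * \<bar>s\<bar>" for x'
    proof -
      define e' where "e' = (1 / s) *\<^sub>R (x' - z)"
      have "e - e' = (1 / s) *\<^sub>R (x - x')"
      proof -
        have "e = (1 / s) *\<^sub>R (x - z)" using s xz by simp
        then show ?thesis by (simp add: e'_def algebra_simps)
      qed
      then have "dist e e' = dist x x' / \<bar>s\<bar>" by (simp add: dist_norm)
      also have "\<dots> < t" using x'(2) s by (simp add: divide_less_eq)
      finally have "e' \<in> U" using t(2) by auto
      then have "mirror_symmetric e'" by (rule symU)
      then have "mirror_symmetric (x' - z)" using mirror_symmetric_scaleR[of "1 / s" "x' - z"] s by (simp add: e'_def)
      moreover have "x' \<in> \<Omega>" using rotation_invariant[OF x] x'(1) by simp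
      moreover have "reflect (x' - z) x' = z" by (rule reflect_diff) (simp add: x' z_def)
      ultimately have "v z = v x'" by (metis mirror_symmetric_def)
      then show ?thesis using vz by simp
    qed
    moreover have "t * \<bar>s\<bar> > 0" using t(1) s by simp
    ultimately show ?thesis by blast
  qed
  have "connected (sphere (0::'a) (norm x))" by (rule connected_sphere[OF dim])
  then show ?thesis
  proof (rule connected_equivalence_relation[where R = "\<lambda>a b. v b = v a"])
    fix a assume a: "a \<in> sphere (0::'a) (norm x)"
    then have aO: "a \<in> \<Omega>" using rotation_invariant[OF xy(1), of a] by simp
    obtain d where d: "d > 0" "\<And>x'. norm x' = norm a \<Longrightarrow> dist a x' < d \<Longrightarrow> v x' = v a" using locally_constant[OF aO] by blast
    show "\<exists>T. openin (top_of_set (sphere 0 (norm x))) T \<and> a \<in> T \<and> (\<forall>b\<in>T. v b = v a)"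
    proof (intro exI conjI ballI)
      show "openin (top_of_set (sphere 0 (norm x))) (sphere 0 (norm x) \<inter> ball a d)"
        by (rule openin_open_Int) simp
      show "a \<in> sphere 0 (norm x) \<inter> ball a d" using a d(1) by simp
      show "v b = v a" if "b \<in> sphere 0 (norm x) \<inter> ball a d" for b
        using d(2)[of b] that a by simp
    qed
  qed (use xy in auto)
qed

text \<open>The projection \<open>e\<close> of \<open>P\<close> to the complement of \<open>x\<close> satisfies \<open>e \<bullet> x = 0\<close> and \<open>e \<bullet> P = e \<bullet> e\<close>.  If \<open>e\<close> is not
  zero, its mirror contains the critical point \<open>x\<close> but not \<open>P\<close>.  If \<open>e = 0\<close>, then \<open>P\<close> is a multiple of \<open>x\<close>
  and \<open>x\<close> lies on the axis unless \<open>P = 0\<close>.\<close>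

lemma radial_if_critical_off_axis:
  assumes dim: "DIM('a) \<ge> 2" and x: "x \<in> \<Omega>" "G x = 0" "x \<notin> span {P}"
    and ab: "a \<in> \<Omega>" "norm b = norm a"
  shows "v b = v a"
proof -
  have x0: "x \<noteq> 0" using x(3) span_zero by auto
  define e where "e = P - ((P \<bullet> x) / (x \<bullet> x)) *\<^sub>R x"
  have xe: "x \<bullet> e = 0" using x0 by (simp add: e_def inner_diff_right inner_commute)
  show ?thesis
  proof (cases "P \<bullet> e = 0")
    case False
    have "P \<bullet> e = e \<bullet> e"
      using xe by (simp add: e_def inner_diff_left inner_diff_right inner_commute)
    then have pe: "P \<bullet> e > 0" and e0: "e \<noteq> 0" using False by auto
    have "mirror_symmetric e" by (rule dominates_critical[OF e0 dominates_towards_max[OF pe] x(1) xe x(2)])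
    then show ?thesis using radial_if_tilted_symmetry[OF dim _ False ab] by blast
  next
    case True
    have "e \<bullet> e = P \<bullet> e"
      using xe by (simp add: e_def inner_diff_left inner_diff_right inner_commute)
    then have "e = 0" using True by simp
    then have Pe: "P = ((P \<bullet> x) / (x \<bullet> x)) *\<^sub>R x" by (simp add: e_def)
    show ?thesis
    proof (cases "P \<bullet> x = 0")
      case True
      then have "P = 0" using Pe by simp
      then show ?thesis using ab by (intro invariant_about_max) auto
    next
      case False
      have "x = ((x \<bullet> x) / (P \<bullet> x)) *\<^sub>R P"
      proof -
        have "((x \<bullet> x) / (P \<bullet> x)) *\<^sub>R P = ((x \<bullet> x) / (P \<bullet> x)) *\<^sub>R (((P \<bullet> x) / (x \<bullet> x)) *\<^sub>R x)"
          using Pe by simp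
        also have "\<dots> = x" using False x0 by simp
        finally show ?thesis by simp
      qed
      then have "x \<in> span {P}" by (metis span_base span_scale insertI1)
      then show ?thesis using x(3) by simp
    qed
  qed
qed

end

end

section \<open>The quasi-linear problem\<close>

lemma C2_gradient_hessian:
  fixes u :: "'a::euclidean_space \<Rightarrow> real"
  assumes "open \<Omega>" "Ck_on 2 u \<Omega>"
  obtains H where "\<And>x. x \<in> \<Omega> \<Longrightarrow> (u has_derivative (\<lambda>h. grad u x \<bullet> h)) (at x)"
    "\<And>x. x \<in> \<Omega> \<Longrightarrow> (grad u has_derivative H x) (at x)" "\<And>h. continuous_on \<Omega> (\<lambda>x. H x h)"
proof -
  have C: "Ck_on (Suc (Suc 0)) u \<Omega>" using assms(2) by (simp add: numeral_2_eq_2)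
  define p where "p b x = grad u x \<bullet> b" for b x
  have Cp: "Ck_on (Suc 0) (p b) \<Omega>" for b
    using Ck_on_grad_inner[OF C assms(1), of b] by (simp add: p_def[abs_def])
  define H where "H x h = (\<Sum>b\<in>Basis. (grad (p b) x \<bullet> h) *\<^sub>R b)" for x h
  have "(grad u has_derivative H x) (at x)" if "x \<in> \<Omega>" for x
  proof (subst has_derivative_componentwise_within, rule ballI)
    fix b :: 'a assume b: "b \<in> Basis"
    have "(p b has_derivative (\<lambda>h. grad (p b) x \<bullet> h)) (at x)"
      using Cp[of b] that by (intro has_derivative_grad) simp
    then show "((\<lambda>x. grad u x \<bullet> b) has_derivative (\<lambda>h. H x h \<bullet> b)) (at x)"
      using b by (simp add: p_def[abs_def] H_def)
  qed
  moreover have "continuous_on \<Omega> (\<lambda>x. H x h)" for h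
    unfolding H_def by (intro continuous_intros continuous_on_grad[OF Cp assms(1)])
  moreover have "(u has_derivative (\<lambda>h. grad u x \<bullet> h)) (at x)" if "x \<in> \<Omega>" for x
    using C that by (intro has_derivative_grad) simp
  ultimately show ?thesis using that by blast
qed

lemma sum_inner_squares: "(\<Sum>b\<in>Basis. (g \<bullet> b) * (g \<bullet> b)) = (norm (g::'a::euclidean_space))\<^sup>2"
  unfolding power2_norm_eq_inner by (rule euclidean_inner[symmetric])

theorem theorem3p3:
  fixes \<Omega> :: "(real ^ 'n) set"
    and k p :: real
    and \<psi> a :: "real \<Rightarrow> real"
    and u :: "real ^ 'n \<Rightarrow> real"
    and P :: "real ^ 'n"
  assumes "CARD('n) \<ge> 2"
    and "is_ball \<Omega> \<or> is_annulus \<Omega>"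
    and "k > 1"
    and "a = (\<lambda>s. 1 + \<bar>s\<bar> powr k)"
    and "p > k + 1"
    and "continuous_on UNIV \<psi>"
    and "\<forall>t. \<psi> t > 0"
    and "classical_solution \<Omega> a \<psi> p u"
    and "morse_index \<Omega> a \<psi> p u = 1"
    and "P \<in> \<Omega>"
    and "\<forall>x\<in>\<Omega>. u x \<le> u P"
  shows "(P \<noteq> 0 \<longrightarrow> axially_symmetric \<Omega> u (axis_through P))
    \<and> (is_ball \<Omega> \<and> P = 0 \<longrightarrow> radially_symmetric \<Omega> u)
    \<and> (\<not> radially_symmetric \<Omega> u \<longrightarrow>
        (\<forall>e. e \<noteq> 0 \<and> \<not> axis_through P \<subseteq> {x. e \<bullet> x = 0} \<longrightarrow> \<not> hyperplane_symmetric \<Omega> u e))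
    \<and> (\<not> radially_symmetric \<Omega> u \<longrightarrow> (\<forall>x\<in>\<Omega>. grad u x = 0 \<longrightarrow> x \<in> axis_through P))"
proof -
  note dom = ball_or_annulus_properties[OF assms(2)]
  define A F F' where "A = inv (change_var a)" and "F = reaction a p" and "F' = reaction_deriv a k p"
  note R = assms(3,5,4)
  have A: "(A has_real_derivative sqrt (a t)) (at t)" "A 0 = 0" "strict_mono A" for t
    unfolding A_def using inverse_change_var_deriv[OF R] inverse_change_var_0[OF R] inverse_change_var_strict_mono[OF R] .
  have FA: "F (A t) = t powr p / sqrt (a t)" if "t > 0" for t
    unfolding A_def F_def by (rule reaction_inverse_change_var[OF R that])
  have F: "s > 0 \<Longrightarrow> (F has_real_derivative F' s) (at s)" "0 < s \<Longrightarrow> s < t \<Longrightarrow> F' s < F' t"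
    "0 < s \<Longrightarrow> 0 < F' s" "0 < s \<Longrightarrow> 0 < F s" "continuous_on {0<..} F'" for s t
    unfolding F_def F'_def
    by (rule reaction_has_deriv[OF R] reaction_deriv_strict_mono[OF R] reaction_deriv_pos[OF R] reaction_pos[OF R]
        reaction_deriv_continuous[OF R]; assumption)+
  have sol: "Ck_on 2 u \<Omega>" "continuous_on (closure \<Omega>) u"
    "\<And>x. x \<in> \<Omega> \<Longrightarrow> - divergence (\<lambda>y. a (u y) *\<^sub>R grad u y) x + deriv a (u x) / 2 * (norm (grad u x))\<^sup>2
              = \<psi> (norm x) * u x powr p"
    "\<And>x. x \<in> \<Omega> \<Longrightarrow> u x > 0" "\<And>x. x \<in> frontier \<Omega> \<Longrightarrow> u x = 0"
    using assms(8) unfolding classical_solution_def by auto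
  obtain Hu where du: "\<And>x. x \<in> \<Omega> \<Longrightarrow> (u has_derivative (\<lambda>h. grad u x \<bullet> h)) (at x)"
    and dG: "\<And>x. x \<in> \<Omega> \<Longrightarrow> (grad u has_derivative Hu x) (at x)" and cH: "\<And>h. continuous_on \<Omega> (\<lambda>x. Hu x h)"
    using C2_gradient_hessian[OF dom(1) sol(1)] by metis
  define a' where "a' t = k * t powr (k - 1)" for t
  have apos: "a t > 0" for t unfolding assms(4) by (simp add: add_pos_nonneg)
  have da: "(a has_real_derivative a' t) (at t)" if "t > 0" for t
    unfolding assms(4) a'_def by (rule one_plus_powr_has_deriv[OF that])
  define v where "v x = A (u x)" for x
  define Gv where "Gv x = sqrt (a (u x)) *\<^sub>R grad u x" for x
  define Hv where "Hv x h = (a' (u x) / (2 * sqrt (a (u x))) * (grad u x \<bullet> h)) *\<^sub>R grad u x + sqrt (a (u x)) *\<^sub>R Hu x h" for x h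
  have chain: "((\<lambda>x. f (u x)) has_derivative (\<lambda>h. f' * (grad u x \<bullet> h))) (at x)"
    if "x \<in> \<Omega>" "(f has_real_derivative f') (at (u x))" for f f' x
    using has_derivative_compose[OF du[OF that(1)], of f "\<lambda>h. f' * h"] that(2)
    by (simp add: has_field_derivative_def)
  have cu: "continuous_on \<Omega> u"
    using du by (meson continuous_at_imp_continuous_on has_derivative_continuous)
  have cgu: "continuous_on \<Omega> (grad u)"
    using dG by (meson continuous_at_imp_continuous_on has_derivative_continuous)
  have ca: "continuous_on UNIV a"
    unfolding assms(4) using assms(3) by (intro continuous_intros continuous_on_powr') auto
  have "semilinear_problem \<Omega> \<psi> F F' v Gv Hv"
  proof
    fix x assume x: "x \<in> \<Omega>"
    show "(v has_derivative (\<bullet>) (Gv x)) (at x)"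
    proof -
      have "(\<lambda>h. sqrt (a (u x)) * (grad u x \<bullet> h)) = (\<bullet>) (Gv x)" by (auto simp: Gv_def)
      then show ?thesis using chain[OF x A(1)] unfolding v_def by simp
    qed
    have sa: "((\<lambda>t. sqrt (a t)) has_real_derivative a' (u x) / (2 * sqrt (a (u x)))) (at (u x))"
      using DERIV_chain2[OF DERIV_real_sqrt[OF apos] da[OF sol(4)[OF x]]] apos[of "u x"]
      by (simp add: field_simps)
    from has_derivative_scaleR[OF chain[OF x sa] dG[OF x]]
    show "(Gv has_derivative Hv x) (at x)"
      by (simp add: Gv_def[abs_def] Hv_def[abs_def] add.commute)
    show "0 < v x" using strict_monoD[OF A(3), of 0 "u x"] A(2) sol(4)[OF x] by (simp add: v_def)
    have "((\<lambda>y. a (u y) *\<^sub>R grad u y) has_derivative (\<lambda>h. a (u x) *\<^sub>R Hu x h + (a' (u x) * (grad u x \<bullet> h)) *\<^sub>R grad u x)) (at x)"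
      by (rule has_derivative_scaleR[OF chain[OF x da[OF sol(4)[OF x]]] dG[OF x]])
    then have fd: "frechet_derivative (\<lambda>y. a (u y) *\<^sub>R grad u y) (at x) = (\<lambda>h. a (u x) *\<^sub>R Hu x h + (a' (u x) * (grad u x \<bullet> h)) *\<^sub>R grad u x)"
      by (rule frechet_derivative_at[symmetric])
    define L where "L = (\<Sum>b\<in>Basis. Hu x b \<bullet> b)"
    define g2 where "g2 = (norm (grad u x))\<^sup>2"
    have "divergence (\<lambda>y. a (u y) *\<^sub>R grad u y) x = a (u x) * L + a' (u x) * g2"
      unfolding divergence_def fd L_def g2_def sum_inner_squares[symmetric]
      by (simp add: inner_add_left sum.distrib sum_distrib_left mult.assoc)
    moreover have "deriv a (u x) = a' (u x)" using da[OF sol(4)[OF x]] by (rule DERIV_imp_deriv)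
    ultimately have eq: "- (a (u x) * L + a' (u x) * g2) + a' (u x) / 2 * g2 = \<psi> (norm x) * u x powr p"
      using sol(3)[OF x] by (simp add: g2_def)
    have "(\<Sum>b\<in>Basis. Hv x b \<bullet> b) = a' (u x) / (2 * sqrt (a (u x))) * g2 + sqrt (a (u x)) * L"
      unfolding Hv_def L_def g2_def sum_inner_squares[symmetric]
      by (simp add: inner_add_left sum.distrib sum_distrib_left mult.assoc)
    moreover define s where "s = sqrt (a (u x))"
    have s: "s > 0" "a (u x) = s * s" using apos[of "u x"] by (auto simp: s_def)
    (* Divided by sqrt (a (u x)), the quasi-linear equation loses its gradient term. *)
    ultimately have "- (\<Sum>b\<in>Basis. Hv x b \<bullet> b) = (- (a (u x) * L + a' (u x) * g2) + a' (u x) / 2 * g2) / s"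
      unfolding s_def[symmetric] s(2) by (simp add: field_simps)
    also have "\<dots> = \<psi> (norm x) * F (v x)"
      unfolding eq v_def FA[OF sol(4)[OF x]] s_def by simp
    finally show "- (\<Sum>b\<in>Basis. Hv x b \<bullet> b) = \<psi> (norm x) * F (v x)" .
  next
    fix h
    have "continuous_on \<Omega> (\<lambda>x. a' (u x))"
      unfolding a'_def by (intro continuous_intros cu) (use sol(4) in force)
    moreover have "continuous_on \<Omega> (\<lambda>x. a (u x))" by (intro continuous_on_compose2[OF ca cu]) auto
    ultimately show "continuous_on \<Omega> (\<lambda>x. Hv x h)"
      unfolding Hv_def using apos by (intro continuous_intros cgu cH) (auto simp: less_imp_neq[symmetric])
  next
    have "continuous_on UNIV A" using A(1) by (intro continuous_at_imp_continuous_on ballI DERIV_isCont) blast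
    then show "continuous_on (closure \<Omega>) v"
      unfolding v_def using sol(2) by (rule continuous_on_compose2) auto
  next
    show "v x = 0" if "x \<in> frontier \<Omega>" for x using sol(5)[OF that] A(2) by (simp add: v_def)
    show "continuous_on UNIV \<psi>" "\<And>t. \<psi> t > 0" using assms(6,7) by auto
  qed (use dom F in auto)
  then interpret semilinear_problem \<Omega> \<psi> F F' v Gv Hv .
  have pot: "potential x = deriv (semilin_nonlin a \<psi> p x) (inv (change_var a) (u x))" if "x \<in> \<Omega>" for x
    using deriv_semilin_nonlin[OF R positive[OF that], of \<psi> x]
    by (simp add: potential_def A_def[symmetric] F'_def[symmetric] v_def)
  interpret morse_index_one_problem \<Omega> \<psi> F F' v Gv Hv
  proof
    show "K \<inter> L \<noteq> {}" if "C1_compact K \<phi> E" "K \<subseteq> \<Omega>" "quadratic_form potential \<phi> E < 0"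
      "C1_compact L \<xi> E'" "L \<subseteq> \<Omega>" "quadratic_form potential \<xi> E' < 0" for K \<phi> E L \<xi> E'
    proof
      assume KL: "K \<inter> L = {}"
      have "2 \<le> morse_index \<Omega> a \<psi> p u"
        by (rule morse_index_ge_2[OF open_domain continuous_potential that KL]) (rule pot)
      then show False using assms(9) by (simp add: one_enat_def numeral_eq_enat)
    qed
  qed
  have uv: "u x = u y \<longleftrightarrow> v x = v y" for x y
    using strict_mono_eq[OF A(3)] by (simp add: v_def)
  have max: "v x \<le> v P" if "x \<in> \<Omega>" for x
    using assms(11) that A(3) by (simp add: v_def strict_mono_less_eq)
  have dim: "DIM(real ^ 'n) \<ge> 2" using assms(1) by simp
  have crit: "Gv x = 0" if "grad u x = 0" for x using that by (simp add: Gv_def)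
  have radialI: "radially_symmetric \<Omega> u" if "\<And>x y. x \<in> \<Omega> \<Longrightarrow> norm y = norm x \<Longrightarrow> v y = v x"
    unfolding radially_symmetric_def uv using that by metis
  have "axially_symmetric \<Omega> u (axis_through P)"
    unfolding axially_symmetric_def axis_through_def uv
  proof (intro allI impI ballI)
    fix T x assume T: "orthogonal_transformation T \<and> (\<forall>y\<in>span {P}. T y = y)" and x: "x \<in> \<Omega>"
    have TP: "T P = P" using T by (simp add: span_base)
    have "T x \<bullet> P = x \<bullet> P" using T TP unfolding orthogonal_transformation_def by metis
    moreover have "norm (T x) = norm x" using T by (simp add: orthogonal_transformation_norm)
    ultimately show "v (T x) = v x" by (intro invariant_about_max[OF assms(10) max x]) auto
  qed
  moreover have "radially_symmetric \<Omega> u" if "P = 0"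
    by (rule radialI, rule invariant_about_max[OF assms(10) max]) (use that in auto)
  moreover have "radially_symmetric \<Omega> u"
    if "e \<noteq> 0" "\<not> axis_through P \<subseteq> {x. e \<bullet> x = 0}" "hyperplane_symmetric \<Omega> u e" for e
  proof -
    have "P \<bullet> e \<noteq> 0"
      using that(2) by (auto simp: axis_through_def span_singleton inner_commute)
    moreover have "mirror_symmetric e"
      using that(3) unfolding hyperplane_symmetric_def mirror_symmetric_def uv reflect_def[symmetric] .
    ultimately show ?thesis by (intro radialI radial_if_tilted_symmetry[OF assms(10) max dim])
  qed
  moreover have "radially_symmetric \<Omega> u" if "x \<in> \<Omega>" "grad u x = 0" "x \<notin> axis_through P" for x
    by (rule radialI, rule radial_if_critical_off_axis[OF assms(10) max dim that(1) crit[OF that(2)]])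
      (use that(3) in \<open>auto simp: axis_through_def\<close>)
  ultimately show ?thesis by blast
qed

end
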